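(* Assume $q>4$. Let $v$ be a point of the affine line over $\mathbb F_q$ (a prime of $A=\mathbb F_q[t]$) and let $n$ be an effective divisor on the affine line (an ideal of $A$) whose support does not contain $v$. Then the map $$M^2_{2,1}(\Gamma(n))(C)\oplus M^2_{2,1}(\Gamma(n))(C)\to M^2_{2,1}(\Gamma_0(v)\cap\Gamma(n))(C),\qquad (f,g)\mapsto\pi^*f+\pi'^*g,$$ induced by the projections $\pi$ and $\pi'$, is injective.
   Context: $K=\mathbb F_q(t)$, $K_\infty=\mathbb F_q((1/t))$, $C$ the completion of an algebraic closure of $K_\infty$, $\Omega=C-K_\infty$ with $\mathrm{GL}(2,K_\infty)$ acting by fractional linear transformations. For an arithmetic subgroup $\Gamma\subset\mathrm{GL}(2,K)$, $\bar M_\Gamma$ is the smooth projective curve over $C$ compactifying $\Gamma\backslash\Omega$, and $M^2_{2,1}(\Gamma)(C)$ is the space of doubly cuspidal Drinfeld modular forms of weight $2$ and type $1$ for $\Gamma$, identified with $H^0(\bar M_\Gamma,\Omega^1)$ (equivalently with the cotangent space of $\mathrm{Jac}(\bar M_\Gamma)$). $\Gamma(m)=\{\gamma\in\mathrm{SL}(2,A):\gamma\equiv1\bmod m\}$, $\Gamma_0(m)=\{\gamma\in\mathrm{SL}(2,A):\gamma\equiv\begin{pmatrix}*&*\\0&*\end{pmatrix}\bmod m\}$. $\pi_v\in A$ is the monic irreducible generator of $v$. $\pi:\bar M_{\Gamma_0(v)\cap\Gamma(n)}\to\bar M_{\Gamma(n)}$ is the natural projection, $w_v$ the involution of $\bar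 M_{\Gamma_0(v)\cap\Gamma(n)}$ induced by $\begin{pmatrix}0&1\\-1&0\end{pmatrix}\begin{pmatrix}\pi_v&0\\0&1\end{pmatrix}$, and $\pi'=\pi\circ w_v$; $\pi^*$, $\pi'^*$ denote pull-back of differential forms. *)

theory Defs
  imports
    "HOL-Algebra.Algebraic_Closure_Type"
    "HOL-Computational_Algebra.Formal_Laurent_Series"
    "HOL-Analysis.Analysis"
begin

text \<open>
  The finite field \<open>F\<^sub>q\<close> is a type \<open>'k\<close> of class \<^class>\<open>field\<close> and \<^class>\<open>finite\<close>, so
  \<open>q = CARD('k)\<close>; \<open>A = F\<^sub>q[t]\<close> is \<^typ>\<open>'k poly\<close>; and \<open>K\<^sub>\<infinity> = F\<^sub>q((1/t))\<close> is \<^typ>\<open>'k fls\<close>, the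
  formal variable of the Laurent series being \<open>1/t\<close>.  Thus \<open>t\<close> is \<^const>\<open>fls_X_inv\<close> and the
  absolute value is normalised by \<open>\<bar>t\<bar> = q\<close>.
\<close>

definition abs_infinity :: "'k::{field,finite} fls \<Rightarrow> real" where
  "abs_infinity x = (if x = 0 then 0 else real CARD('k) powi (- fls_subdegree x))"

definition A_to_Kinf :: "'k::field poly \<Rightarrow> 'k fls" where
  "A_to_Kinf p = poly (map_poly fls_const p) fls_X_inv"

text \<open>\<open>K = F\<^sub>q(t)\<close> is realised as a subfield of \<open>K\<^sub>\<infinity>\<close>.\<close>

definition K_in_Kinf :: "'k::field fls set" where
  "K_in_Kinf = {A_to_Kinf a / A_to_Kinf b | a b. b \<noteq> 0}"

definition mat2 :: "'a \<Rightarrow> 'a \<Rightarrow> 'a \<Rightarrow> 'a \<Rightarrow> 'a::zero ^ 2 ^ 2" where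
  "mat2 a b c d = vector [vector [a, b], vector [c, d]]"

definition matrix_to_Kinf :: "'k::field poly ^ 2 ^ 2 \<Rightarrow> 'k fls ^ 2 ^ 2" where
  "matrix_to_Kinf M = (\<chi> i j. A_to_Kinf (M $ i $ j))"

definition GL2_K :: "('k::field fls ^ 2 ^ 2) set" where
  "GL2_K = {M. det M \<noteq> 0 \<and> (\<forall>i j. M $ i $ j \<in> K_in_Kinf)}"

text \<open>An ideal \<open>m\<close> of the principal ideal domain \<open>A\<close> is given by a generator.\<close>

definition Gamma_principal :: "'k::field poly \<Rightarrow> ('k fls ^ 2 ^ 2) set" where
  "Gamma_principal m = matrix_to_Kinf ` {M. det M = 1 \<and> (\<forall>i j. m dvd (M - mat 1) $ i $ j)}"

definition Gamma0 :: "'k::field poly \<Rightarrow> ('k fls ^ 2 ^ 2) set" where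
  "Gamma0 m = matrix_to_Kinf ` {M. det M = 1 \<and> m dvd M $ 2 $ 1}"

definition atkin_lehner_matrix :: "'k::field poly \<Rightarrow> 'k fls ^ 2 ^ 2" where
  "atkin_lehner_matrix p = matrix_to_Kinf (mat2 0 1 (- 1) 0 ** mat2 p 0 0 1)"

text \<open>
  The field \<open>C\<close> with its absolute value is the completion of an algebraic closure of \<open>K\<^sub>\<infinity>\<close>: it is
  complete, and the algebraic closure is a dense subfield on which the absolute value extends
  that of \<open>K\<^sub>\<infinity>\<close>.  This determines \<open>C\<close> up to isometric isomorphism.
\<close>

locale completed_alg_closure =
  fixes av :: "'c::field \<Rightarrow> real"
    and emb :: "'k::{field,finite} fls alg_closure \<Rightarrow> 'c"
  assumes av_nonneg: "\<And>x. av x \<ge> 0"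
    and av_eq_0_iff: "\<And>x. av x = 0 \<longleftrightarrow> x = 0"
    and av_mult: "\<And>x y. av (x * y) = av x * av y"
    and av_ultrametric: "\<And>x y. av (x + y) \<le> max (av x) (av y)"
    and av_complete:
      "\<And>y. (\<forall>e>0. \<exists>N. \<forall>i\<ge>N. \<forall>j\<ge>N. av (y i - y j) < e)
        \<Longrightarrow> \<exists>l. (\<lambda>i::nat. av (y i - l)) \<longlonglongrightarrow> 0"
    and emb_1: "emb 1 = 1"
    and emb_add: "\<And>a b. emb (a + b) = emb a + emb b"
    and emb_mult: "\<And>a b. emb (a * b) = emb a * emb b"
    and emb_dense: "\<And>x e. e > 0 \<Longrightarrow> \<exists>a. av (x - emb a) < e"
    and av_Kinf: "\<And>s. av (emb (to_ac s)) = abs_infinity s"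
begin

definition iota :: "'k fls \<Rightarrow> 'c" where
  "iota s = emb (to_ac s)"

definition Omega :: "'c set" where
  "Omega = UNIV - range iota"

definition mobius :: "'k fls ^ 2 ^ 2 \<Rightarrow> 'c \<Rightarrow> 'c" where
  "mobius M z = (iota (M$1$1) * z + iota (M$1$2)) / (iota (M$2$1) * z + iota (M$2$2))"

text \<open>The exhaustion of \<open>\<Omega>\<close> by affinoids, which is an admissible covering.\<close>

definition Omega_affinoid :: "nat \<Rightarrow> 'c set" where
  "Omega_affinoid r =
    {z. av z \<le> real CARD('k) ^ r \<and> (\<forall>s. av (z - iota s) \<ge> 1 / real CARD('k) ^ r)}"

text \<open>
  Rigid analytic functions on \<open>\<Omega>\<close>: on each affinoid of the covering, a uniform limit of rational
  functions without poles there.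
\<close>

definition rigid_analytic :: "('c \<Rightarrow> 'c) \<Rightarrow> bool" where
  "rigid_analytic f \<longleftrightarrow>
    (\<forall>r. \<forall>e>0. \<exists>p d. \<forall>z\<in>Omega_affinoid r.
       poly d z \<noteq> 0 \<and> av (f z - poly p z / poly d z) < e)"

text \<open>
  Functions on \<open>\<Omega>\<close> are represented by functions on \<open>C\<close> that vanish outside \<open>\<Omega>\<close>.
  The operator below is \<open>(f[M])(z) = (det M)\<^sup>m (c z + d)\<^sup>-\<^sup>k f(M z)\<close> for weight \<open>k\<close> and type \<open>m\<close>.
\<close>

definition slash :: "nat \<Rightarrow> nat \<Rightarrow> ('c \<Rightarrow> 'c) \<Rightarrow> 'k fls ^ 2 ^ 2 \<Rightarrow> 'c \<Rightarrow> 'c" where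
  "slash k m f M z =
    (if z \<in> Omega
     then iota (det M) ^ m / (iota (M$2$1) * z + iota (M$2$2)) ^ k * f (mobius M z) else 0)"

text \<open>
  The lattice of translations in \<open>N\<^sup>-\<^sup>1 \<Gamma> N\<close>, and its exponential function
  \<open>e\<^sub>L(z) = z \<Prod>\<^bsub>\<lambda> \<in> L, \<lambda> \<noteq> 0\<^esub> (1 - z / \<lambda>)\<close>, the product being taken over balls of growing radius.
\<close>

definition cusp_lattice :: "('k fls ^ 2 ^ 2) set \<Rightarrow> 'k fls ^ 2 ^ 2 \<Rightarrow> 'k fls set" where
  "cusp_lattice G N = {b. \<exists>M\<in>G. M ** N = N ** mat2 1 b 0 1}"

definition lattice_exp :: "'k fls set \<Rightarrow> 'c \<Rightarrow> 'c" where
  "lattice_exp L z =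
    (THE w. (\<lambda>r::nat.
       av (z * (\<Prod>b\<in>{b\<in>L. b \<noteq> 0 \<and> abs_infinity b \<le> real r}. 1 - z / iota b) - w)) \<longlonglongrightarrow> 0)"

text \<open>
  \<open>f\<close> has, for large \<open>\<bar>z\<bar>\<^sub>i = inf {\<bar>z - s\<bar> | s \<in> K\<^sub>\<infinity>}\<close>, an expansion \<open>\<Sum>\<^bsub>i \<ge> 2\<^esub> a\<^sub>i u(z)\<^sup>i\<close> in the
  parameter \<open>u = 1 / e\<^sub>L\<close> at infinity.
\<close>

definition doubly_vanishes_at_infinity :: "'k fls set \<Rightarrow> ('c \<Rightarrow> 'c) \<Rightarrow> bool" where
  "doubly_vanishes_at_infinity L f \<longleftrightarrow>
    (\<exists>a R. a 0 = 0 \<and> a 1 = 0 \<and>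
      (\<forall>z\<in>Omega. (\<forall>s. av (z - iota s) \<ge> R) \<longrightarrow>
        (\<lambda>j. av ((\<Sum>i<j. a i * (1 / lattice_exp L z) ^ i) - f z)) \<longlonglongrightarrow> 0))"

text \<open>
  \<open>M\<^sup>2\<^bsub>k,m\<^esub>(\<Gamma>)(C)\<close>.  Since \<open>GL(2,K)\<close> is transitive on \<open>P\<^sup>1(K)\<close>, letting \<open>N\<close> range over it covers
  every cusp.
\<close>

definition double_cusp_forms :: "nat \<Rightarrow> nat \<Rightarrow> ('k fls ^ 2 ^ 2) set \<Rightarrow> ('c \<Rightarrow> 'c) set" where
  "double_cusp_forms k m G =
    {f. (\<forall>z. z \<notin> Omega \<longrightarrow> f z = 0) \<and> rigid_analytic f \<and>
        (\<forall>M\<in>G. slash k m f M = f) \<and>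
        (\<forall>N\<in>GL2_K. doubly_vanishes_at_infinity (cusp_lattice G N) (slash k m f N))}"

text \<open>
  A form \<open>f\<close> of weight 2 and type 1 is identified with the differential form \<open>f(z) dz\<close>.  As
  \<open>d(M z) = det M / (c z + d)\<^sup>2 dz\<close>, the following is the coefficient of \<open>dz\<close> in the pull-back of
  \<open>f(z) dz\<close> along the automorphism \<open>z \<mapsto> M z\<close> of \<open>\<Omega>\<close>.
\<close>

definition pullback :: "'k fls ^ 2 ^ 2 \<Rightarrow> ('c \<Rightarrow> 'c) \<Rightarrow> 'c \<Rightarrow> 'c" where
  "pullback M f z =
    (if z \<in> Omega
     then iota (det M) / (iota (M$2$1) * z + iota (M$2$2))\<^sup>2 * f (mobius M z) else 0)"

text \<open>
  The projection \<open>\<pi>\<close> is induced by the identity of \<open>\<Omega>\<close>, and \<open>\<pi>' = \<pi> \<circ> w\<^sub>v\<close>, whence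
  \<open>\<pi>'\<^sup>* = w\<^sub>v\<^sup>* \<circ> \<pi>\<^sup>*\<close>.
\<close>

definition proj_pullback :: "('c \<Rightarrow> 'c) \<Rightarrow> 'c \<Rightarrow> 'c" where
  "proj_pullback = pullback (mat 1)"

definition proj'_pullback :: "'k poly \<Rightarrow> ('c \<Rightarrow> 'c) \<Rightarrow> 'c \<Rightarrow> 'c" where
  "proj'_pullback v = pullback (atkin_lehner_matrix v) \<circ> proj_pullback"

definition degeneracy_map :: "'k poly \<Rightarrow> ('c \<Rightarrow> 'c) \<times> ('c \<Rightarrow> 'c) \<Rightarrow> 'c \<Rightarrow> 'c" where
  "degeneracy_map v = (\<lambda>(f, g) z. proj_pullback f z + proj'_pullback v g z)"

end

end

theory Submission
  imports Defs
begin

text \<open>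
  Injectivity.  If \<open>f + g|W = 0\<close> with \<open>W\<close> the matrix of \<open>w\<^sub>v\<close>, then also \<open>g = - f|W\<close>, as \<open>W\<^sup>2\<close> is scalar.
  Hence \<open>f\<close> and \<open>g\<close> are invariant under \<open>\<Gamma>(n)\<close> and under its conjugate by \<open>W\<close>, and therefore under the
  translations by \<open>n / v\<^sup>j\<close> for all \<open>j\<close>.  These tend to 0, so by the identity principle \<open>f\<close> is locally
  constant on \<open>\<Omega>\<close>; since a lower unipotent element of \<open>\<Gamma>(n)\<close> multiplies \<open>f\<close> by the nonconstant
  automorphy factor \<open>(c z + 1)\<^sup>2\<close>, \<open>f = 0\<close>.

  The identity principle rests on a Schwarz lemma for uniform limits of rational functions on a
  disc: \<open>C\<close> is algebraically closed with dense value group, so the coefficients of a polynomial are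
  controlled by its value at any point whose absolute value is not that of a root.

  The image.  The translation lattice \<open>L'\<close> of \<open>\<Gamma>\<^sub>0(v) \<inter> \<Gamma>(n)\<close> at a cusp equals that of
  \<open>\<Gamma>(n)\<close>, say \<open>L = \<alpha> A\<close>, or \<open>v L\<close>.  In the second case
  \<open>e\<^sub>L = e\<^bsub>L'\<^esub> \<Prod>\<^sub>c (1 - e\<^bsub>L'\<^esub> / e\<^bsub>L'\<^esub>(c))\<close>, so that \<open>1 / e\<^sub>L\<close> is a power series in \<open>1 / e\<^bsub>L'\<^esub>\<close>.
\<close>

text \<open>The translations accumulate because \<open>\<Gamma>(n)\<close> and its conjugate by
  \<open>W\<close> lie in SL(2, A[1/v]), a group that is discrete only when the place v is
  considered together with infinity. The obstacle is the meaning of analytic: a form is merely a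
  uniform limit of rational functions of unbounded degree, and neither zeros nor periods of the
  limit are inherited by its approximants. Every estimate must therefore tolerate an error at the
  prescribed zeros and must not depend on the degree. For the image, an expansion at a cusp is known
  only as a convergent sum for each z far from K_inf, so growth of its coefficients has to be
  extracted from convergence at one point before another parameter can be substituted.\<close>

no_notation fps_nth (infixl \<open>$\<close> 75)

section \<open>Ultrametric estimates and limits in C\<close>

context completed_alg_closure
begin

lemma av_0 [simp]: "av 0 = 0"
  by (simp add: av_eq_0_iff)

lemma av_pos: "x \<noteq> 0 \<Longrightarrow> av x > 0"
  using av_nonneg[of x] av_eq_0_iff[of x] by linarith

lemma av_1 [simp]: "av 1 = 1"
proof -
  have "av 1 * av 1 = av 1" using av_mult[of 1 1] by simp
  thus ?thesis using av_pos[of 1] by simp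
qed

lemma av_minus [simp]: "av (- x) = av x"
proof -
  have "av (-1) ^ 2 = 1" using av_mult[of "-1" "-1"] by (simp add: power2_eq_square)
  hence "av (-1) = 1" using av_nonneg[of "-1"] power2_eq_1_iff by fastforce
  thus ?thesis using av_mult[of "-1" x] by simp
qed

lemma av_diff_le: "av (x - y) \<le> max (av x) (av y)"
  using av_ultrametric[of x "- y"] by simp

lemma av_diff_commute: "av (x - y) = av (y - x)"
  using av_minus[of "x - y"] by simp

lemma av_triangle: "av (x - z) \<le> max (av (x - y)) (av (y - z))"
  using av_ultrametric[of "x - y" "y - z"] by simp

lemma av_power: "av (x ^ n) = av x ^ n"
  by (induction n) (simp_all add: av_mult)

lemma av_inverse: "av (inverse x) = inverse (av x)"
proof (cases "x = 0")
  case False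
  hence "av x * av (inverse x) = 1" by (simp flip: av_mult)
  thus ?thesis by (simp add: inverse_unique)
qed simp

lemma av_divide: "av (x / y) = av x / av y"
  by (simp add: field_class.field_divide_inverse av_mult av_inverse divide_inverse)

lemma av_prod: "av (prod f A) = (\<Prod>i\<in>A. av (f i))"
  by (induction A rule: infinite_finite_induct) (simp_all add: av_mult)

lemma av_add_eq:
  assumes "av y < av x"
  shows "av (x + y) = av x"
  using assms av_ultrametric[of x y] av_diff_le[of "x + y" y] by auto

lemma av_diff_eq:
  assumes "av y < av x"
  shows "av (x - y) = av x"
  using assms av_add_eq[of "- y" x] by simp

lemma av_sum_le:
  assumes "\<And>i. i \<in> A \<Longrightarrow> av (f i) \<le> B" "B \<ge> 0"
  shows "av (sum f A) \<le> B"
  using assms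
proof (induction A rule: infinite_finite_induct)
  case (insert x A)
  hence "av (f x) \<le> B" "av (sum f A) \<le> B" by auto
  with insert(1,2) show ?case using av_ultrametric[of "f x" "sum f A"] by simp
qed auto

lemma av_limit_unique:
  assumes "(\<lambda>i. av (y i - a)) \<longlonglongrightarrow> 0" "(\<lambda>i. av (y i - b)) \<longlonglongrightarrow> 0"
  shows "a = b"
proof -
  have "(\<lambda>i. max (av (y i - a)) (av (y i - b))) \<longlonglongrightarrow> max 0 0"
    using assms by (intro tendsto_max)
  moreover have "av (a - b) \<le> max (av (y i - a)) (av (y i - b))" for i
    using av_triangle[of a b "y i"] by (simp add: av_diff_commute)
  ultimately have "av (a - b) \<le> 0"
    by (intro tendsto_lowerbound[of _ 0 sequentially]) auto
  thus ?thesis using av_nonneg[of "a - b"] av_eq_0_iff[of "a - b"] by simp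
qed

text \<open>A telescoping sum is bounded by its largest term, so null consecutive differences
  already give a Cauchy sequence.\<close>

lemma av_ultrametric_Cauchy:
  assumes "(\<lambda>i. av (y (Suc i) - y i)) \<longlonglongrightarrow> 0"
  shows "\<exists>l. (\<lambda>i. av (y i - l)) \<longlonglongrightarrow> 0"
proof (rule av_complete, intro allI impI)
  fix e :: real assume "e > 0"
  then obtain N where N: "\<And>i. i \<ge> N \<Longrightarrow> av (y (Suc i) - y i) < e"
    using order_tendstoD(2)[OF assms, of e] by (auto simp: eventually_sequentially)
  have A: "av (y (N + k) - y N) < e" for k
  proof (induction k)
    case (Suc k)
    have "av (y (N + Suc k) - y N) \<le> max (av (y (Suc (N + k)) - y (N + k))) (av (y (N + k) - y N))"
      using av_triangle by simp
    also have "\<dots> < e" using Suc N[of "N + k"] by simp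
    finally show ?case .
  qed (use \<open>e > 0\<close> in simp)
  have B: "av (y i - y N) < e" if "i \<ge> N" for i
    using A[of "i - N"] that by simp
  have "av (y i - y j) < e" if "i \<ge> N" "j \<ge> N" for i j
    using B[OF that(1)] B[OF that(2)] av_triangle[of "y i" "y j" "y N"]
    by (simp add: av_diff_commute)
  thus "\<exists>N. \<forall>i\<ge>N. \<forall>j\<ge>N. av (y i - y j) < e" by blast
qed

lemma av_limit_mult:
  assumes "(\<lambda>i. av (y i - a)) \<longlonglongrightarrow> 0" "(\<lambda>i. av (z i - b)) \<longlonglongrightarrow> 0"
  shows "(\<lambda>i. av (y i * z i - a * b)) \<longlonglongrightarrow> 0"
proof (rule Lim_null_comparison)
  show "(\<lambda>i. max (max (av (y i - a) * av (z i - b)) (av (y i - a) * av b)) (av a * av (z i - b))) \<longlonglongrightarrow> 0"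
    using tendsto_max[OF tendsto_max[OF tendsto_mult[OF assms] tendsto_mult_right[OF assms(1)]]
      tendsto_mult_left[OF assms(2)], of "av b" "av a"] by simp
  have "av (y i * z i - a * b)
      \<le> max (max (av (y i - a) * av (z i - b)) (av (y i - a) * av b)) (av a * av (z i - b))" for i
  proof -
    have "y i * z i - a * b = ((y i - a) * (z i - b) + (y i - a) * b) + a * (z i - b)"
      by (simp add: algebra_simps)
    thus ?thesis
      using av_ultrametric[of "(y i - a) * (z i - b) + (y i - a) * b" "a * (z i - b)"]
        av_ultrametric[of "(y i - a) * (z i - b)" "(y i - a) * b"]
      unfolding av_mult by (auto simp: av_mult)
  qed
  thus "\<forall>\<^sub>F i in sequentially. norm (av (y i * z i - a * b))
      \<le> max (max (av (y i - a) * av (z i - b)) (av (y i - a) * av b)) (av a * av (z i - b))"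
    by (intro always_eventually) (simp add: av_nonneg)
qed

lemma av_limit_add:
  assumes "(\<lambda>i. av (y i - a)) \<longlonglongrightarrow> 0" "(\<lambda>i. av (z i - b)) \<longlonglongrightarrow> 0"
  shows "(\<lambda>i. av (y i + z i - (a + b))) \<longlonglongrightarrow> 0"
proof (rule Lim_null_comparison)
  show "(\<lambda>i. max (av (y i - a)) (av (z i - b))) \<longlonglongrightarrow> 0"
    using tendsto_max[OF assms] by simp
  have "av (y i + z i - (a + b)) \<le> max (av (y i - a)) (av (z i - b))" for i
    using av_ultrametric[of "y i - a" "z i - b"] by (simp add: algebra_simps)
  thus "\<forall>\<^sub>F i in sequentially. norm (av (y i + z i - (a + b))) \<le> max (av (y i - a)) (av (z i - b))"
    by (intro always_eventually) (simp add: av_nonneg)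
qed

lemma av_limit_norm:
  assumes "(\<lambda>i. av (y i - a)) \<longlonglongrightarrow> 0"
  shows "(\<lambda>i. av (y i)) \<longlonglongrightarrow> av a"
proof -
  have "\<bar>av (y i) - av a\<bar> \<le> av (y i - a)" for i
    using av_ultrametric[of "y i - a" a] av_ultrametric[of "a - y i" "y i"]
      av_nonneg[of "y i - a"] av_nonneg[of a] av_nonneg[of "y i"]
    by (simp add: av_diff_commute max_def split: if_splits)
  hence "(\<lambda>i. av (y i) - av a) \<longlonglongrightarrow> 0"
    by (intro Lim_null_comparison[OF _ assms]) (simp add: always_eventually)
  thus ?thesis by (simp add: LIM_zero_iff)
qed

lemma emb_0 [simp]: "emb 0 = 0"
  using emb_add[of 0 0] by (metis add.right_neutral add_left_cancel)

lemma emb_minus: "emb (- a) = - emb a"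
  using emb_add[of a "- a"] by (simp add: eq_neg_iff_add_eq_0 add.commute)

lemma emb_diff: "emb (a - b) = emb a - emb b"
  using emb_add[of a "- b"] by (simp add: emb_minus)

lemma emb_power: "emb (a ^ n) = emb a ^ n"
  by (induction n) (simp_all add: emb_1 emb_mult)

lemma emb_poly: "emb (poly p a) = poly (map_poly emb p) (emb a)"
  by (induction p) (simp_all add: emb_add emb_mult map_poly_pCons)

lemma iota_0 [simp]: "iota 0 = 0" and iota_1 [simp]: "iota 1 = 1"
  and iota_add: "iota (a + b) = iota a + iota b"
  and iota_mult: "iota (a * b) = iota a * iota b"
  and iota_minus: "iota (- a) = - iota a"
  and iota_diff: "iota (a - b) = iota a - iota b"
  and iota_power: "iota (a ^ m) = iota a ^ m"
  by (simp_all add: iota_def emb_1 emb_add emb_mult emb_minus emb_diff emb_power)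

lemma av_iota: "av (iota s) = abs_infinity s"
  by (simp add: iota_def av_Kinf)

lemma iota_eq_0_iff [simp]: "iota s = 0 \<longleftrightarrow> s = 0"
proof -
  have "iota s = 0 \<longleftrightarrow> av (iota s) = 0" by (simp add: av_eq_0_iff)
  also have "\<dots> \<longleftrightarrow> s = 0" unfolding av_iota abs_infinity_def by auto
  finally show ?thesis .
qed

lemma iota_eq_iff [simp]: "iota s = iota s' \<longleftrightarrow> s = s'"
  using iota_eq_0_iff[of "s - s'"] by (simp add: iota_diff)

lemma iota_divide: "iota (a / b) = iota a / iota b"
proof (cases "b = 0")
  case False
  hence "iota (a / b) * iota b = iota a" by (simp flip: iota_mult)
  thus ?thesis using False by (simp add: field_simps)
qed simp

subsection \<open>Algebraic closedness of the completion\<close>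

lemma av_poly_le:
  assumes "\<And>k. av (coeff p k) * r ^ k \<le> S" "av x \<le> r"
  shows "av (poly p x) \<le> S"
  unfolding poly_altdef
proof (rule av_sum_le)
  fix k
  have "av (coeff p k * x ^ k) \<le> av (coeff p k) * r ^ k"
    using assms(2) av_nonneg by (auto simp: av_mult av_power intro!: mult_left_mono power_mono)
  thus "av (coeff p k * x ^ k) \<le> S" using assms(1)[of k] by simp
next
  have "0 \<le> av (coeff p 0) * r ^ 0" using av_nonneg by simp
  thus "S \<ge> 0" using assms(1)[of 0] by simp
qed

text \<open>A single \<open>K\<close> bounds both values and difference quotients, because the
  product rule for \<open>x * poly p x\<close> needs the former to propagate the latter.\<close>

lemma poly_Lipschitz_on_ball:
  assumes "B \<ge> 0"
  shows "\<exists>K\<ge>0. \<forall>x y. av x \<le> B \<longrightarrow> av y \<le> B \<longrightarrow>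
           av (poly p x) \<le> K \<and> av (poly p x - poly p y) \<le> K * av (x - y)"
proof (induction p)
  case (pCons c p)
  then obtain K where K: "K \<ge> 0" "\<And>x y. av x \<le> B \<Longrightarrow> av y \<le> B \<Longrightarrow>
           av (poly p x) \<le> K \<and> av (poly p x - poly p y) \<le> K * av (x - y)" by blast
  let ?K = "max (max (av c) (B * K)) K"
  show ?case
  proof (intro exI[of _ ?K] conjI allI impI)
    fix x y assume xy: "av x \<le> B" "av y \<le> B"
    have "av (x * poly p x) \<le> B * K"
      unfolding av_mult using xy K av_nonneg assms by (intro mult_mono) auto
    thus "av (poly (pCons c p) x) \<le> ?K"
      using av_ultrametric[of c "x * poly p x"] by simp
    have eq: "poly (pCons c p) x - poly (pCons c p) y
        = x * (poly p x - poly p y) + (x - y) * poly p y" by (simp add: algebra_simps)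
    have "av (x * (poly p x - poly p y)) \<le> B * (K * av (x - y))"
      unfolding av_mult using xy K av_nonneg assms by (intro mult_mono) auto
    also have "\<dots> \<le> ?K * av (x - y)"
      using av_nonneg[of "x - y"] by (simp add: mult_right_mono flip: mult.assoc)
    finally have 1: "av (x * (poly p x - poly p y)) \<le> ?K * av (x - y)" .
    have "av ((x - y) * poly p y) \<le> av (x - y) * ?K"
      unfolding av_mult using K(2)[OF xy(2,2)] av_nonneg[of "x - y"] by (intro mult_left_mono) auto
    hence 2: "av ((x - y) * poly p y) \<le> ?K * av (x - y)" by (simp add: mult.commute)
    show "av (poly (pCons c p) x - poly (pCons c p) y) \<le> ?K * av (x - y)"
      unfolding eq using 1 2 av_ultrametric[of "x * (poly p x - poly p y)" "(x - y) * poly p y"] by simp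
  qed (use K in auto)
qed (auto intro: exI[of _ 0])

text \<open>Quantitative continuity of roots: \<open>P\<close> is a product of linear factors, so
  |P(a)| is the product of the distances from \<open>a\<close> to the roots, and these cannot all
  exceed \<open>d\<close>.\<close>

lemma exists_close_root:
  fixes P :: "'k fls alg_closure poly"
  assumes "lead_coeff P = 1" "degree P > 0" "d > 0" "av (emb (poly P a)) \<le> d ^ degree P"
  shows "\<exists>b. poly P b = 0 \<and> av (emb a - emb b) \<le> d"
proof -
  obtain A where A: "size A = degree P" "P = (\<Prod>x\<in>#A. [:-x, 1:])"
    using alg_closed_imp_factorization[of P] assms(1)
    by (metis coeff_0 smult_1_left zero_neq_one)
  have *: "d ^ size A < av (emb (poly (\<Prod>x\<in>#A. [:-x, 1:]) a))"
    if "\<forall>x\<in>#A. av (emb a - emb x) > d" "A \<noteq> {#}" for A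
    using that
  proof (induction A)
    case (add x A)
    have "av (emb (poly (\<Prod>x\<in>#add_mset x A. [:-x, 1:]) a))
        = av (emb a - emb x) * av (emb (poly (\<Prod>x\<in>#A. [:-x, 1:]) a))"
    proof -
      have "poly (\<Prod>x\<in>#add_mset x A. [:-x, 1:]) a = (a - x) * poly (\<Prod>x\<in>#A. [:-x, 1:]) a"
        by (simp add: algebra_simps)
      thus ?thesis by (simp only: emb_mult av_mult emb_diff)
    qed
    moreover have "d ^ size A \<le> av (emb (poly (\<Prod>x\<in>#A. [:-x, 1:]) a))"
      using add by (cases "A = {#}") (auto simp: emb_1 intro: less_imp_le)
    moreover have "d < av (emb a - emb x)" using add by auto
    ultimately show ?case using \<open>d > 0\<close> by (auto intro!: mult_less_le_imp_less)
  qed auto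
  have "A \<noteq> {#}" using A assms by auto
  have "\<not> (\<forall>x\<in>#A. av (emb a - emb x) > d)"
  proof
    assume "\<forall>x\<in>#A. av (emb a - emb x) > d"
    hence "d ^ degree P < av (emb (poly P a))"
      using *[of A] \<open>A \<noteq> {#}\<close> by (simp flip: A)
    thus False using assms(4) by simp
  qed
  then obtain b where b: "b \<in># A" "av (emb a - emb b) \<le> d"
    by (meson linorder_not_le)
  have "poly P b = (\<Prod>x\<in>#A. poly [:-x, 1:] b)"
    by (subst A(2)) (simp add: poly_prod_mset)
  also have "\<dots> = 0"
    using b(1) by (simp add: prod_mset_zero_iff image_iff) 
  finally show ?thesis using b by blast
qed

text \<open>Approximate \<open>p\<close> by monic polynomials over the dense algebraic closure,
  follow nearby roots from one approximant to the next, and take the limit of the roots by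
  completeness.\<close>

lemma monic_poly_has_root:
  fixes p :: "'c poly"
  assumes "lead_coeff p = 1" and m: "degree p > 0"
  shows "\<exists>x. poly p x = 0"
proof -
  let ?m = "degree p"
  \<comment> \<open>\<open>B\<close> bounds the coefficients of \<open>p\<close>; since it is at
    least 1, it also becomes a common bound for the roots of all approximants.\<close>
  define B where "B = Max (insert 1 ((\<lambda>k. av (coeff p k)) ` {..?m}))"
  have B1: "B \<ge> 1" unfolding B_def by simp
  have Bc: "av (coeff p k) \<le> B" for k
  proof (cases "k \<le> ?m")
    case True thus ?thesis unfolding B_def by (intro Max_ge) auto
  next
    case False thus ?thesis using B1 by (simp add: coeff_eq_0)
  qed
  \<comment> \<open>At points of size at most \<open>B\<close>, a coefficient error
    \<open>e i\<close> costs at most \<open>(1 / 2 ^ i) ^ ?m\<close> in the value; the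
    \<open>?m\<close>-th root of this is the distance to the next root given by
    \<open>exists_close_root\<close>.\<close>
  define e where "e = (\<lambda>i::nat. (1 / 2 ^ i) ^ ?m / B ^ ?m)"
  have e_pos: "e i > 0" for i unfolding e_def using B1 by simp
  have e_le1: "e i \<le> 1" for i
    unfolding e_def power_divide[symmetric] using B1
    by (intro power_le_one) (auto simp: field_simps intro: mult_mono[of 1 B 1 "2 ^ i", simplified])
  have e_dec: "e (Suc i) \<le> e i" for i
    unfolding e_def using B1 by (intro divide_right_mono power_mono) (auto simp: field_simps)
  have "\<exists>P :: 'k fls alg_closure poly. lead_coeff P = 1 \<and> degree P = ?m \<and>
      (\<forall>k. av (coeff p k - emb (coeff P k)) \<le> e i)" for i
  proof -
    obtain a where a: "\<And>k. av (coeff p k - emb (a k)) < e i"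
      using choice[of "\<lambda>k a. av (coeff p k - emb a) < e i"] emb_dense[OF e_pos[of i]] by blast
    define P where "P = monom 1 ?m + (\<Sum>k<?m. monom (a k) k)"
    have cP: "coeff P k = (if k = ?m then 1 else if k < ?m then a k else 0)" for k
      unfolding P_def by (auto simp: coeff_sum sum.delta)
    have "degree P = ?m"
      using degree_le[of ?m P] le_degree[of P ?m] by (simp add: cP)
    moreover have "av (coeff p k - emb (coeff P k)) \<le> e i" for k
      using a[of k] e_pos[of i] assms(1)
      by (auto simp: cP emb_1 coeff_eq_0 intro: less_imp_le)
    ultimately show ?thesis by (intro exI[of _ P]) (simp add: cP)
  qed
  then obtain P where P: "\<And>i. lead_coeff (P i) = 1" "\<And>i. degree (P i) = ?m"
    "\<And>i k. av (coeff p k - emb (coeff (P i) k)) \<le> e i" by metis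
  have P_coeff: "av (emb (coeff (P i) k)) \<le> B" for i k
    using P(3)[of k i] e_le1[of i] B1 Bc[of k] av_diff_le[of "coeff p k" "coeff p k - emb (coeff (P i) k)"]
    by simp
  have root_le: "av (emb b) \<le> B" if "poly (P i) b = 0" for i b
  proof (rule ccontr)
    assume "\<not> ?thesis"
    hence b: "av (emb b) > B" by simp
    have "0 = emb (\<Sum>k\<le>?m. coeff (P i) k * b ^ k)"
      using that by (simp add: poly_altdef P(2))
    also have "(\<Sum>k\<le>?m. coeff (P i) k * b ^ k) = (\<Sum>k<?m. coeff (P i) k * b ^ k) + b ^ ?m"
      using P(1)[of i] P(2)[of i] by (simp add: sum.lessThan_Suc flip: lessThan_Suc_atMost)
    also have "emb \<dots> = (\<Sum>k<?m. emb (coeff (P i) k * b ^ k)) + emb b ^ ?m"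
    proof -
      have "emb (sum f A) = (\<Sum>k\<in>A. emb (f k))" for f and A :: "nat set"
        by (induction A rule: infinite_finite_induct) (auto simp: emb_add)
      thus ?thesis by (simp add: emb_add emb_power)
    qed
    finally have "emb b ^ ?m = - (\<Sum>k<?m. emb (coeff (P i) k * b ^ k))"
      by (simp add: eq_neg_iff_add_eq_0 add.commute)
    hence "av (emb b) ^ ?m = av (\<Sum>k<?m. emb (coeff (P i) k * b ^ k))"
      by (metis av_minus av_power)
    also have "\<dots> \<le> B * av (emb b) ^ (?m - 1)"
    proof (rule av_sum_le)
      fix k assume "k \<in> {..<?m}"
      thus "av (emb (coeff (P i) k * b ^ k)) \<le> B * av (emb b) ^ (?m - 1)"
        unfolding emb_mult av_mult emb_power av_power using P_coeff[of i k] b B1 av_nonneg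
        by (intro mult_mono power_increasing) auto
    qed (use B1 av_nonneg in simp)
    also have "\<dots> < av (emb b) * av (emb b) ^ (?m - 1)"
      using b B1 by (intro mult_strict_right_mono) auto
    also have "\<dots> = av (emb b) ^ ?m" using m by (metis Suc_diff_1 power_Suc)
    finally show False by simp
  qed
  have close: "av (poly p (emb b) - emb (poly (P i) b)) \<le> (1 / 2 ^ i) ^ ?m" if "av (emb b) \<le> B" for i b
  proof -
    have "av (poly (p - map_poly emb (P i)) (emb b)) \<le> e i * B ^ ?m"
    proof (rule av_poly_le[OF _ that])
      fix k
      show "av (coeff (p - map_poly emb (P i)) k) * B ^ k \<le> e i * B ^ ?m"
      proof (cases "k \<le> ?m")
        case True
        thus ?thesis using P(3)[of k i] B1 e_pos[of i] av_nonneg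
          by (auto simp: coeff_map_poly intro!: mult_mono power_increasing)
      next
        case False
        thus ?thesis using P(2)[of i] B1 e_pos[of i] by (simp add: coeff_map_poly coeff_eq_0)
      qed
    qed
    thus ?thesis using B1 by (simp add: e_def emb_poly)
  qed
  have "\<exists>x. \<forall>i. poly (P i) (x i) = 0 \<and> av (emb (x i) - emb (x (Suc i))) \<le> 1 / 2 ^ i"
  proof (rule dependent_nat_choice)
    show "\<exists>x. poly (P 0) x = 0"
      using alg_closed_imp_poly_has_root[of "P 0"] P(2) m by simp
  next
    fix x i assume x: "poly (P i) x = 0"
    have xB: "av (emb x) \<le> B" using root_le[OF x] .
    have "av (emb (poly (P (Suc i)) x))
        \<le> max (av (poly p (emb x))) (av (poly p (emb x) - emb (poly (P (Suc i)) x)))"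
      using av_diff_le[of "poly p (emb x)" "poly p (emb x) - emb (poly (P (Suc i)) x)"] by simp
    also have "\<dots> \<le> (1 / 2 ^ i) ^ ?m"
    proof -
      have "(1 / 2 ^ Suc i :: real) ^ ?m \<le> (1 / 2 ^ i) ^ ?m"
        by (intro power_mono) (auto simp: field_simps)
      thus ?thesis using close[OF xB, of i] close[OF xB, of "Suc i"] x by simp
    qed
    finally have "\<exists>b. poly (P (Suc i)) b = 0 \<and> av (emb x - emb b) \<le> 1 / 2 ^ i"
      using P m by (intro exists_close_root) auto
    thus "\<exists>y. poly (P (Suc i)) y = 0 \<and> av (emb x - emb y) \<le> 1 / 2 ^ i" by blast
  qed
  then obtain x where x: "\<And>i. poly (P i) (x i) = 0"
    "\<And>i. av (emb (x i) - emb (x (Suc i))) \<le> 1 / 2 ^ i" by blast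
  have half: "(\<lambda>i. 1 / 2 ^ i :: real) \<longlonglongrightarrow> 0"
    using LIMSEQ_realpow_zero[of "1 / 2 :: real"] by (simp add: power_one_over)
  have "(\<lambda>i. av (emb (x (Suc i)) - emb (x i))) \<longlonglongrightarrow> 0"
    by (rule Lim_null_comparison[OF always_eventually half])
       (use x(2) in \<open>simp add: av_nonneg av_diff_commute\<close>)
  from av_ultrametric_Cauchy[OF this] obtain l where l: "(\<lambda>i. av (emb (x i) - l)) \<longlonglongrightarrow> 0" ..
  have "av l \<le> B"
    using root_le[OF x(1)] by (intro tendsto_upperbound[OF av_limit_norm[OF l]]) auto
  obtain K where K: "\<And>x y. av x \<le> B \<Longrightarrow> av y \<le> B \<Longrightarrow> av (poly p x - poly p y) \<le> K * av (x - y)"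
    using poly_Lipschitz_on_ball[of B p] B1 by auto
  have "av (poly p l) \<le> max (K * av (emb (x i) - l)) (1 / 2 ^ i)" for i
  proof -
    have "(1 / 2 ^ i) ^ ?m \<le> (1 / 2 ^ i :: real) ^ 1"
      using m by (intro power_decreasing) (auto simp: field_simps)
    hence "av (poly p (emb (x i))) \<le> 1 / 2 ^ i"
      using close[OF root_le[OF x(1)], of i i] x(1)[of i] by simp
    moreover have "av (poly p (emb (x i)) - poly p l) \<le> K * av (emb (x i) - l)"
      using K[OF root_le[OF x(1)] \<open>av l \<le> B\<close>] .
    ultimately show ?thesis
      using av_diff_le[of "poly p (emb (x i))" "poly p (emb (x i)) - poly p l"] by simp
  qed
  moreover have "(\<lambda>i. max (K * av (emb (x i) - l)) (1 / 2 ^ i)) \<longlonglongrightarrow> 0"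
    using tendsto_max[OF tendsto_mult_left[OF l, of K] half] by simp
  ultimately have "av (poly p l) \<le> 0"
    by (intro tendsto_lowerbound[of _ 0 sequentially]) auto
  hence "poly p l = 0" using av_pos[of "poly p l"] by fastforce
  thus ?thesis ..
qed

lemma poly_linear_factor_induct [case_names const linear]:
  fixes p :: "'c poly"
  assumes const: "\<And>c. Q [:c:]" and linear: "\<And>b p. Q p \<Longrightarrow> Q ([:- b, 1:] * p)"
  shows "Q p"
proof (induction "degree p" arbitrary: p rule: less_induct)
  case less
  show ?case
  proof (cases "degree p = 0")
    case True
    thus ?thesis using const by (metis degree_eq_zeroE)
  next
    case False
    hence "p \<noteq> 0" by auto
    let ?p = "smult (inverse (lead_coeff p)) p"
    obtain x where "poly ?p x = 0"
      using monic_poly_has_root[of ?p] False \<open>p \<noteq> 0\<close> by auto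
    hence "poly p x = 0" using \<open>p \<noteq> 0\<close> by simp
    then obtain q where q: "p = [:- x, 1:] * q" by (auto simp: poly_eq_0_iff_dvd)
    hence "degree p = Suc (degree q)" using \<open>p \<noteq> 0\<close> degree_mult_eq[of "[:- x, 1:]" q] by (cases "q = 0") simp_all
    thus ?thesis using less[of q] linear[of q x] q by simp
  qed
qed

end

lemma card_field_gt_1: "real CARD('k::{field,finite}) > 1"
proof -
  have "card {0, 1 :: 'k} \<le> CARD('k)" by (intro card_mono) auto
  thus ?thesis by simp
qed

text \<open>As the variable is 1/t, being small means that an initial segment of coefficients
  vanishes. This lets limits in K_inf be built coefficient by coefficient.\<close>

lemma abs_infinity_less_iff:
  fixes s :: "'k::{field,finite} fls"
  shows "abs_infinity s < 1 / real CARD('k) ^ i \<longleftrightarrow> (\<forall>n\<le>int i. fls_nth s n = 0)"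
proof (cases "s = 0")
  case False
  let ?q = "real CARD('k)"
  have "abs_infinity s < 1 / ?q ^ i \<longleftrightarrow> ?q powi (- fls_subdegree s) < ?q powi (- int i)"
    using False by (simp add: abs_infinity_def power_int_minus inverse_eq_divide)
  also have "\<dots> \<longleftrightarrow> int i < fls_subdegree s"
    using card_field_gt_1[where 'k = 'k] 
    by (metis neg_less_iff_less not_less_iff_gr_or_eq power_int_strict_increasing)
  also have "\<dots> \<longleftrightarrow> (\<forall>n\<le>int i. fls_nth s n = 0)"
    using False nth_fls_subdegree_nonzero[OF False] by (force simp: not_le)
  finally show ?thesis .
qed (simp add: abs_infinity_def card_field_gt_1)

context completed_alg_closure
begin

lemma q_gt_1: "real CARD('k) > 1" by (rule card_field_gt_1)

subsection \<open>The identity principle\<close>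

text \<open>An \<open>N\<close>-th root of t has absolute value g = q^(1/N), and for large
  \<open>N\<close> the ratio of consecutive powers of g is too small to jump over the
  interval.\<close>

lemma value_group_dense:
  assumes "0 < r1" "r1 < r2"
  shows "\<exists>x. r1 < av x \<and> av x < r2"
proof -
  obtain N where "real CARD('k) < (r2 / r1) ^ N"
    using real_arch_pow[of "r2 / r1" "real CARD('k)"] assms by auto
  moreover from this have N: "N > 0" using q_gt_1 by (cases N) auto
  obtain y :: "'k fls alg_closure" where y: "y ^ N = to_ac fls_X_inv"
    using nth_root_exists[OF N] by blast
  define g where "g = av (emb y)"
  have "av (emb y) ^ N = real CARD('k)"
    using av_Kinf[of fls_X_inv] y
    by (simp add: av_power[symmetric] emb_power[symmetric] abs_infinity_def)
  ultimately have g: "g ^ N = real CARD('k)" "g ^ N < (r2 / r1) ^ N" by (simp_all add: g_def)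
  have g0: "g \<ge> 0" by (simp add: g_def av_nonneg)
  have g1: "g > 1"
  proof (rule ccontr)
    assume "\<not> g > 1"
    hence "g ^ N \<le> 1" using g0 by (intro power_le_one) auto
    thus False using g q_gt_1 by simp
  qed
  have g2: "g * r1 < r2"
    using power_less_imp_less_base[OF g(2)] assms by (simp add: field_simps)
  \<comment> \<open>The last exponent whose power of \<open>g\<close> is at most \<open>r1\<close>;
    the next power exceeds \<open>r1\<close> but is at most \<open>g * r1\<close>.\<close>
  define k where "k = \<lfloor>log g r1\<rfloor>"
  have "g powr k \<le> r1"
    using g1 assms by (simp add: powr_le_iff k_def)
  moreover have "r1 < g powr (k + 1)"
    using g1 assms by (simp add: less_powr_iff k_def)
  ultimately have k: "g powi k \<le> r1" "r1 < g powi (k + 1)"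
    using g1 by (simp_all add: powr_real_of_int' flip: of_int_add)
  have "g powi (k + 1) = g * g powi k" using g1 by (simp add: power_int_add)
  also have "\<dots> \<le> g * r1" using k g1 by simp
  also have "\<dots> < r2" by (rule g2)
  finally have "g powi (k + 1) < r2" .
  moreover have "av (emb y powi (k + 1)) = g powi (k + 1)"
    by (simp add: power_int_def av_power av_inverse g_def)
  ultimately show ?thesis using k by metis
qed

lemma exists_generic_radius:
  assumes "0 < r1" "r1 < r2" "finite F"
  shows "\<exists>x. r1 < av x \<and> av x < r2 \<and> av x \<notin> F"
proof -
  \<comment> \<open>The first forbidden value above \<open>r1\<close>, capped by \<open>r2\<close>:
    the open interval from \<open>r1\<close> to \<open>r\<close> avoids \<open>F\<close>.\<close>
  define r where "r = Min (insert r2 {s \<in> F. s > r1})"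
  have "r > r1" unfolding r_def using assms by (subst Min_gr_iff) auto
  have "r \<le> r2" and F: "s \<ge> r" if "s \<in> F" "s > r1" for s
    unfolding r_def using assms that by (auto intro: Min_le)
  have "r \<le> r2" unfolding r_def using assms by auto
  from value_group_dense[OF assms(1) \<open>r > r1\<close>] obtain x where "r1 < av x" "av x < r" by blast
  thus ?thesis using F \<open>r \<le> r2\<close> by (intro exI[of _ x]) force
qed

text \<open>Maximised over \<open>k\<close>, the left side is the Gauss norm at radius |x|. This
  norm is multiplicative, and a linear factor attains it at \<open>x\<close> when |x - b| = max(|x|,
  |b|), which holds if its root has another absolute value.\<close>

lemma coeff_le_at_generic_point:
  fixes p :: "'c poly"
  assumes "\<And>b. poly p b = 0 \<Longrightarrow> av b \<noteq> av x"
  shows "av (coeff p k) * av x ^ k \<le> av (poly p x)"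
  using assms
proof (induction p arbitrary: k rule: poly_linear_factor_induct)
  case (const c)
  thus ?case by (cases k) (simp_all add: av_nonneg)
next
  case (linear b p)
  have "av b \<noteq> av x" using linear.prems[of b] by simp
  hence xb: "av (x - b) = max (av x) (av b)"
    using av_diff_eq[of b x] av_diff_eq[of x b] by (cases "av b < av x") (auto simp: av_diff_commute)
  have IH: "av (coeff p k) * av x ^ k \<le> av (poly p x)" for k
    using linear by simp
  have "av (coeff ([:- b, 1:] * p) k) * av x ^ k \<le> max (av x) (av b) * av (poly p x)"
  proof -
    have c: "coeff ([:- b, 1:] * p) k = (case k of 0 \<Rightarrow> 0 | Suc j \<Rightarrow> coeff p j) - b * coeff p k"
      by (simp add: coeff_pCons split: nat.split)
    have "av (b * coeff p k) * av x ^ k \<le> max (av x) (av b) * av (poly p x)"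
      unfolding av_mult mult.assoc using IH[of k] av_nonneg by (intro mult_mono) (auto simp: max_def)
    moreover have "av (case k of 0 \<Rightarrow> 0 | Suc j \<Rightarrow> coeff p j) * av x ^ k
        \<le> max (av x) (av b) * av (poly p x)"
    proof (cases k)
      case 0 thus ?thesis using av_nonneg by (simp add: max_def)
    next
      case (Suc j)
      have "av x * (av (coeff p j) * av x ^ j) \<le> max (av x) (av b) * av (poly p x)"
        using IH[of j] av_nonneg by (intro mult_mono) (auto simp: max_def)
      thus ?thesis by (simp add: Suc algebra_simps)
    qed
    ultimately have "max (av (case k of 0 \<Rightarrow> 0 | Suc j \<Rightarrow> coeff p j)) (av (b * coeff p k)) * av x ^ k
        \<le> max (av x) (av b) * av (poly p x)"
      by (metis max_def)
    moreover have "av (coeff ([:- b, 1:] * p) k) * av x ^ k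
       \<le> max (av (case k of 0 \<Rightarrow> 0 | Suc j \<Rightarrow> coeff p j)) (av (b * coeff p k)) * av x ^ k"
      unfolding c using av_diff_le av_nonneg by (intro mult_right_mono) auto
    ultimately show ?thesis by linarith
  qed
  also have "\<dots> = av (poly ([:- b, 1:] * p) x)"
    unfolding xb[symmetric] av_mult[symmetric] by (simp add: algebra_simps)
  finally show ?case .
qed

text \<open>The ultrametric Cauchy estimate. The gap between the radii makes room for a point whose
  absolute value differs from that of every root.\<close>

lemma coeff_le_sup_norm:
  fixes p :: "'c poly"
  assumes "0 < r1" "r1 < r2" "\<And>x. av x \<le> r2 \<Longrightarrow> av (poly p x) \<le> S"
  shows "av (coeff p k) * r1 ^ k \<le> S"
proof (cases "p = 0")
  case True
  thus ?thesis using assms(3)[of 0] assms(1,2) by simp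
next
  case False
  hence "finite (av ` {b. poly p b = 0})" by (simp add: poly_roots_finite)
  from exists_generic_radius[OF assms(1,2) this]
  obtain x where x: "r1 < av x" "av x < r2" "av x \<notin> av ` {b. poly p b = 0}" by blast
  have "av (coeff p k) * r1 ^ k \<le> av (coeff p k) * av x ^ k"
    using x assms(1) av_nonneg by (intro mult_left_mono power_mono) auto
  also have "\<dots> \<le> av (poly p x)"
    using x(3) by (intro coeff_le_at_generic_point) (metis (mono_tags) imageI mem_Collect_eq)
  also have "\<dots> \<le> S" using assms(3) x by simp
  finally show ?thesis .
qed

text \<open>Every root \<open>b\<close> is larger than \<open>r\<close>, so each factor has |x - b|
  = |b|. Where only absolute values matter, a denominator without zeros on a disc may thus be
  replaced by its value at 0.\<close>

lemma av_poly_constant_if_no_root: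
  fixes d :: "'c poly"
  assumes "\<And>x. av x \<le> r \<Longrightarrow> poly d x \<noteq> 0" "av x \<le> r"
  shows "av (poly d x) = av (poly d 0)"
  using assms
proof (induction d rule: poly_linear_factor_induct)
  case (linear b d)
  have "av b > r" using linear.prems(1)[of b] by force
  hence "av (x - b) = av b" using linear.prems(2) av_diff_eq[of x b] by (simp add: av_diff_commute)
  moreover have "av (poly d x) = av (poly d 0)"
    using linear.prems by (intro linear.IH) auto
  moreover have "poly ([:- b, 1:] * d) x = (x - b) * poly d x" "poly ([:- b, 1:] * d) 0 = - b * poly d 0"
    by (simp_all add: algebra_simps)
  ultimately show ?case by (simp only: av_mult av_minus)
qed simp

text \<open>At radius \<open>r\<close> the Gauss norm of x - a is \<open>r\<close>, so dividing by
  it costs this factor. The proof runs down Horner's recurrence, starting above the degree of the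
  quotient, where the coefficients vanish.\<close>

lemma coeff_synthetic_div_le:
  fixes p :: "'c poly"
  assumes "r > 0" "av a \<le> r" "\<And>k. av (coeff p k) * r ^ k \<le> S"
  shows "av (coeff (synthetic_div p a) k) * r ^ k \<le> S / r"
proof -
  let ?q = "synthetic_div p a"
  have S: "S \<ge> 0" using assms(3)[of 0] av_nonneg[of "coeff p 0"] by simp
  have step: "coeff ?q k = coeff p (Suc k) + a * coeff ?q (Suc k)" for k
  proof -
    have "coeff p (Suc k) = coeff ([:- a, 1:] * ?q + [:poly p a:]) (Suc k)"
      by (simp only: synthetic_div_correct')
    thus ?thesis by (simp add: coeff_pCons)
  qed
  show ?thesis
  proof (induction "Suc (degree ?q) - k" arbitrary: k)
    case 0
    thus ?case using S assms(1) by (simp add: coeff_eq_0)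
  next
    case (Suc j)
    have IH: "av (coeff ?q (Suc k)) * r ^ Suc k \<le> S / r" using Suc(1)[of "Suc k"] Suc(2) by simp
    have "av (a * coeff ?q (Suc k)) * r ^ k * r \<le> r * (av (coeff ?q (Suc k)) * r ^ Suc k)"
      unfolding av_mult using assms(1,2) av_nonneg by (simp add: mult_right_mono algebra_simps)
    also have "\<dots> \<le> S" using IH assms(1) by (simp add: field_simps)
    finally have "av (a * coeff ?q (Suc k)) * r ^ k \<le> S / r" using assms(1) by (simp add: field_simps)
    moreover have "av (coeff p (Suc k)) * r ^ k \<le> S / r"
      using assms(3)[of "Suc k"] assms(1) by (simp add: field_simps)
    ultimately have "max (av (coeff p (Suc k))) (av (a * coeff ?q (Suc k))) * r ^ k \<le> S / r"
      by (metis max_def)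
    moreover have "av (coeff ?q k) * r ^ k
        \<le> max (av (coeff p (Suc k))) (av (a * coeff ?q (Suc k))) * r ^ k"
      using step[of k] av_ultrametric assms(1) by (intro mult_right_mono) auto
    ultimately show ?case by linarith
  qed
qed

text \<open>
  A Schwarz lemma for polynomials that are merely small at the prescribed points; the constant
  \<open>C\<close> depends on the points only, so that it survives the passage to a uniform limit.
\<close>

lemma approximate_Schwarz:
  assumes "0 < r0" "r0 \<le> r1" "distinct as" "\<And>a. a \<in> set as \<Longrightarrow> av a \<le> r0"
  shows "\<exists>C\<ge>0. \<forall>p :: 'c poly. \<forall>e S x. e \<ge> 0 \<longrightarrow> (\<forall>a\<in>set as. av (poly p a) \<le> e) \<longrightarrow>
     (\<forall>k. av (coeff p k) * r1 ^ k \<le> S) \<longrightarrow> av x \<le> r0 \<longrightarrow>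
     av (poly p x) \<le> max (C * e) (S * (r0 / r1) ^ length as)"
  using assms(3,4)
proof (induction as)
  case Nil
  show ?case
  proof (intro exI[of _ 0] conjI allI impI)
    fix p :: "'c poly" and e S :: real and x
    assume "\<forall>k. av (coeff p k) * r1 ^ k \<le> S" "av x \<le> r0"
    thus "av (poly p x) \<le> max (0 * e) (S * (r0 / r1) ^ length [])"
      using av_poly_le[of p r1 S x] assms by simp
  qed simp
next
  case (Cons a as)
  then obtain C where C: "C \<ge> 0" "\<And>p :: 'c poly. \<And>e S x. e \<ge> 0 \<Longrightarrow> (\<forall>a\<in>set as. av (poly p a) \<le> e) \<Longrightarrow>
     (\<forall>k. av (coeff p k) * r1 ^ k \<le> S) \<Longrightarrow> av x \<le> r0 \<Longrightarrow>
     av (poly p x) \<le> max (C * e) (S * (r0 / r1) ^ length as)" by force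
  \<comment> \<open>The least separation of \<open>a\<close> from the later points, which controls
    the loss when the quotient at \<open>b\<close> is recovered from p(b) - p(a). The 1 covers an
    empty list.\<close>
  define \<delta> where "\<delta> = Min (insert 1 ((\<lambda>b. av (b - a)) ` set as))"
  have "\<delta> > 0" unfolding \<delta>_def using Cons.prems(1) by (subst Min_gr_iff) (auto intro!: av_pos)
  have \<delta>: "\<delta> \<le> av (b - a)" if "b \<in> set as" for b
    unfolding \<delta>_def using that by (intro Min_le) auto
  show ?case
  \<comment> \<open>The 1 pays for the remainder p(a), the other entry for the quotient multiplied
    by x - a.\<close>
  proof (intro exI[of _ "max 1 (r0 * (C / \<delta>))"] conjI allI impI)
    fix p :: "'c poly" and e S :: real and x
    assume e: "e \<ge> 0" "\<forall>b\<in>set (a # as). av (poly p b) \<le> e"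
      and S: "\<forall>k. av (coeff p k) * r1 ^ k \<le> S" and x: "av x \<le> r0"
    let ?q = "synthetic_div p a"
    have p: "poly p y = poly p a + (y - a) * poly ?q y" for y
    proof -
      have "poly p y = poly ([:- a, 1:] * ?q + [:poly p a:]) y" by (simp only: synthetic_div_correct')
      thus ?thesis by (simp add: algebra_simps)
    qed
    have a: "av a \<le> r0" using Cons.prems by simp
    have "\<forall>b\<in>set as. av (poly ?q b) \<le> e / \<delta>"
    proof
      fix b assume b: "b \<in> set as"
      have "av (b - a) * av (poly ?q b) = av (poly p b - poly p a)"
        unfolding av_mult[symmetric] using p[of b] by simp
      also have "\<dots> \<le> e" using av_diff_le[of "poly p b" "poly p a"] e b by force
      finally have "\<delta> * av (poly ?q b) \<le> e"
        using mult_right_mono[OF \<delta>[OF b] av_nonneg[of "poly ?q b"]] by simp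
      thus "av (poly ?q b) \<le> e / \<delta>" using \<open>\<delta> > 0\<close> by (simp add: field_simps)
    qed
    moreover have "\<forall>k. av (coeff ?q k) * r1 ^ k \<le> S / r1"
      using S a assms by (auto intro!: coeff_synthetic_div_le)
    ultimately have "av (poly ?q x) \<le> max (C * (e / \<delta>)) (S / r1 * (r0 / r1) ^ length as)"
      using e(1) \<open>\<delta> > 0\<close> x by (intro C) auto
    moreover have "av (x - a) \<le> r0" using av_diff_le[of x a] x a by simp
    ultimately have "av ((x - a) * poly ?q x)
        \<le> r0 * max (C * (e / \<delta>)) (S / r1 * (r0 / r1) ^ length as)"
      unfolding av_mult using av_nonneg assms by (intro mult_mono) auto
    also have "\<dots> = max (r0 * (C / \<delta>) * e) (S * (r0 / r1) ^ length (a # as))"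
    proof -
      have "r0 * max x y = max (r0 * x) (r0 * y)" for x y
        using assms(1) by (simp add: max_mult_distrib_left)
      moreover have "r0 * (C * (e / \<delta>)) = r0 * (C / \<delta>) * e"
        "r0 * (S / r1 * (r0 / r1) ^ length as) = S * (r0 / r1) ^ length (a # as)" by simp_all
      ultimately show ?thesis by (simp only:)
    qed
    also have "\<dots> \<le> max (max 1 (r0 * (C / \<delta>)) * e) (S * (r0 / r1) ^ length (a # as))"
      using e(1) by (intro max.mono[OF mult_right_mono order_refl]) auto
    finally have 1: "av ((x - a) * poly ?q x)
        \<le> max (max 1 (r0 * (C / \<delta>)) * e) (S * (r0 / r1) ^ length (a # as))" .
    have "av (poly p a) \<le> 1 * e" using e by simp
    also have "\<dots> \<le> max 1 (r0 * (C / \<delta>)) * e" using e by (intro mult_right_mono) auto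
    finally show "av (poly p x) \<le> max (max 1 (r0 * (C / \<delta>)) * e) (S * (r0 / r1) ^ length (a # as))"
      unfolding p[of x] using 1 av_ultrametric[of "poly p a" "(x - a) * poly ?q x"] by linarith
  qed auto
qed

text \<open>With \<open>m\<close> of the zeros, the Schwarz lemma shrinks the bound of
  \<open>h\<close> by \<open>(r0 / r1) ^ m\<close>, up to an error that disappears with the
  approximation. As \<open>m\<close> is arbitrary, no positive value of |h| survives.\<close>

lemma analytic_identity_principle:
  fixes h :: "'c \<Rightarrow> 'c" and b :: "nat \<Rightarrow> 'c"
  assumes approx: "\<And>e. e > 0 \<Longrightarrow> \<exists>p d. \<forall>x. av x \<le> r \<longrightarrow>
      poly d x \<noteq> 0 \<and> av (h x - poly p x / poly d x) < e"
    and zeros: "\<And>j. h (b j) = 0" and inj: "inj b" and lim: "(\<lambda>j. av (b j)) \<longlonglongrightarrow> 0"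
    and x: "av x < r"
  shows "h x = 0"
proof (rule ccontr)
  assume "h x \<noteq> 0"
  define \<delta> where "\<delta> = av (h x)"
  have "\<delta> > 0" using \<open>h x \<noteq> 0\<close> by (simp add: \<delta>_def av_pos)
  have "r > 0" using x av_nonneg[of x] by simp
  \<comment> \<open>\<open>r / 2\<close> keeps \<open>r0\<close> positive when \<open>x\<close> is
    0. Both intermediate radii are needed: the Schwarz factor is their ratio, and the Cauchy
    estimate loses radius between \<open>r\<close> and \<open>r1\<close>.\<close>
  obtain r0 where r0: "max (r / 2) (av x) < r0" "r0 < r" using dense[of "max (r / 2) (av x)" r] x \<open>r > 0\<close> by auto
  obtain r1 where r1: "r0 < r1" "r1 < r" using dense[OF r0(2)] by blast
  have pos: "r0 > 0" "r1 > 0" using r0 r1 \<open>r > 0\<close> by auto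
  \<comment> \<open>Replacing \<open>d\<close> by its value at 0 destroys the approximation of
    \<open>h\<close> but keeps the comparison of absolute values up to \<open>e\<close>, which is
    what the Schwarz lemma consumes.\<close>
  have normalised: "\<exists>p. \<forall>y. av y \<le> r \<longrightarrow> av (poly p y) \<le> max (av (h y)) e \<and> av (h y) \<le> max (av (poly p y)) e"
    if e: "e > 0" for e
  proof -
    obtain p d where pd: "\<And>y. av y \<le> r \<Longrightarrow> poly d y \<noteq> 0"
      "\<And>y. av y \<le> r \<Longrightarrow> av (h y - poly p y / poly d y) < e" using approx[OF e] by blast
    have "av (poly (smult (1 / poly d 0) p) y) = av (poly p y / poly d y)" if "av y \<le> r" for y
      using av_poly_constant_if_no_root[OF pd(1) that] by (simp add: av_mult av_divide)
    moreover have "av (poly p y / poly d y) \<le> max (av (h y)) e" if "av y \<le> r" for y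
      using pd(2)[OF that] av_diff_le[of "h y" "h y - poly p y / poly d y"] by simp
    moreover have "av (h y) \<le> max (av (poly p y / poly d y)) e" if "av y \<le> r" for y
      using pd(2)[OF that] av_ultrametric[of "h y - poly p y / poly d y" "poly p y / poly d y"] by simp
    ultimately show ?thesis by (intro exI[of _ "smult (1 / poly d 0) p"]) simp
  qed
  obtain S where S: "S > 0" "\<And>y. av y \<le> r \<Longrightarrow> av (h y) \<le> S"
  proof -
    obtain p where p: "\<And>y. av y \<le> r \<Longrightarrow> av (h y) \<le> max (av (poly p y)) 1"
      using normalised[of 1] by auto
    obtain K where "\<And>y. av y \<le> r \<Longrightarrow> av (poly p y) \<le> K"
      using poly_Lipschitz_on_ball[of r p] \<open>r > 0\<close> by auto
    thus ?thesis using p by (intro that[of "max K 1"]) (auto simp: le_max_iff_disj intro: order_trans)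
  qed
  have "(\<lambda>m. S * (r0 / r1) ^ m) \<longlonglongrightarrow> S * 0"
    using pos r1 by (intro tendsto_mult_left LIMSEQ_realpow_zero) auto
  hence "\<forall>\<^sub>F m in sequentially. S * (r0 / r1) ^ m < \<delta>"
    using \<open>\<delta> > 0\<close> by (intro order_tendstoD(2)) auto
  then obtain m where m: "S * (r0 / r1) ^ m < \<delta>"
    by (auto simp: eventually_sequentially)
  obtain j0 where j0: "\<And>j. j \<ge> j0 \<Longrightarrow> av (b j) < r0"
    using order_tendstoD(2)[OF lim pos(1)] by (auto simp: eventually_sequentially)
  define as where "as = map (\<lambda>j. b (j0 + j)) [0..<m]"
  have "distinct as" unfolding as_def using inj by (auto simp: distinct_map inj_on_def dest!: injD[OF inj])
  moreover have "\<And>a. a \<in> set as \<Longrightarrow> av a \<le> r0" unfolding as_def using j0 by (auto intro: less_imp_le)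
  ultimately obtain C where C: "C \<ge> 0" "\<And>p :: 'c poly. \<And>e S x. e \<ge> 0 \<Longrightarrow> (\<forall>a\<in>set as. av (poly p a) \<le> e) \<Longrightarrow>
     (\<forall>k. av (coeff p k) * r1 ^ k \<le> S) \<Longrightarrow> av x \<le> r0 \<Longrightarrow>
     av (poly p x) \<le> max (C * e) (S * (r0 / r1) ^ length as)"
    using approximate_Schwarz[of r0 r1 as] pos less_imp_le[OF r1(1)] by metis
  \<comment> \<open>Chosen last, since \<open>C\<close> depends on the chosen zeros: it makes
    \<open>C * e\<close> and \<open>e\<close> smaller than \<delta> and keeps the approximant
    bounded by \<open>S\<close>.\<close>
  define e where "e = min S (\<delta> / (2 * (C + 1)))"
  have e: "e > 0" "e \<le> S" using S \<open>\<delta> > 0\<close> C(1) by (simp_all add: e_def)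
  have "e * (2 * (C + 1)) \<le> \<delta>" 
  proof -
    have "e \<le> \<delta> / (2 * (C + 1))" by (simp add: e_def)
    thus ?thesis using C(1) by (subst (asm) pos_le_divide_eq) auto
  qed
  hence "2 * e + 2 * (C * e) \<le> \<delta>" by (simp add: algebra_simps)
  moreover have "C * e \<ge> 0" using C e by simp
  ultimately have "C * e < \<delta>" "e < \<delta>" using e(1) \<open>\<delta> > 0\<close> by linarith+
  obtain p where p: "\<And>y. av y \<le> r \<Longrightarrow> av (poly p y) \<le> max (av (h y)) e"
     "\<And>y. av y \<le> r \<Longrightarrow> av (h y) \<le> max (av (poly p y)) e"
    using normalised[OF e(1)] by blast
  have "av (poly p x) \<le> max (C * e) (S * (r0 / r1) ^ length as)"
  proof (rule C(2))
    show "\<forall>a\<in>set as. av (poly p a) \<le> e"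
    proof
      fix a assume "a \<in> set as"
      then obtain j where "a = b (j0 + j)" by (auto simp: as_def)
      hence "h a = 0" "av a \<le> r" using zeros j0[of "j0 + j"] r0 by simp_all
      thus "av (poly p a) \<le> e" using p(1)[of a] e by simp
    qed
    have "av (poly p y) \<le> S" if "av y \<le> r" for y
      using p(1)[OF that] S(2)[OF that] e by simp
    thus "\<forall>k. av (coeff p k) * r1 ^ k \<le> S"
      using coeff_le_sup_norm[OF pos(2) r1(2)] by blast
  qed (use e r0 in auto)
  also have "\<dots> < \<delta>" using m \<open>C * e < \<delta>\<close> by (simp add: as_def)
  finally have "av (poly p x) < \<delta>" .
  thus False using p(2)[of x] x \<open>e < \<delta>\<close> by (simp add: \<delta>_def)
qed

section \<open>The affinoid exhaustion and local constancy\<close>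

lemma Omega_bounded_away_from_Kinf:
  assumes "z \<in> Omega"
  shows "\<exists>c>0. \<forall>s. c \<le> av (z - iota s)"
proof (rule ccontr)
  assume neg: "\<not> ?thesis"
  have "\<exists>s. av (z - iota s) < 1 / real CARD('k) ^ i" for i
    using neg q_gt_1 by (metis divide_pos_pos not_le zero_less_one zero_less_power order.strict_trans)
  then obtain s where s: "\<And>i. av (z - iota (s i)) < 1 / real CARD('k) ^ i" by metis
  have agree: "fls_nth (s j) n = fls_nth (s i) n" if "n \<le> int i" "i \<le> j" for i j n
  proof -
    have "1 / real CARD('k) ^ j \<le> 1 / real CARD('k) ^ i"
      using q_gt_1 that(2) by (intro divide_left_mono power_increasing) auto
    hence "av (iota (s j) - iota (s i)) < 1 / real CARD('k) ^ i"
      using s[of i] s[of j] av_triangle[of "iota (s j)" "iota (s i)" z] by (simp add: av_diff_commute)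
    hence "abs_infinity (s j - s i) < 1 / real CARD('k) ^ i" by (simp add: av_iota flip: iota_diff)
    thus ?thesis using that by (auto simp: abs_infinity_less_iff)
  qed
  \<comment> \<open>The approximations agree to growing order, so their limit in K_inf is read off
    coefficientwise. For negative \<open>n\<close>, \<open>nat n\<close> is 0 and the coefficient
    comes from \<open>s 0\<close>, which bounds the series below.\<close>
  define l where "l = Abs_fls (\<lambda>n. fls_nth (s (nat n)) n)"
  have l: "fls_nth l n = fls_nth (s (nat n)) n" for n
    unfolding l_def
  proof (rule nth_Abs_fls_lower_bound)
    show "\<forall>n < min 0 (fls_subdegree (s 0)). fls_nth (s (nat n)) n = 0" by simp
  qed
  have "abs_infinity (l - s i) < 1 / real CARD('k) ^ i" for i
    unfolding abs_infinity_less_iff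
  proof (intro allI impI)
    fix n assume "n \<le> int i"
    thus "fls_nth (l - s i) n = 0" using agree[of n "nat n" i] by (simp add: l)
  qed
  hence *: "av (iota (l - s i)) < 1 / real CARD('k) ^ i" for i by (simp add: av_iota)
  have "av (z - iota l) \<le> 1 / real CARD('k) ^ i" for i
    using s[of i] *[of i] av_triangle[of z "iota l" "iota (s i)"] by (simp add: av_diff_commute iota_diff)
  moreover have "(\<lambda>i. 1 / real CARD('k) ^ i) \<longlonglongrightarrow> 0"
    using q_gt_1 LIMSEQ_realpow_zero[of "1 / real CARD('k)"] by (simp add: power_one_over)
  ultimately have "av (z - iota l) \<le> 0"
    by (intro tendsto_lowerbound[of _ 0 sequentially]) auto
  hence "z = iota l" using av_pos[of "z - iota l"] by fastforce
  thus False using assms by (simp add: Omega_def)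
qed

lemma Omega_affinoid_subset: "Omega_affinoid r \<subseteq> Omega"
proof
  fix z assume "z \<in> Omega_affinoid r"
  hence "\<forall>s. av (z - iota s) \<ge> 1 / real CARD('k) ^ r" by (simp add: Omega_affinoid_def)
  moreover have "1 / real CARD('k) ^ r > 0" using q_gt_1 by simp
  ultimately have "av (z - iota s) > 0" for s by (meson less_le_trans)
  hence "z \<noteq> iota s" for s using av_0 by (metis diff_self less_irrefl)
  thus "z \<in> Omega" unfolding Omega_def by auto
qed

lemma Omega_affinoid_covers:
  assumes "\<And>s. c \<le> av (z - iota s)" "c > 0"
  shows "\<exists>r. \<forall>r'\<ge>r. z \<in> Omega_affinoid r'"
proof -
  obtain r where r: "max (av z) (1 / c) < real CARD('k) ^ r" using real_arch_pow[OF q_gt_1] by blast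
  have "z \<in> Omega_affinoid r'" if "r' \<ge> r" for r'
  proof -
    have "real CARD('k) ^ r \<le> real CARD('k) ^ r'" using that q_gt_1 by (intro power_increasing) auto
    hence "av z \<le> real CARD('k) ^ r'" "1 / c \<le> real CARD('k) ^ r'" using r by auto
    moreover from this have "1 / real CARD('k) ^ r' \<le> c" using assms(2) q_gt_1 by (simp add: field_simps)
    ultimately show ?thesis using assms(1) by (auto simp: Omega_affinoid_def intro: order_trans)
  qed
  thus ?thesis by blast
qed

lemma Omega_affinoid_contains_disc:
  assumes "z \<in> Omega_affinoid r" "av y < 1 / real CARD('k) ^ r"
  shows "z + y \<in> Omega_affinoid r"
proof -
  have z: "av z \<le> real CARD('k) ^ r" "\<And>s. 1 / real CARD('k) ^ r \<le> av (z - iota s)"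
    using assms(1) by (auto simp: Omega_affinoid_def)
  have "av (z + y - iota s) = av (z - iota s)" for s
    using av_add_eq[of y "z - iota s"] z(2)[of s] assms(2) by (simp add: algebra_simps)
  moreover have "1 / real CARD('k) ^ r \<le> real CARD('k) ^ r"
  proof -
    have "1 \<le> real CARD('k) ^ r" using q_gt_1 by (intro one_le_power) simp
    hence "1 / real CARD('k) ^ r \<le> 1" by simp
    thus ?thesis using \<open>1 \<le> real CARD('k) ^ r\<close> by linarith
  qed
  ultimately show ?thesis
    using z assms(2) av_ultrametric[of z y] by (simp add: Omega_affinoid_def)
qed

text \<open>A closed disc around \<open>z\<close> stays inside one affinoid, and there the identity
  principle applies to y -> f(z + y) - f(z), which vanishes at all \<open>b j\<close>.\<close>

lemma rigid_analytic_locally_constant: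
  assumes f: "rigid_analytic f" and z: "z \<in> Omega"
    and inj: "inj b" and lim: "(\<lambda>j. av (b j)) \<longlonglongrightarrow> 0" and per: "\<And>j. f (z + b j) = f z"
  shows "\<exists>\<rho>>0. \<forall>y. av y < \<rho> \<longrightarrow> z + y \<in> Omega \<and> f (z + y) = f z"
proof -
  obtain c where "c > 0" "\<And>s. c \<le> av (z - iota s)"
    using Omega_bounded_away_from_Kinf[OF z] by blast
  then obtain r where zr: "z \<in> Omega_affinoid r" using Omega_affinoid_covers by blast
  \<comment> \<open>Half the radius, so that the closed disc required by the identity principle
    still lies in the affinoid.\<close>
  define \<rho> where "\<rho> = 1 / real CARD('k) ^ r / 2"
  have \<rho>: "\<rho> > 0" "\<rho> < 1 / real CARD('k) ^ r" 
  proof -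
    have "1 / real CARD('k) ^ r > 0" using q_gt_1 by simp
    moreover have "x / 2 > 0 \<and> x / 2 < x" if "x > 0" for x :: real using that by simp
    ultimately show "\<rho> > 0" "\<rho> < 1 / real CARD('k) ^ r" unfolding \<rho>_def by blast+
  qed
  have in_aff: "z + y \<in> Omega_affinoid r" if "av y \<le> \<rho>" for y
    using Omega_affinoid_contains_disc[OF zr] that \<rho> by simp
  have "f (z + y) - f z = 0" if "av y < \<rho>" for y
  proof (rule analytic_identity_principle[of \<rho> "\<lambda>y. f (z + y) - f z" b])
    fix e :: real assume "e > 0"
    then obtain p d where pd: "\<And>w. w \<in> Omega_affinoid r \<Longrightarrow> poly d w \<noteq> 0"
      "\<And>w. w \<in> Omega_affinoid r \<Longrightarrow> av (f w - poly p w / poly d w) < e"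
      using f unfolding rigid_analytic_def by meson
    \<comment> \<open>Substituting z + y recentres the approximants, and the constant f(z) is
      absorbed into the numerator.\<close>
    let ?sh = "\<lambda>p. pcompose p [:z, 1:]"
    have "poly (?sh d) y \<noteq> 0 \<and>
        av (f (z + y) - f z - poly (?sh p - smult (f z) (?sh d)) y / poly (?sh d) y) < e"
      if "av y \<le> \<rho>" for y
    proof -
      have "poly d (z + y) \<noteq> 0" "av (f (z + y) - poly p (z + y) / poly d (z + y)) < e"
        using pd in_aff[OF that] by blast+
      thus ?thesis by (simp add: poly_pcompose diff_divide_distrib)
    qed
    thus "\<exists>p d. \<forall>y. av y \<le> \<rho> \<longrightarrow> poly d y \<noteq> 0 \<and>
        av (f (z + y) - f z - poly p y / poly d y) < e" by blast
  qed (use inj lim per that in auto)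
  moreover have "z + y \<in> Omega" if "av y < \<rho>" for y
    using in_aff[of y] Omega_affinoid_subset that by (auto intro: less_imp_le)
  ultimately show ?thesis using \<rho>(1) by (intro exI[of _ \<rho>]) auto
qed

end

subsection \<open>Polynomial ideals, matrices and the slash operator\<close>

text \<open>Formulated for bare subsets because it is applied both to the combinations of two
  polynomials and to modules of cusp translations.\<close>

lemma poly_ideal_principal:
  fixes I :: "'k::field poly set"
  assumes "0 \<in> I" "\<And>a b. a \<in> I \<Longrightarrow> b \<in> I \<Longrightarrow> a + b \<in> I" "\<And>a r. a \<in> I \<Longrightarrow> r * a \<in> I"
  shows "\<exists>g. I = range (\<lambda>x. g * x)"
proof (cases "I = {0}")
  case True
  thus ?thesis by (intro exI[of _ 0]) auto
next
  case False
  then obtain a where "a \<in> I \<and> a \<noteq> 0" using assms(1) by blast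
  from ex_has_least_nat[where P = "\<lambda>a. a \<in> I \<and> a \<noteq> 0", OF this, of degree]
  obtain g where g: "g \<in> I" "g \<noteq> 0" "\<And>y. y \<in> I \<Longrightarrow> y \<noteq> 0 \<Longrightarrow> degree g \<le> degree y" by blast
  have "b \<in> range (\<lambda>x. g * x)" if b: "b \<in> I" for b
  proof -
    have "b mod g = b + (- (b div g)) * g"
      by (metis minus_div_mult_eq_mod minus_mult_left uminus_add_conv_diff add.commute)
    hence "b mod g \<in> I" using assms(2)[OF b assms(3)[OF g(1)]] by metis
    hence "b mod g = 0" using g(3)[of "b mod g"] degree_mod_less[OF g(2), of b] by force
    hence "b = g * (b div g)" by (metis mult_div_mod_eq add.right_neutral)
    thus ?thesis by blast
  qed
  moreover have "range (\<lambda>x. g * x) \<subseteq> I" using assms(3)[OF g(1)] by (auto simp: mult.commute)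
  ultimately show ?thesis by blast
qed

lemma irreducible_poly_bezout:
  fixes v a :: "'k::field poly"
  assumes "irreducible v" "\<not> v dvd a"
  shows "\<exists>x y. v * x + a * y = 1"
proof -
  let ?I = "{v * x + a * y | x y. True}"
  have "\<exists>g. ?I = range (\<lambda>x. g * x)"
  proof (rule poly_ideal_principal)
    show "0 \<in> ?I" by (auto intro!: exI[of _ 0])
    show "b + c \<in> ?I" if bc: "b \<in> ?I" "c \<in> ?I" for b c
    proof -
      obtain x y x' y' where "b = v * x + a * y" "c = v * x' + a * y'" using bc by blast
      hence "b + c = v * (x + x') + a * (y + y')" by (simp add: algebra_simps)
      thus ?thesis by blast
    qed
    show "r * b \<in> ?I" if b: "b \<in> ?I" for b r
    proof -
      obtain x y where "b = v * x + a * y" using b by blast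
      hence "r * b = v * (r * x) + a * (r * y)" by (simp add: algebra_simps)
      thus ?thesis by blast
    qed
  qed
  then obtain g where g: "?I = range (\<lambda>x. g * x)" by blast
  have "v * 1 + a * 0 \<in> ?I" "v * 0 + a * 1 \<in> ?I" by blast+
  hence "v \<in> range (\<lambda>x. g * x)" "a \<in> range (\<lambda>x. g * x)" unfolding g by simp_all
  then obtain h h' where h: "v = g * h" and "a = g * h'" by blast
  hence "g dvd a" by simp
  have "g dvd 1"
  proof (rule ccontr)
    assume "\<not> g dvd 1"
    hence "h dvd 1" using irreducibleD[OF assms(1) h] by blast
    then obtain i where "1 = h * i" by (elim dvdE)
    hence "g = v * i" by (simp add: h mult.assoc)
    thus False using \<open>g dvd a\<close> assms(2) by (metis dvd_mult_left dvd_trans dvd_triv_left)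
  qed
  then obtain i where "1 = g * i" by (elim dvdE)
  hence "1 \<in> ?I" unfolding g by (rule image_eqI) simp
  thus ?thesis by (smt (verit) mem_Collect_eq)
qed

lemma irreducible_poly_dvd_multD:
  fixes v :: "'k::field poly"
  assumes "irreducible v" "v dvd a * b" "\<not> v dvd a"
  shows "v dvd b"
proof -
  obtain x y where "v * x + a * y = 1" using irreducible_poly_bezout[OF assms(1,3)] by blast
  hence "b = (v * x + a * y) * b" by simp
  also have "\<dots> = v * (x * b) + a * b * y" by (simp add: algebra_simps)
  finally have "b = v * (x * b) + a * b * y" .
  thus ?thesis using assms(2) by (metis dvd_add dvd_mult2 dvd_triv_left)
qed

lemma irreducible_poly_degree_pos:
  fixes v :: "'k::field poly"
  assumes "irreducible v"
  shows "degree v > 0"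
proof (rule ccontr)
  assume "\<not> degree v > 0"
  then obtain c where "v = [:c:]" by (metis degree_eq_zeroE not_gr_zero)
  moreover have "v \<noteq> 0" "\<not> v dvd 1" using assms by (auto simp: irreducible_def)
  ultimately show False by (auto simp: is_unit_const_poly_iff dvd_field_iff)
qed

section \<open>Two-by-two matrices and the embedding of A\<close>

lemma mat2_nth [simp]:
  "mat2 a b c d $ 1 $ 1 = a" "mat2 a b c d $ 1 $ 2 = b"
  "mat2 a b c d $ 2 $ 1 = c" "mat2 a b c d $ 2 $ 2 = d"
  by (simp_all add: mat2_def)

lemma mat2_eqI:
  assumes "M $ 1 $ 1 = N $ 1 $ 1" "M $ 1 $ 2 = N $ 1 $ 2" "M $ 2 $ 1 = N $ 2 $ 1" "M $ 2 $ 2 = N $ 2 $ 2"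
  shows "(M :: 'a ^ 2 ^ 2) = N"
  using assms by (simp add: vec_eq_iff forall_2)

lemma matrix_mult_nth2: "((M :: 'a::semiring_1 ^ 2 ^ 2) ** N) $ i $ j = M $ i $ 1 * N $ 1 $ j + M $ i $ 2 * N $ 2 $ j"
  by (simp add: matrix_matrix_mult_def sum_2)

lemma mat_1_nth2 [simp]:
  "(mat 1 :: 'a::{zero,one} ^ 2 ^ 2) $ 1 $ 1 = 1" "(mat 1 :: 'a ^ 2 ^ 2) $ 1 $ 2 = 0"
  "(mat 1 :: 'a ^ 2 ^ 2) $ 2 $ 1 = 0" "(mat 1 :: 'a ^ 2 ^ 2) $ 2 $ 2 = 1"
  by (simp_all add: mat_def)

lemma A_to_Kinf_0 [simp]: "A_to_Kinf 0 = 0"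
  by (simp add: A_to_Kinf_def)

lemma A_to_Kinf_pCons: "A_to_Kinf (pCons c p) = fls_const c + fls_X_inv * A_to_Kinf p"
  by (simp add: A_to_Kinf_def map_poly_pCons)

lemma A_to_Kinf_1 [simp]: "A_to_Kinf 1 = 1"
  using A_to_Kinf_pCons[of 1 0] by (simp flip: one_pCons)

lemma A_to_Kinf_add: "A_to_Kinf (p + r) = A_to_Kinf p + A_to_Kinf r"
  by (induction p r rule: poly_induct2) (simp_all add: A_to_Kinf_pCons fls_plus_const algebra_simps)

lemma A_to_Kinf_minus: "A_to_Kinf (- p) = - A_to_Kinf p"
  using A_to_Kinf_add[of p "- p"] by (simp add: eq_neg_iff_add_eq_0 add.commute)

lemma A_to_Kinf_diff: "A_to_Kinf (p - r) = A_to_Kinf p - A_to_Kinf r"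
  using A_to_Kinf_add[of p "- r"] by (simp add: A_to_Kinf_minus)

lemma A_to_Kinf_smult: "A_to_Kinf (smult c p) = fls_const c * A_to_Kinf p"
  by (induction p) (simp_all add: A_to_Kinf_pCons algebra_simps flip: fls_const_mult_const)

lemma A_to_Kinf_mult: "A_to_Kinf (p * r) = A_to_Kinf p * A_to_Kinf r"
  by (induction p) (simp_all add: A_to_Kinf_pCons A_to_Kinf_add A_to_Kinf_smult algebra_simps)

lemma A_to_Kinf_power: "A_to_Kinf (p ^ m) = A_to_Kinf p ^ m"
  by (induction m) (simp_all add: A_to_Kinf_mult)

lemma matrix_to_Kinf_nth [simp]: "matrix_to_Kinf M $ i $ j = A_to_Kinf (M $ i $ j)"
  by (simp add: matrix_to_Kinf_def)

lemma atkin_lehner_matrix_eq: "atkin_lehner_matrix v = mat2 0 1 (- A_to_Kinf v) 0"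
  by (rule mat2_eqI)
     (simp_all add: atkin_lehner_matrix_def matrix_mult_nth2 A_to_Kinf_minus)

lemma Gamma_principalI:
  assumes "a * d - b * c = 1" "n dvd a - 1" "n dvd b" "n dvd c" "n dvd d - 1"
    and "M = mat2 (A_to_Kinf a) (A_to_Kinf b) (A_to_Kinf c) (A_to_Kinf d)"
  shows "M \<in> Gamma_principal n"
  unfolding Gamma_principal_def
proof (rule image_eqI)
  show "M = matrix_to_Kinf (mat2 a b c d)" unfolding assms(6) by (rule mat2_eqI) simp_all
  show "mat2 a b c d \<in> {M. det M = 1 \<and> (\<forall>i j. n dvd (M - mat 1) $ i $ j)}"
    using assms by (simp add: det_2 forall_2)
qed

lemma Gamma_principalE:
  assumes "M \<in> Gamma_principal n"
  obtains a b c d where "a * d - b * c = 1" "n dvd a - 1" "n dvd b" "n dvd c" "n dvd d - 1"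
    "M = mat2 (A_to_Kinf a) (A_to_Kinf b) (A_to_Kinf c) (A_to_Kinf d)"
proof -
  obtain Y where Y: "M = matrix_to_Kinf Y" "det Y = 1" "\<forall>i j. n dvd (Y - mat 1) $ i $ j"
    using assms by (auto simp: Gamma_principal_def)
  show ?thesis
  proof (rule that)
    show "M = mat2 (A_to_Kinf (Y $ 1 $ 1)) (A_to_Kinf (Y $ 1 $ 2)) (A_to_Kinf (Y $ 2 $ 1)) (A_to_Kinf (Y $ 2 $ 2))"
      unfolding Y(1) by (rule mat2_eqI) simp_all
  qed (use Y(2,3) in \<open>simp_all add: det_2 forall_2\<close>)
qed

text \<open>The transvection I + s u u', with u the column (a, c) and u' the row (-c, a). It fixes
  u, and over a field every unipotent matrix fixing a nonzero u has this shape.\<close>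

definition unipotent :: "'a::comm_ring_1 \<Rightarrow> 'a \<Rightarrow> 'a \<Rightarrow> 'a ^ 2 ^ 2" where
  "unipotent a c s = mat2 (1 - s * a * c) (s * a\<^sup>2) (- s * c\<^sup>2) (1 + s * a * c)"

lemma det_unipotent [simp]: "det (unipotent a c s) = 1"
  by (simp add: unipotent_def det_2 algebra_simps power2_eq_square)

lemma unipotent_lower_conj:
  "mat2 1 0 r 1 ** unipotent a c s = unipotent a (c + r * a) s ** mat2 1 0 r 1"
  by (rule mat2_eqI) (simp_all add: unipotent_def matrix_mult_nth2 algebra_simps power2_eq_square)

lemma unipotent_upper_conj:
  "mat2 1 r 0 1 ** unipotent a c s = unipotent (a + r * c) c s ** mat2 1 r 0 1"
  by (rule mat2_eqI) (simp_all add: unipotent_def matrix_mult_nth2 algebra_simps power2_eq_square)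

text \<open>The matrix of w_v sends the column (a, v c) to v times (c, -a). Rescaling a column by v
  multiplies the parameter by v^2 and the determinant v divides it once, leaving
  \<open>v * s\<close>: a factor v of the cusp is traded for one in the parameter.\<close>

lemma unipotent_atkin_lehner_conj:
  "mat2 0 1 (- v) 0 ** unipotent a (v * c) s = unipotent c (- a) (v * s) ** mat2 0 1 (- v) 0"
  by (rule mat2_eqI) (simp_all add: unipotent_def matrix_mult_nth2 algebra_simps power2_eq_square)

section \<open>The Moebius action and the slash operator\<close>

context completed_alg_closure
begin

lemma av_A_to_Kinf: "p \<noteq> 0 \<Longrightarrow> av (iota (A_to_Kinf p)) = real CARD('k) ^ degree p"
proof (induction p)
  case (pCons c p)
  have c: "av (iota (fls_const c)) \<le> 1" "c \<noteq> 0 \<Longrightarrow> av (iota (fls_const c)) = 1"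
    by (simp_all add: av_iota abs_infinity_def)
  show ?case
  proof (cases "p = 0")
    case True
    thus ?thesis using pCons c by (simp add: A_to_Kinf_pCons)
  next
    case False
    have X: "av (iota fls_X_inv) = real CARD('k)" by (simp add: av_iota abs_infinity_def)
    have "real CARD('k) ^ Suc (degree p) > 1" using q_gt_1 by (intro one_less_power) auto
    hence "av (iota (fls_const c)) < av (iota fls_X_inv * iota (A_to_Kinf p))"
      using c(1) pCons False X by (simp add: av_mult)
    from av_add_eq[OF this] show ?thesis
      using pCons False X by (simp add: A_to_Kinf_pCons iota_add iota_mult av_mult add.commute)
  qed
qed simp

lemma A_to_Kinf_eq_0_iff: "A_to_Kinf (p :: 'k poly) = 0 \<longleftrightarrow> p = 0"
proof
  assume "A_to_Kinf p = 0"
  thus "p = 0" using av_A_to_Kinf[of p] q_gt_1 by (cases "p = 0") simp_all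
qed simp

lemma A_to_Kinf_eq_iff: "A_to_Kinf (p :: 'k poly) = A_to_Kinf r \<longleftrightarrow> p = r"
  using A_to_Kinf_eq_0_iff[of "p - r"] by (simp add: A_to_Kinf_diff)

lemma OmegaD: "z \<in> Omega \<Longrightarrow> z \<noteq> iota s"
  by (auto simp: Omega_def)

lemma Omega_linear_nonzero:
  assumes "z \<in> Omega" "c \<noteq> 0 \<or> d \<noteq> 0"
  shows "iota c * z + iota d \<noteq> 0"
proof
  assume 0: "iota c * z + iota d = 0"
  show False
  proof (cases "c = 0")
    case True
    thus False using 0 assms(2) by simp
  next
    case False
    hence "z = iota (- d / c)"
      using 0 by (simp add: iota_divide iota_minus field_simps eq_neg_iff_add_eq_0)
    thus False using OmegaD[OF assms(1)] by blast
  qed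
qed

lemma det_nonzero_row2: "det (M :: 'k fls ^ 2 ^ 2) \<noteq> 0 \<Longrightarrow> M $ 2 $ 1 \<noteq> 0 \<or> M $ 2 $ 2 \<noteq> 0"
  by (auto simp: det_2)

lemma mobius_denominator:
  "z \<in> Omega \<Longrightarrow> det (M :: 'k fls ^ 2 ^ 2) \<noteq> 0 \<Longrightarrow> iota (M $ 2 $ 1) * z + iota (M $ 2 $ 2) \<noteq> 0"
  by (rule Omega_linear_nonzero[OF _ det_nonzero_row2])

lemma mobius_in_Omega:
  assumes z: "z \<in> Omega" and M: "det M \<noteq> 0"
  shows "mobius M z \<in> Omega"
proof -
  have "mobius M z \<noteq> iota s" for s
  proof
    assume "mobius M z = iota s"
    hence "iota (M$1$1) * z + iota (M$1$2) = iota s * (iota (M$2$1) * z + iota (M$2$2))"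
      using mobius_denominator[OF z M] by (simp add: mobius_def field_simps)
    hence e: "iota (M$1$1 - s * M$2$1) * z + iota (M$1$2 - s * M$2$2) = 0"
      by (simp add: iota_diff iota_mult algebra_simps)
    have "M$1$1 - s * M$2$1 = 0 \<and> M$1$2 - s * M$2$2 = 0"
      using Omega_linear_nonzero[OF z] e by blast
    hence "M$1$1 = s * M$2$1" "M$1$2 = s * M$2$2" by (simp_all only: right_minus_eq)
    hence "det M = s * M$2$1 * M$2$2 - s * M$2$2 * M$2$1" by (simp only: det_2)
    hence "det M = 0" by (simp add: algebra_simps)
    thus False using M by simp
  qed
  thus ?thesis by (auto simp: Omega_def)
qed

text \<open>Stated for both rows at once: \<open>i = 2\<close> is the cocycle relation of the
  automorphy factor, and the quotient of the rows is the composition law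
  \<open>mobius_mult\<close>.\<close>

lemma mobius_cocycle:
  assumes "z \<in> Omega" "det N \<noteq> 0"
  shows "iota ((M ** N :: 'k fls ^ 2 ^ 2) $ i $ 1) * z + iota ((M ** N) $ i $ 2)
    = (iota (M $ i $ 1) * mobius N z + iota (M $ i $ 2)) * (iota (N $ 2 $ 1) * z + iota (N $ 2 $ 2))"
proof -
  let ?n = "\<lambda>i. iota (N $ i $ 1) * z + iota (N $ i $ 2)"
  have "mobius N z * ?n 2 = ?n 1" using mobius_denominator[OF assms] by (simp add: mobius_def)
  hence "(iota (M $ i $ 1) * mobius N z + iota (M $ i $ 2)) * ?n 2 = iota (M $ i $ 1) * ?n 1 + iota (M $ i $ 2) * ?n 2"
    by (simp add: distrib_right mult.assoc)
  also have "\<dots> = iota ((M ** N) $ i $ 1) * z + iota ((M ** N) $ i $ 2)"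
    by (simp add: matrix_mult_nth2 iota_add iota_mult algebra_simps)
  finally show ?thesis by simp
qed

lemma mobius_mult:
  assumes "z \<in> Omega" "det N \<noteq> 0"
  shows "mobius (M ** N) z = mobius M (mobius N z)"
  unfolding mobius_def[of "M ** N"] mobius_cocycle[OF assms]
  using mobius_denominator[OF assms] by (simp add: mobius_def[of M])

lemma slash_mult:
  assumes "det N \<noteq> 0"
  shows "slash k m (slash k m f M) N = slash k m f (M ** N)"
proof
  fix z
  show "slash k m (slash k m f M) N z = slash k m f (M ** N) z"
    using assms mobius_in_Omega[of z N] mobius_mult[of z N M] mobius_cocycle[of z N M 2]
    by (simp add: slash_def det_mul iota_mult power_mult_distrib mult_ac)
qed

lemma slash_mat_1:
  assumes "\<And>z. z \<notin> Omega \<Longrightarrow> f z = 0"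
  shows "slash k m f (mat 1) = f"
proof
  fix z show "slash k m f (mat 1) z = f z"
    using assms[of z] by (simp add: slash_def mobius_def)
qed

lemma slash_add: "slash k m (\<lambda>z. f z + g z) M = (\<lambda>z. slash k m f M z + slash k m g M z)"
  by (rule ext) (simp add: slash_def distrib_left)

lemma slash_diff: "slash k m (\<lambda>z. f z - g z) M = (\<lambda>z. slash k m f M z - slash k m g M z)"
  by (rule ext) (simp add: slash_def right_diff_distrib)

lemma slash_uminus: "slash k m (\<lambda>z. - g z) M = (\<lambda>z. - slash k m g M z)"
  by (rule ext) (simp add: slash_def algebra_simps)

lemma pullback_eq_slash: "pullback M f = slash 2 1 f M"
  by (rule ext) (simp add: pullback_def slash_def)

lemma slash_fixed_conj:
  assumes "slash k m f G = f" "slash k m f U' = f" "G ** U = U' ** G" "det U \<noteq> 0" "det G \<noteq> 0"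
  shows "slash k m f U = f"
proof -
  have "slash k m f U = slash k m (slash k m f G) U" by (simp only: assms(1))
  also have "\<dots> = slash k m (slash k m f U') G" by (simp only: slash_mult assms(3-5) not_False_eq_True)
  also have "\<dots> = f" by (simp only: assms(1,2))
  finally show ?thesis .
qed


subsection \<open>Invariance under accumulating translations\<close>

text \<open>The square of the matrix is the scalar -v, on which weight 2 and type 1 give the factor
  v^2 / (-v)^2 = 1.\<close>

lemma slash_atkin_lehner_twice:
  assumes "\<And>z. z \<notin> Omega \<Longrightarrow> f z = 0" "v \<noteq> 0"
  shows "slash 2 1 (slash 2 1 f (atkin_lehner_matrix v)) (atkin_lehner_matrix v) = f"
proof -
  let ?v = "A_to_Kinf v"
  have v: "?v \<noteq> 0" using assms(2) by (simp add: A_to_Kinf_eq_0_iff)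
  have "slash 2 1 (slash 2 1 f (atkin_lehner_matrix v)) (atkin_lehner_matrix v)
    = slash 2 1 f (mat2 (- ?v) 0 0 (- ?v))"
  proof (subst slash_mult)
    show "det (atkin_lehner_matrix v) \<noteq> 0" using v by (simp add: atkin_lehner_matrix_eq det_2)
    have "atkin_lehner_matrix v ** atkin_lehner_matrix v = mat2 (- ?v) 0 0 (- ?v)"
      by (rule mat2_eqI) (simp_all add: atkin_lehner_matrix_eq matrix_mult_nth2)
    thus "slash 2 1 f (atkin_lehner_matrix v ** atkin_lehner_matrix v)
      = slash 2 1 f (mat2 (- ?v) 0 0 (- ?v))" by simp
  qed
  also have "\<dots> = f"
    using assms(1) v by (auto simp: slash_def mobius_def det_2 iota_mult iota_minus power2_eq_square)
  finally show ?thesis .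
qed

text \<open>
  The group generated by \<open>\<Gamma>(n)\<close> and its conjugate by \<open>w\<^sub>v\<close> contains unipotent elements fixing any
  prescribed cusp \<open>(a : c)\<close> with arbitrarily large powers of \<open>v\<close> in the denominator: an element of
  \<open>\<Gamma>(n)\<close> makes \<open>c\<close> divisible by \<open>v\<close>, and conjugation by \<open>w\<^sub>v\<close> then removes one power.
\<close>

lemma unipotent_invariance:
  fixes v n :: "'k poly"
  assumes v: "irreducible v" and n: "\<not> v dvd n"
    and f: "\<And>M. M \<in> Gamma_principal n \<Longrightarrow> slash 2 1 f M = f"
    and g: "\<And>M. M \<in> Gamma_principal n \<Longrightarrow> slash 2 1 g M = g"
    and fg: "slash 2 1 f (atkin_lehner_matrix v) = (\<lambda>z. - g z)"
    and gf: "slash 2 1 g (atkin_lehner_matrix v) = (\<lambda>z. - f z)"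
    and "a * x + c * y = 1"
  defines "s \<equiv> \<lambda>j. A_to_Kinf n / A_to_Kinf v ^ j"
  shows "slash 2 1 f (unipotent (A_to_Kinf a) (A_to_Kinf c) (s j)) = f \<and>
         slash 2 1 g (unipotent (A_to_Kinf a) (A_to_Kinf c) (s j)) = g"
  using \<open>a * x + c * y = 1\<close>
\<comment> \<open>The cusp has to vary, since one step passes from (a : v c) to (c : -a).\<close>
proof (induction j arbitrary: a c x y)
  case 0
  have "unipotent (A_to_Kinf a) (A_to_Kinf c) (s 0) \<in> Gamma_principal n"
  proof (rule Gamma_principalI)
    show "(1 - n * a * c) * (1 + n * a * c) - n * a\<^sup>2 * (- n * c\<^sup>2) = 1"
      by (simp add: algebra_simps power2_eq_square)
    show "unipotent (A_to_Kinf a) (A_to_Kinf c) (s 0) = mat2 (A_to_Kinf (1 - n * a * c))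
        (A_to_Kinf (n * a\<^sup>2)) (A_to_Kinf (- n * c\<^sup>2)) (A_to_Kinf (1 + n * a * c))"
      by (simp add: unipotent_def s_def A_to_Kinf_diff A_to_Kinf_add A_to_Kinf_mult A_to_Kinf_minus
         A_to_Kinf_power)
  qed (simp_all add: mult.assoc)
  thus ?case using f g by blast
next
  case (Suc j)
  let ?A = A_to_Kinf
  \<comment> \<open>Both functions are carried along because w_v exchanges them up to sign.\<close>
  define Q where "Q = (\<lambda>a c. slash 2 1 f (unipotent (?A a) (?A c) (s (Suc j))) = f \<and>
      slash 2 1 g (unipotent (?A a) (?A c) (s (Suc j))) = g)"
  have v0: "?A v \<noteq> 0" "v \<noteq> 0" using v by (auto simp: A_to_Kinf_eq_0_iff irreducible_def)
  let ?W = "mat2 0 1 (- ?A v) 0"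
  have detW: "det ?W \<noteq> 0" using v0 by (simp add: det_2)
  note fg' = fg[unfolded atkin_lehner_matrix_eq] and gf' = gf[unfolded atkin_lehner_matrix_eq]
  have divisible: "Q a (v * c)" if "a * x + v * c * y = 1" for a c x y
  proof -
    define U where "U = unipotent (?A a) (?A (v * c)) (s (Suc j))"
    define U' where "U' = unipotent (?A c) (?A (- a)) (s j)"
    have "c * (v * y) + (- a) * (- x) = 1" using that by (simp add: algebra_simps)
    from Suc.IH[OF this] have U': "slash 2 1 f U' = f" "slash 2 1 g U' = g" by (auto simp: U'_def)
    have "?A v * s (Suc j) = s j" using v0 by (simp add: s_def)
    hence WU: "?W ** U = U' ** ?W"
      unfolding U_def U'_def A_to_Kinf_mult A_to_Kinf_minus
      using unipotent_atkin_lehner_conj[of "?A v" "?A a" "?A c" "s (Suc j)"] by simp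
    have detU: "det U \<noteq> 0" by (simp add: U_def)
    have step: "slash 2 1 f1 U = f1"
      if "slash 2 1 g1 U' = g1" "slash 2 1 g1 ?W = (\<lambda>z. - f1 z)" for f1 g1
    proof -
      have "slash 2 1 (slash 2 1 g1 ?W) U = slash 2 1 g1 ?W"
        using slash_mult[OF detU, of 2 1 g1 ?W] slash_mult[OF detW, of 2 1 g1 U'] that(1) WU by simp
      hence "(\<lambda>z. - slash 2 1 f1 U z) = (\<lambda>z. - f1 z)" unfolding that(2) slash_uminus .
      thus ?thesis by (simp add: fun_eq_iff)
    qed
    show ?thesis using step[OF U'(2) gf'] step[OF U'(1) fg'] by (simp add: Q_def U_def)
  qed
  have first_coprime: "Q a c" if ax: "a * x + c * y = 1" and a: "\<not> v dvd a" for a c x y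
  proof -
    \<comment> \<open>Inverting \<open>n * a\<close> modulo \<open>v\<close> solves c + n r a = 0
      modulo \<open>v\<close>, so a lower shear in \<Gamma>(n) makes the second coordinate divisible
      by \<open>v\<close>.\<close>
    have "\<not> v dvd n * a" using irreducible_poly_dvd_multD[OF v _ n] a by blast
    then obtain i k where "v * i + n * a * k = 1" using irreducible_poly_bezout[OF v] by blast
    hence "c * (v * i + n * a * k) = c" by simp
    hence "c + n * (- k * c) * a = v * (c * i)" by (simp add: algebra_simps)
    then obtain r c' where r: "c + n * r * a = v * c'" by blast
    have "a * (x - n * r * y) + v * c' * y = 1" unfolding r[symmetric] using ax by (simp add: algebra_simps)
    hence *: "Q a (c + n * r * a)" unfolding r by (rule divisible)
    have G: "mat2 1 0 (?A (n * r)) 1 \<in> Gamma_principal n"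
      by (rule Gamma_principalI[of 1 1 0 "n * r"]) simp_all
    have conj: "mat2 1 0 (?A (n * r)) 1 ** unipotent (?A a) (?A c) (s (Suc j))
       = unipotent (?A a) (?A (c + n * r * a)) (s (Suc j)) ** mat2 1 0 (?A (n * r)) 1"
      by (simp add: unipotent_lower_conj A_to_Kinf_add A_to_Kinf_mult)
    have "det (mat2 1 0 (?A (n * r)) 1) \<noteq> 0" by (simp add: det_2)
    thus ?thesis using * slash_fixed_conj[OF f[OF G] _ conj] slash_fixed_conj[OF g[OF G] _ conj]
      by (simp add: Q_def)
  qed
  have "Q a c"
  proof (cases "v dvd a")
    case False
    thus ?thesis using first_coprime Suc.prems by blast
  next
    case True
    \<comment> \<open>As \<open>c\<close> is prime to \<open>v\<close>, the upper shear by
      \<open>n\<close> makes the first coordinate prime to \<open>v\<close>, which is the previous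
      case.\<close>
    have "\<not> v dvd c"
    proof
      assume "v dvd c"
      hence "v dvd 1" using True Suc.prems by (metis dvd_add dvd_mult2)
      thus False using v by (auto simp: irreducible_def)
    qed
    hence "\<not> v dvd n * c" using irreducible_poly_dvd_multD[OF v _ n] by blast
    hence nv: "\<not> v dvd a + n * c" using True by (simp add: dvd_add_right_iff)
    have "(a + n * c) * x + c * (y - n * x) = 1" using Suc.prems by (simp add: algebra_simps)
    hence *: "Q (a + n * c) c" using nv by (rule first_coprime)
    have G: "mat2 1 (?A n) 0 1 \<in> Gamma_principal n"
      by (rule Gamma_principalI[of 1 1 n 0]) simp_all
    have conj: "mat2 1 (?A n) 0 1 ** unipotent (?A a) (?A c) (s (Suc j))
       = unipotent (?A (a + n * c)) (?A c) (s (Suc j)) ** mat2 1 (?A n) 0 1"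
      by (simp add: unipotent_upper_conj A_to_Kinf_add A_to_Kinf_mult)
    have "det (mat2 1 (?A n) 0 1) \<noteq> 0" by (simp add: det_2)
    thus ?thesis using * slash_fixed_conj[OF f[OF G] _ conj] slash_fixed_conj[OF g[OF G] _ conj]
      by (simp add: Q_def)
  qed
  thus ?case by (simp add: Q_def)
qed

text \<open>
  Accumulating translations make \<open>f\<close> locally constant, which is incompatible with the nontrivial
  automorphy factor of a lower unipotent element.
\<close>

lemma vanishes_if_translations_accumulate:
  assumes f: "rigid_analytic f" "\<And>z. z \<notin> Omega \<Longrightarrow> f z = 0"
    and b: "inj b" "(\<lambda>j. av (iota (b j))) \<longlonglongrightarrow> 0" "\<And>j. slash 2 1 f (mat2 1 (b j) 0 1) = f"
    and c: "c \<noteq> 0" "slash 2 1 f (mat2 1 0 c 1) = f"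
  shows "f z = 0"
proof (rule ccontr)
  assume fz: "f z \<noteq> 0"
  have z: "z \<in> Omega" using fz f(2) by blast
  have inj: "inj (\<lambda>j. iota (b j))" using b(1) by (auto simp: inj_def)
  have locally_const: "\<exists>\<rho>>0. \<forall>y. av y < \<rho> \<longrightarrow> z + y \<in> Omega \<and> f (z + y) = f z" if z: "z \<in> Omega" for z
  proof (rule rigid_analytic_locally_constant[OF f(1) z inj b(2)])
    fix j
    show "f (z + iota (b j)) = f z"
      using fun_cong[OF b(3)[of j], of z] z by (simp add: slash_def mobius_def det_2)
  qed
  let ?L = "mat2 1 0 c 1"
  define J where "J = iota c * z + 1"
  define w where "w = z / J"
  have J0: "J \<noteq> 0" using Omega_linear_nonzero[OF z, of c 1] by (simp add: J_def)
  have w: "w \<in> Omega" "f w = J\<^sup>2 * f z"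
    using mobius_in_Omega[OF z, of ?L] fun_cong[OF c(2), of z] z J0
    by (simp_all add: det_2 mobius_def slash_def w_def J_def field_simps)
  obtain \<rho>1 where \<rho>1: "\<rho>1 > 0" "\<And>y. av y < \<rho>1 \<Longrightarrow> z + y \<in> Omega \<and> f (z + y) = f z"
    using locally_const[OF z] by blast
  obtain \<rho>2 where \<rho>2: "\<rho>2 > 0" "\<And>y. av y < \<rho>2 \<Longrightarrow> w + y \<in> Omega \<and> f (w + y) = f w"
    using locally_const[OF w(1)] by blast
  \<comment> \<open>The three bounds keep z + y where \<open>f\<close> equals f(z), keep |c y| < |J|
    so that the denominator does not change size, and keep the image of z + y where \<open>f\<close>
    equals f(w).\<close>
  define \<rho> where "\<rho> = min \<rho>1 (min (av J / av (iota c)) (\<rho>2 * (av J)\<^sup>2))"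
  have avpos: "av J > 0" "av (iota c) > 0" using J0 c by (auto intro: av_pos)
  have "\<rho> > 0" using \<rho>1 \<rho>2 avpos by (simp add: \<rho>_def)
  \<comment> \<open>Local constancy at \<open>z\<close> and at its image \<open>w\<close> forces the
    automorphy factors at \<open>z\<close> and z + y to have equal squares, while y is
    nonzero.\<close>
  have key: "iota c * y = - 2 * J" if y: "0 < av y" "av y < \<rho>" for y
  proof -
    have "av (iota c * y) < av J" using y avpos by (simp add: \<rho>_def av_mult field_simps)
    hence J': "av (J + iota c * y) = av J" by (rule av_add_eq)
    hence J'0: "J + iota c * y \<noteq> 0" using avpos by force
    have zy: "z + y \<in> Omega" "f (z + y) = f z" using \<rho>1(2)[of y] y by (auto simp: \<rho>_def)
    have den: "iota c * (z + y) + 1 = J + iota c * y" by (simp add: J_def algebra_simps)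
    have "(z + y) / (J + iota c * y) - w = y / (J * (J + iota c * y))"
      using J0 J'0 by (simp add: w_def field_simps) (simp add: J_def algebra_simps)
    hence "av ((z + y) / (J + iota c * y) - w) = av y / (av J)\<^sup>2"
      by (simp add: av_divide av_mult J' power2_eq_square)
    also have "\<dots> < \<rho>2" using y avpos by (simp add: \<rho>_def field_simps)
    finally have "f ((z + y) / (J + iota c * y)) = f w"
      using \<rho>2(2)[of "(z + y) / (J + iota c * y) - w"] by simp
    moreover have "f ((z + y) / (J + iota c * y)) = (J + iota c * y)\<^sup>2 * f (z + y)"
    proof -
      have "1 / (J + iota c * y)\<^sup>2 * f ((z + y) / (J + iota c * y)) = f (z + y)"
        using fun_cong[OF c(2), of "z + y"] zy(1) by (simp add: slash_def mobius_def det_2 den)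
      thus ?thesis using J'0 by (simp add: field_simps)
    qed
    ultimately have "(J + iota c * y)\<^sup>2 * f z = J\<^sup>2 * f z" using w(2) zy(2) by simp
    hence "(J + iota c * y)\<^sup>2 = J\<^sup>2" using fz by simp
    hence "iota c * y * (iota c * y + 2 * J) = 0"
      by (simp add: algebra_simps power2_eq_square)
    moreover have "y \<noteq> 0" using y by auto
    ultimately have "iota c * y + 2 * J = 0" using c(1) by simp
    thus ?thesis by (simp add: eq_neg_iff_add_eq_0)
  qed
  \<comment> \<open>Two points of different size cannot both equal -2J/c. This works in every
    characteristic, including 2, where -2J vanishes.\<close>
  obtain y1 where y1: "\<rho> / 2 < av y1" "av y1 < \<rho>" using value_group_dense[of "\<rho> / 2" \<rho>] \<open>\<rho> > 0\<close> by auto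
  have "0 < av y1" using y1 \<open>\<rho> > 0\<close> by linarith
  then obtain y2 where y2: "av y1 / 2 < av y2" "av y2 < av y1"
    using value_group_dense[of "av y1 / 2" "av y1"] by auto
  have "iota c * y1 = iota c * y2" using key[of y1] key[of y2] y1 y2 \<open>0 < av y1\<close> by simp
  hence "y1 = y2" using c(1) by simp
  thus False using y2 by simp
qed


subsection \<open>Operations on rigid analytic functions\<close>

lemma rigid_analytic_add_mult:
  assumes f: "rigid_analytic f" and g: "rigid_analytic g" and c: "av c \<le> 1"
  shows "rigid_analytic (\<lambda>z. f z + c * g z)"
  unfolding rigid_analytic_def
proof (intro allI impI)
  fix r and e :: real assume "e > 0"
  obtain p d where pd: "\<And>w. w \<in> Omega_affinoid r \<Longrightarrow> poly d w \<noteq> 0"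
      "\<And>w. w \<in> Omega_affinoid r \<Longrightarrow> av (f w - poly p w / poly d w) < e"
    using f \<open>e > 0\<close> unfolding rigid_analytic_def by meson
  obtain p' d' where pd': "\<And>w. w \<in> Omega_affinoid r \<Longrightarrow> poly d' w \<noteq> 0"
      "\<And>w. w \<in> Omega_affinoid r \<Longrightarrow> av (g w - poly p' w / poly d' w) < e"
    using g \<open>e > 0\<close> unfolding rigid_analytic_def by meson
  have "poly (d * d') w \<noteq> 0 \<and>
      av (f w + c * g w - poly (p * d' + smult c (p' * d)) w / poly (d * d') w) < e"
    if w: "w \<in> Omega_affinoid r" for w
  proof -
    note nz = pd(1)[OF w] pd'(1)[OF w]
    have "poly (p * d' + smult c (p' * d)) w / poly (d * d') w
        = poly p w / poly d w + c * (poly p' w / poly d' w)"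
      using nz by (simp add: add_divide_distrib)
    hence eq: "f w + c * g w - poly (p * d' + smult c (p' * d)) w / poly (d * d') w
        = (f w - poly p w / poly d w) + c * (g w - poly p' w / poly d' w)"
      by (simp add: algebra_simps)
    have "av (c * (g w - poly p' w / poly d' w)) \<le> 1 * av (g w - poly p' w / poly d' w)"
      unfolding av_mult using c av_nonneg by (intro mult_right_mono) auto
    hence "av (c * (g w - poly p' w / poly d' w)) < e" using pd'(2)[OF w] by simp
    hence "av ((f w - poly p w / poly d w) + c * (g w - poly p' w / poly d' w)) < e"
      using pd(2)[OF w] av_ultrametric[of "f w - poly p w / poly d w" "c * (g w - poly p' w / poly d' w)"]
      by simp
    hence "av (f w + c * g w - poly (p * d' + smult c (p' * d)) w / poly (d * d') w) < e"
      unfolding eq .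
    thus ?thesis using nz by simp
  qed
  thus "\<exists>p d. \<forall>z\<in>Omega_affinoid r. poly d z \<noteq> 0 \<and> av (f z + c * g z - poly p z / poly d z) < e"
    by blast
qed

lemma rigid_analytic_add:
  assumes "rigid_analytic f" "rigid_analytic g"
  shows "rigid_analytic (\<lambda>z. f z + g z)"
  using rigid_analytic_add_mult[OF assms, of 1] by simp

lemma rigid_analytic_diff:
  assumes "rigid_analytic f" "rigid_analytic g"
  shows "rigid_analytic (\<lambda>z. f z - g z)"
  using rigid_analytic_add_mult[OF assms, of "-1"] by simp

lemma poly_at_reciprocal:
  fixes p :: "'c poly"
  shows "\<exists>p' N. \<forall>z. z \<noteq> 0 \<longrightarrow> poly p (c / z) * z ^ N = poly p' z"
proof (induction p)
  case 0
  show ?case by (auto intro: exI[of _ 0])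
next
  case (pCons a p)
  then obtain p' N where p': "\<And>z. z \<noteq> 0 \<Longrightarrow> poly p (c / z) * z ^ N = poly p' z" by blast
  have "poly (pCons a p) (c / z) * z ^ Suc N = poly (monom a (Suc N) + smult c p') z"
    if z: "z \<noteq> 0" for z
    using p'[OF z, symmetric] z by (simp add: poly_monom algebra_simps)
  thus ?case by blast
qed

text \<open>The identity c/z - s = -(s/z) (z - c/s) turns the distance of c/z from K_inf into that
  of z. It is needed for s at least as large as c/z; subtracting a smaller s does not change
  |c/z|.\<close>

lemma reciprocal_Omega_affinoid:
  assumes "c \<noteq> 0"
  shows "\<exists>r'. \<forall>z\<in>Omega_affinoid r. iota c / z \<in> Omega_affinoid r'"
proof -
  define Q where "Q = real CARD('k) ^ r"
  define C where "C = av (iota c)"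
  have Q1: "Q \<ge> 1" using q_gt_1 unfolding Q_def by (intro one_le_power) simp
  have C: "C > 0" using assms by (simp add: C_def av_pos)
  \<comment> \<open>On the affinoid, |z| lies between 1/Q and Q. Hence |c/z| is at most
    \<open>C * Q\<close>, and its distance from K_inf is at least (C/Q)/Q times 1/Q, the reciprocal
    of the second bound.\<close>
  obtain r' where r': "max (C * Q) (Q * Q * Q / C) < real CARD('k) ^ r'"
    using real_arch_pow[OF q_gt_1] by blast
  have "Q * 1 \<le> Q * (Q * Q)" using Q1 by (intro mult_left_mono) (auto intro: mult_mono[of 1 Q 1 Q, simplified])
  hence Q3: "Q \<le> Q * Q * Q" by (simp add: mult.assoc)
  have r'1: "1 / real CARD('k) ^ r' \<le> C / (Q * Q * Q)"
    using r' C Q1 q_gt_1 by (simp add: field_simps)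
  have "iota c / z \<in> Omega_affinoid r'" if z: "z \<in> Omega_affinoid r" for z
  proof -
    have zQ: "av z \<le> Q" and zs: "\<And>s. 1 / Q \<le> av (z - iota s)"
      using z by (auto simp: Omega_affinoid_def Q_def)
    have z1: "1 / Q \<le> av z" using zs[of 0] by simp
    have "1 / Q > 0" using Q1 by simp
    hence avz: "av z > 0" using z1 by linarith
    hence z0: "z \<noteq> 0" by auto
    have "av (iota c / z) = C / av z" by (simp add: av_divide C_def)
    also have "\<dots> \<le> C / (1 / Q)" using z1 avz Q1 C by (intro divide_left_mono) auto
    finally have 1: "av (iota c / z) \<le> real CARD('k) ^ r'" using r' by simp
    have low: "C / Q \<le> av (iota c / z)"
      using zQ avz C by (simp add: av_divide C_def divide_left_mono)
    have "C / (Q * Q * Q) \<le> av (iota c / z - iota s)" for s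
    proof (cases "av (iota s) < av (iota c / z)")
      case True
      have "C / (Q * Q * Q) \<le> C / Q" using Q3 C Q1 by (intro divide_left_mono) auto
      thus ?thesis using low av_diff_eq[OF True] by simp
    next
      case False
      hence s: "C / Q \<le> av (iota s)" using low by simp
      moreover have "C / Q > 0" using C Q1 by simp
      ultimately have "s \<noteq> 0" by auto
      hence "iota c / z - iota s = - (iota s / z) * (z - iota (c / s))"
        using z0 by (simp add: iota_divide field_simps)
      hence "av (iota c / z - iota s) = av (iota s) / av z * av (z - iota (c / s))"
        by (simp add: av_mult av_divide)
      also have "\<dots> \<ge> (C / Q) / Q * (1 / Q)"
        using s zQ avz zs[of "c / s"] C Q1 av_nonneg by (intro mult_mono frac_le) auto
      finally show ?thesis by (simp add: mult.assoc)
    qed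
    thus ?thesis using 1 r'1 by (auto simp: Omega_affinoid_def intro: order_trans)
  qed
  thus ?thesis by blast
qed

text \<open>The matrix acts by z -> -1/(v z) with factor 1/(v z^2). Both are rational, and the
  factor is bounded on an affinoid because |z| is bounded away from 0 there.\<close>

lemma rigid_analytic_atkin_lehner:
  assumes f: "rigid_analytic f" and v: "v \<noteq> 0"
  shows "rigid_analytic (slash 2 1 f (atkin_lehner_matrix v))"
  unfolding rigid_analytic_def
proof (intro allI impI)
  fix r and e :: real assume e: "e > 0"
  define V where "V = iota (A_to_Kinf v)"
  define c where "c = - 1 / A_to_Kinf v"
  have V0: "V \<noteq> 0" "A_to_Kinf v \<noteq> 0" using v by (simp_all add: V_def A_to_Kinf_eq_0_iff)
  have c: "iota c = - 1 / V" "c \<noteq> 0" using V0 by (simp_all add: c_def V_def iota_divide iota_minus)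
  define Q where "Q = real CARD('k) ^ r"
  have Q1: "Q \<ge> 1" using q_gt_1 unfolding Q_def by (intro one_le_power) simp
  have avV: "av V > 0" using V0 by (simp add: av_pos)
  obtain r' where r': "\<And>z. z \<in> Omega_affinoid r \<Longrightarrow> iota c / z \<in> Omega_affinoid r'"
    using reciprocal_Omega_affinoid[OF c(2)] by blast
  \<comment> \<open>This tolerance absorbs the factor 1/(V z^2), which is at most Q^2/|V| in
    absolute value on the affinoid.\<close>
  have "e * av V / Q\<^sup>2 > 0" using e avV Q1 by simp
  then obtain p d where pd: "\<And>w. w \<in> Omega_affinoid r' \<Longrightarrow> poly d w \<noteq> 0"
      "\<And>w. w \<in> Omega_affinoid r' \<Longrightarrow> av (f w - poly p w / poly d w) < e * av V / Q\<^sup>2"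
    using f unfolding rigid_analytic_def by meson
  obtain p' N where p': "\<And>z. z \<noteq> 0 \<Longrightarrow> poly p (iota c / z) * z ^ N = poly p' z"
    using poly_at_reciprocal by blast
  obtain d' M where d': "\<And>z. z \<noteq> 0 \<Longrightarrow> poly d (iota c / z) * z ^ M = poly d' z"
    using poly_at_reciprocal by blast
  \<comment> \<open>\<open>N\<close> and \<open>M\<close> are the powers of z clearing
    \<open>p\<close> and \<open>d\<close> after the substitution; \<open>V\<close> and the extra
    exponent 2 are the automorphy factor.\<close>
  have "poly (monom V (N + 2) * d') z \<noteq> 0 \<and> av (slash 2 1 f (atkin_lehner_matrix v) z
      - poly (p' * monom 1 M) z / poly (monom V (N + 2) * d') z) < e" if z: "z \<in> Omega_affinoid r" for z
  proof -
    have zO: "z \<in> Omega" using z Omega_affinoid_subset by blast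
    have z0: "z \<noteq> 0" using OmegaD[OF zO, of 0] by simp
    have z1: "1 / Q \<le> av z" using z by (auto simp: Omega_affinoid_def Q_def dest: spec[of _ 0])
    let ?w = "iota c / z"
    have w: "poly d ?w \<noteq> 0" "av (f ?w - poly p ?w / poly d ?w) < e * av V / Q\<^sup>2"
      using pd r'[OF z] by blast+
    have d'0: "poly d' z \<noteq> 0" using d'[OF z0] w(1) z0 by (metis mult_eq_0_iff power_not_zero)
    have sl: "slash 2 1 f (atkin_lehner_matrix v) z = 1 / (V * z\<^sup>2) * f ?w"
    proof -
      have "mobius (atkin_lehner_matrix v) z = ?w"
        using V0 z0 by (simp add: mobius_def atkin_lehner_matrix_eq iota_minus c V_def)
      thus ?thesis using zO V0 z0
        by (simp add: slash_def atkin_lehner_matrix_eq det_2 iota_minus V_def power2_eq_square)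
    qed
    have "poly (p' * monom 1 M) z / poly (monom V (N + 2) * d') z = 1 / (V * z\<^sup>2) * (poly p ?w / poly d ?w)"
      using z0 V0 w(1)
      by (simp add: poly_monom p'[OF z0, symmetric] d'[OF z0, symmetric] power_add power2_eq_square)
    hence "slash 2 1 f (atkin_lehner_matrix v) z - poly (p' * monom 1 M) z / poly (monom V (N + 2) * d') z
       = 1 / (V * z\<^sup>2) * (f ?w - poly p ?w / poly d ?w)"
      unfolding sl by (simp only: right_diff_distrib)
    hence "av (slash 2 1 f (atkin_lehner_matrix v) z - poly (p' * monom 1 M) z / poly (monom V (N + 2) * d') z)
       = 1 / (av V * (av z)\<^sup>2) * av (f ?w - poly p ?w / poly d ?w)"
      by (simp add: av_mult av_divide av_power)
    also have "\<dots> \<le> Q\<^sup>2 / av V * av (f ?w - poly p ?w / poly d ?w)"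
    proof (intro mult_right_mono)
      have "(1 / Q)\<^sup>2 \<le> (av z)\<^sup>2" using z1 Q1 by (intro power_mono) auto
      hence "1 / (av z)\<^sup>2 \<le> Q\<^sup>2" using av_pos[OF z0] Q1 by (simp add: field_simps)
      thus "1 / (av V * (av z)\<^sup>2) \<le> Q\<^sup>2 / av V" using avV by (simp add: field_simps)
    qed (rule av_nonneg)
    also have "\<dots> < Q\<^sup>2 / av V * (e * av V / Q\<^sup>2)"
      using w(2) avV Q1 by (intro mult_strict_left_mono) auto
    also have "\<dots> = e" using avV Q1 by simp
    finally show ?thesis using d'0 V0 z0 by (simp add: poly_monom)
  qed
  thus "\<exists>p d. \<forall>z\<in>Omega_affinoid r. poly d z \<noteq> 0 \<and>
      av (slash 2 1 f (atkin_lehner_matrix v) z - poly p z / poly d z) < e" by blast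
qed

end

subsection \<open>Exponential functions of lattices\<close>

definition add_subgroup :: "'a::ab_group_add set \<Rightarrow> bool" where
  "add_subgroup V \<longleftrightarrow> 0 \<in> V \<and> (\<forall>x\<in>V. \<forall>y\<in>V. x - y \<in> V)"

lemma add_subgroup_uminus: "add_subgroup V \<Longrightarrow> x \<in> V \<Longrightarrow> - x \<in> V"
  unfolding add_subgroup_def by (metis diff_0)

lemma add_subgroup_add: "add_subgroup V \<Longrightarrow> x \<in> V \<Longrightarrow> y \<in> V \<Longrightarrow> x + y \<in> V"
  using add_subgroup_uminus[of V y] unfolding add_subgroup_def
  by (metis diff_minus_eq_add)

lemma add_subgroup_translate_image:
  assumes "add_subgroup V" "y \<in> V"
  shows "(\<lambda>b. b - y) ` V = V"
proof (intro equalityI subsetI)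
  fix x assume "x \<in> V"
  hence "x + y \<in> V" using assms by (simp add: add_subgroup_add)
  thus "x \<in> (\<lambda>b. b - y) ` V" by (intro image_eqI[of _ _ "x + y"]) auto
qed (use assms in \<open>auto simp: add_subgroup_def\<close>)

lemma prod_translate:
  fixes V :: "'a::field set"
  assumes "add_subgroup V" "y \<in> V"
  shows "(\<Prod>b\<in>V. x + y - b) = (\<Prod>b\<in>V. x - b)"
proof -
  have "(\<Prod>b\<in>V. x - b) = (\<Prod>b\<in>(\<lambda>b. b - y) ` V. x - b)"
    using add_subgroup_translate_image[OF assms] by simp
  also have "\<dots> = (\<Prod>b\<in>V. x - (b - y))" by (subst prod.reindex) (auto simp: inj_on_def)
  finally show ?thesis by (simp add: algebra_simps)
qed

text \<open>After subtraction of its value at x = 0 the left side is monic in x of degree card V,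
  like the product over x - b, and by translation invariance both vanish on \<open>V\<close>. So
  they coincide.\<close>

lemma prod_minus_roots_additive:
  fixes V :: "'a::field set"
  assumes V: "add_subgroup V" "finite V"
  shows "(\<Prod>b\<in>V. x + y - b) = (\<Prod>b\<in>V. x - b) + (\<Prod>b\<in>V. y - b)"
proof -
  define p1 where "p1 = (\<Prod>b\<in>V. [:y - b, 1:]) - [:\<Prod>b\<in>V. y - b:]"
  define p2 where "p2 = (\<Prod>b\<in>V. [:- b, 1:])"
  have V0: "0 \<in> V" using V by (simp add: add_subgroup_def)
  hence card: "card V > 0" using V(2) by (auto simp: card_gt_0_iff)
  have deg: "degree (\<Prod>b\<in>V. [:h b, 1:]) = card V" for h :: "'a \<Rightarrow> 'a"
    by (subst degree_prod_eq_sum_degree) auto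
  have lead: "coeff (\<Prod>b\<in>V. [:h b, 1:]) (card V) = 1" for h :: "'a \<Rightarrow> 'a"
    using lead_coeff_prod[of "\<lambda>b. [:h b, 1:]" V] by (simp add: deg)
  have "p1 = p2"
  proof (rule poly_eqI_degree_lead_coeff)
    show "coeff p1 (card V) = coeff p2 (card V)"
      using card by (simp add: p1_def p2_def lead coeff_pCons split: nat.split)
    show "card V \<le> card V" ..
    show "degree p1 \<le> card V" unfolding p1_def by (intro degree_diff_le) (auto simp: deg)
    show "degree p2 \<le> card V" unfolding p2_def by (simp add: deg)
    fix z assume z: "z \<in> V"
    have "poly p2 z = 0" unfolding p2_def poly_prod using z V(2) by (intro prod_zero) auto
    moreover have "poly p1 z = (\<Prod>b\<in>V. y + z - b) - (\<Prod>b\<in>V. y - b)"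
      unfolding p1_def by (simp add: poly_prod algebra_simps)
    ultimately show "poly p1 z = poly p2 z" using prod_translate[OF V(1) z, of y] by simp
  qed
  hence "poly p1 x = poly p2 x" by simp
  thus ?thesis unfolding p1_def p2_def by (simp add: poly_prod algebra_simps)
qed

text \<open>For a finite subgroup \<open>V\<close>, the additive polynomial with root set
  \<open>V\<close>, normalised by linear instead of leading coefficient 1, so that it converges when
  \<open>V\<close> runs through growing balls of a lattice.\<close>

definition finite_exp :: "'a::field set \<Rightarrow> 'a \<Rightarrow> 'a" where
  "finite_exp V z = z * (\<Prod>b\<in>V - {0}. 1 - z / b)"

lemma prod_minus_roots_eq_finite_exp:
  fixes V :: "'a::field set"
  assumes "finite V" "0 \<in> V"
  shows "(\<Prod>b\<in>V. z - b) = (\<Prod>b\<in>V - {0}. - b) * finite_exp V z"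
proof -
  have "(\<Prod>b\<in>V. z - b) = z * (\<Prod>b\<in>V - {0}. z - b)"
    using prod.remove[OF assms, of "\<lambda>b. z - b"] by simp
  also have "(\<Prod>b\<in>V - {0}. z - b) = (\<Prod>b\<in>V - {0}. - b * (1 - z / b))"
    by (intro prod.cong) (auto simp: field_simps)
  also have "\<dots> = (\<Prod>b\<in>V - {0}. - b) * (\<Prod>b\<in>V - {0}. 1 - z / b)" by (rule prod.distrib)
  finally show ?thesis by (simp add: finite_exp_def mult_ac)
qed

lemma finite_exp_add:
  fixes V :: "'a::field set"
  assumes "add_subgroup V" "finite V"
  shows "finite_exp V (x + y) = finite_exp V x + finite_exp V y"
proof -
  have 0: "0 \<in> V" using assms by (simp add: add_subgroup_def)
  let ?k = "\<Prod>b\<in>V - {0}. - b"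
  have "?k \<noteq> 0" using assms(2) by simp
  moreover have "?k * finite_exp V (x + y) = ?k * (finite_exp V x + finite_exp V y)"
    using prod_minus_roots_additive[OF assms, of x y]
    by (simp add: prod_minus_roots_eq_finite_exp[OF assms(2) 0] distrib_left)
  ultimately show ?thesis by simp
qed

lemma finite_exp_zero:
  fixes V :: "'a::field set"
  assumes "finite V" "b \<in> V"
  shows "finite_exp V b = 0"
proof (cases "b = 0")
  case False
  hence "(\<Prod>a\<in>V - {0}. 1 - b / a) = 0" using assms by (intro prod_zero) (auto intro!: bexI[of _ b])
  thus ?thesis by (simp add: finite_exp_def)
qed (simp add: finite_exp_def)

lemma finite_exp_translate:
  fixes V :: "'a::field set"
  assumes "add_subgroup V" "finite V" "b \<in> V"
  shows "finite_exp V (z - b) = finite_exp V z"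
  using finite_exp_add[OF assms(1,2), of "z - b" b] finite_exp_zero[OF assms(2,3)] by simp

text \<open>The product over a coset is the exponential at c - z divided by that at c, and
  additivity makes this a single linear factor in the exponential at z.\<close>

lemma prod_coset_eq_finite_exp:
  fixes V :: "'a::field set"
  assumes V: "add_subgroup V" "finite V" and c: "c \<notin> V"
  shows "(\<Prod>b\<in>V. 1 - z / (c + b)) = 1 - finite_exp V z / finite_exp V c"
proof -
  let ?P = "\<lambda>x. \<Prod>b\<in>V. x - b"
  have V0: "0 \<in> V" using V by (simp add: add_subgroup_def)
  have neg: "(\<Prod>b\<in>V. x + b) = ?P x" for x
  proof -
    have "uminus ` V = V" using add_subgroup_uminus[OF V(1)] by (force simp: image_iff)
    hence "?P x = (\<Prod>b\<in>uminus ` V. x - b)" by simp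
    also have "\<dots> = (\<Prod>b\<in>V. x + b)" by (subst prod.reindex) (auto simp: inj_on_def)
    finally show ?thesis by simp
  qed
  have cb: "c + b \<noteq> 0" if "b \<in> V" for b
    using that c add_subgroup_uminus[OF V(1) that] by (metis add_eq_0_iff2)
  have Pc: "?P c \<noteq> 0" using V(2) c by (auto simp: prod_zero_iff)
  have "(\<Prod>b\<in>V. 1 - z / (c + b)) = (\<Prod>b\<in>V. (c - z + b) / (c + b))"
    using cb by (intro prod.cong) (auto simp: field_simps)
  also have "\<dots> = ?P (c - z) / ?P c" by (simp add: prod_dividef neg)
  also have "?P (c - z) = ?P c - ?P z"
    using prod_minus_roots_additive[OF V, of "c - z" z] by simp
  also have "(?P c - ?P z) / ?P c = 1 - ?P z / ?P c" using Pc by (simp add: diff_divide_distrib)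
  also have "?P z / ?P c = finite_exp V z / finite_exp V c"
    using V(2) by (simp add: prod_minus_roots_eq_finite_exp[OF V(2) V0])
  finally show ?thesis .
qed

text \<open>Sort the roots by cosets of \<open>V'\<close>: the trivial coset contributes the
  exponential of \<open>V'\<close> itself, every other representative in \<open>S\<close> one linear
  factor in it.\<close>

lemma finite_exp_overgroup:
  fixes V V' :: "'a::field set"
  assumes V': "add_subgroup V'" "finite V'" and S: "finite S" "0 \<in> S"
    and bij: "bij_betw (\<lambda>(c, b). c + b) (S \<times> V') V"
  shows "finite_exp V z = finite_exp V' z * (\<Prod>c\<in>S - {0}. 1 - finite_exp V' z / finite_exp V' c)"
proof -
  let ?h = "\<lambda>(c, b). c + b :: 'a"
  have inj: "inj_on ?h (S \<times> V')" and img: "?h ` (S \<times> V') = V" using bij by (auto simp: bij_betw_def)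
  have V'0: "0 \<in> V'" using V' by (simp add: add_subgroup_def)
  have notin: "c \<notin> V'" if "c \<in> S - {0}" for c
  proof
    assume "c \<in> V'"
    hence "(c, 0) = (0, c)" using that S V'0 by (intro inj_onD[OF inj]) auto
    thus False using that by simp
  qed
  have "V - {0} = ?h ` (S \<times> V' - {(0, 0)})"
    using inj_on_image_set_diff[OF inj, of "S \<times> V'" "{(0, 0)}"] S V'0 img by auto
  hence "(\<Prod>b\<in>V - {0}. 1 - z / b) = (\<Prod>x\<in>S \<times> V' - {(0, 0)}. 1 - z / ?h x)"
    by (simp only:) (subst prod.reindex, auto intro: inj_on_subset[OF inj])
  also have "S \<times> V' - {(0, 0)} = {0} \<times> (V' - {0}) \<union> (S - {0}) \<times> V'" using S V'0 by auto
  also have "(\<Prod>x\<in>{0} \<times> (V' - {0}) \<union> (S - {0}) \<times> V'. 1 - z / ?h x)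
      = (\<Prod>x\<in>{0} \<times> (V' - {0}). 1 - z / ?h x) * (\<Prod>x\<in>(S - {0}) \<times> V'. 1 - z / ?h x)"
    using S V' by (intro prod.union_disjoint) auto
  also have "(\<Prod>x\<in>{0} \<times> (V' - {0}). 1 - z / ?h x) = (\<Prod>b\<in>V' - {0}. 1 - z / b)"
    using prod.cartesian_product[of "\<lambda>c b. 1 - z / (c + b)" "V' - {0}" "{0}"] by (simp add: case_prod_unfold)
  also have "(\<Prod>x\<in>(S - {0}) \<times> V'. 1 - z / ?h x) = (\<Prod>c\<in>S - {0}. \<Prod>b\<in>V'. 1 - z / (c + b))"
    using prod.cartesian_product[of "\<lambda>c b. 1 - z / (c + b)" V' "S - {0}"] by (simp add: case_prod_unfold)
  also have "\<dots> = (\<Prod>c\<in>S - {0}. 1 - finite_exp V' z / finite_exp V' c)"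
    using notin by (intro prod.cong refl prod_coset_eq_finite_exp[OF V']) auto
  finally show ?thesis by (simp add: finite_exp_def mult.assoc)
qed

section \<open>From finite groups to discrete lattices\<close>

context completed_alg_closure
begin

lemma av_limit_inverse:
  assumes lim: "(\<lambda>i. av (y i - a)) \<longlonglongrightarrow> 0" and a: "a \<noteq> 0"
  shows "(\<lambda>i. av (inverse (y i) - inverse a)) \<longlonglongrightarrow> 0"
proof -
  have "(\<lambda>i. av (y i - a) / (av (y i) * av a)) \<longlonglongrightarrow> 0 / (av a * av a)"
    using av_pos[OF a] by (intro tendsto_divide lim tendsto_mult_right av_limit_norm) auto
  moreover have "\<forall>\<^sub>F i in sequentially. av (y i - a) / (av (y i) * av a) = av (inverse (y i) - inverse a)"
    using order_tendstoD(1)[OF av_limit_norm[OF lim] av_pos[OF a]]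
  proof eventually_elim
    case (elim i)
    hence "y i \<noteq> 0" by auto
    hence "inverse (y i) - inverse a = (a - y i) / (y i * a)"
      using a by (simp add: field_simps)
    thus ?case by (simp add: av_divide av_mult av_diff_commute)
  qed
  ultimately show ?thesis by (simp add: tendsto_cong)
qed

lemma av_limit_prod:
  assumes "\<And>c. c \<in> S \<Longrightarrow> (\<lambda>i. av (y c i - a c)) \<longlonglongrightarrow> 0"
  shows "(\<lambda>i. av ((\<Prod>c\<in>S. y c i) - (\<Prod>c\<in>S. a c))) \<longlonglongrightarrow> 0"
  using assms
  by (induction S rule: infinite_finite_induct) (auto intro: av_limit_mult)

definition discrete_subgroup :: "'k fls set \<Rightarrow> bool" where
  "discrete_subgroup L \<longleftrightarrow> add_subgroup L \<and> (\<forall>r. finite {b \<in> L. abs_infinity b \<le> r})"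

definition lattice_ball :: "'k fls set \<Rightarrow> real \<Rightarrow> 'c set" where
  "lattice_ball L r = iota ` {b \<in> L. abs_infinity b \<le> r}"

text \<open>Balls are subgroups for an ultrametric absolute value, so the partial products of the
  exponential belong to finite groups and inherit their identities.\<close>

lemma lattice_ball_subgroup:
  assumes L: "discrete_subgroup L" and r: "r \<ge> 0"
  shows "add_subgroup (lattice_ball L r)" "finite (lattice_ball L r)"
proof -
  show "finite (lattice_ball L r)" using L by (auto simp: lattice_ball_def discrete_subgroup_def)
  show "add_subgroup (lattice_ball L r)"
    unfolding add_subgroup_def
  proof (intro conjI ballI)
    have "0 \<in> {b \<in> L. abs_infinity b \<le> r}"
      using L r by (simp add: discrete_subgroup_def add_subgroup_def abs_infinity_def)
    thus "0 \<in> lattice_ball L r" unfolding lattice_ball_def by (metis imageI iota_0)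
    fix x y assume "x \<in> lattice_ball L r" "y \<in> lattice_ball L r"
    then obtain b b' where b: "x = iota b" "b \<in> L" "av (iota b) \<le> r" "y = iota b'" "b' \<in> L" "av (iota b') \<le> r"
      by (auto simp: lattice_ball_def av_iota)
    have "abs_infinity (b - b') \<le> r"
      using av_diff_le[of "iota b" "iota b'"] b by (simp add: av_iota flip: iota_diff)
    moreover have "b - b' \<in> L" using L b by (simp add: discrete_subgroup_def add_subgroup_def)
    ultimately show "x - y \<in> lattice_ball L r" using b by (auto simp: lattice_ball_def simp flip: iota_diff)
  qed
qed

lemma av_prod_one_minus_le:
  assumes "\<And>b. b \<in> S \<Longrightarrow> av (x b) \<le> d" "0 \<le> d" "d \<le> 1"
  shows "av ((\<Prod>b\<in>S. 1 - x b) - 1) \<le> d"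
  using assms(1)
proof (induction S rule: infinite_finite_induct)
  case (insert b S)
  let ?p = "\<Prod>b\<in>S. 1 - x b"
  have IH: "av (?p - 1) \<le> d" and b: "av (x b) \<le> d" using insert by auto
  have "av ?p \<le> 1" using av_ultrametric[of "?p - 1" 1] IH assms(3) by simp
  hence "av (x b * ?p) \<le> d * 1" unfolding av_mult using b assms av_nonneg by (intro mult_mono) auto
  moreover have "(1 - x b) * ?p - 1 = (?p - 1) - x b * ?p" by (simp add: algebra_simps)
  ultimately have "av ((1 - x b) * ?p - 1) \<le> d" using IH av_diff_le[of "?p - 1" "x b * ?p"] by (simp only: max_def split: if_splits)
  thus ?case using insert by simp
qed (use assms in auto)

text \<open>The new factors involve points larger than \<open>r\<close>, so each is within |z|/r of
  1. In particular the absolute value of the product is constant from r > |z| on.\<close>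

lemma finite_exp_lattice_ball_step:
  assumes L: "discrete_subgroup L" and r: "r \<le> r'" "0 < r" "av z < r"
  shows "av (finite_exp (lattice_ball L r') z) = av (finite_exp (lattice_ball L r) z)"
    "av (finite_exp (lattice_ball L r') z - finite_exp (lattice_ball L r) z)
      \<le> av (finite_exp (lattice_ball L r) z) * (av z / r)"
proof -
  let ?V = "lattice_ball L r" and ?V' = "lattice_ball L r'"
  define T where "T = (\<Prod>b\<in>?V' - ?V. 1 - z / b)"
  have sub: "?V \<subseteq> ?V'" using r by (auto simp: lattice_ball_def)
  have fin: "finite ?V'" "finite ?V" using lattice_ball_subgroup(2)[OF L] r by auto
  have "0 \<in> ?V" using lattice_ball_subgroup(1)[OF L, of r] r by (simp add: add_subgroup_def)
  hence "?V' - {0} = (?V - {0}) \<union> (?V' - ?V)" using sub by blast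
  hence "(\<Prod>b\<in>?V' - {0}. 1 - z / b) = (\<Prod>b\<in>?V - {0}. 1 - z / b) * T"
    unfolding T_def using fin by (simp only:) (intro prod.union_disjoint, auto)
  hence eq: "finite_exp ?V' z = finite_exp ?V z * T" by (simp add: finite_exp_def mult.assoc)
  have "av (z / b) \<le> av z / r" if "b \<in> ?V' - ?V" for b
  proof -
    have "av b > r" using that by (auto simp: lattice_ball_def av_iota)
    thus ?thesis unfolding av_divide using r av_nonneg by (intro divide_left_mono mult_pos_pos) auto
  qed
  hence T: "av (T - 1) \<le> av z / r"
    unfolding T_def using r av_nonneg by (intro av_prod_one_minus_le) auto
  moreover have "av z / r < 1" using r by simp
  ultimately have "av T = 1" using av_add_eq[of "T - 1" 1] by simp
  thus "av (finite_exp ?V' z) = av (finite_exp ?V z)" by (simp add: eq av_mult)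
  have "finite_exp ?V' z - finite_exp ?V z = finite_exp ?V z * (T - 1)" by (simp add: eq algebra_simps)
  thus "av (finite_exp ?V' z - finite_exp ?V z) \<le> av (finite_exp ?V z) * (av z / r)"
    using mult_left_mono[OF T av_nonneg] by (simp only: av_mult)
qed

text \<open>Justifies the definite description in \<open>lattice_exp\<close>: consecutive
  differences of the products tend to 0, hence there is a limit, and limits are unique.\<close>

lemma lattice_exp_limit:
  assumes L: "discrete_subgroup L"
  shows "(\<lambda>r. av (finite_exp (lattice_ball L (real r)) z - lattice_exp L z)) \<longlonglongrightarrow> 0"
proof -
  let ?E = "\<lambda>r::nat. finite_exp (lattice_ball L (real r)) z"
  obtain R :: nat where R: "av z < real R" using reals_Archimedean2 by blast
  have R0: "real R > 0" using R av_nonneg[of z] by linarith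
  have E: "?E r = z * (\<Prod>b\<in>{b\<in>L. b \<noteq> 0 \<and> abs_infinity b \<le> real r}. 1 - z / iota b)" for r
  proof -
    have "lattice_ball L (real r) - {0} = iota ` {b\<in>L. b \<noteq> 0 \<and> abs_infinity b \<le> real r}"
      by (auto simp: lattice_ball_def)
    thus ?thesis unfolding finite_exp_def by (simp add: prod.reindex inj_on_def)
  qed
  have "(\<lambda>r. av (?E (Suc r) - ?E r)) \<longlonglongrightarrow> 0"
  proof (rule Lim_null_comparison)
    show "(\<lambda>r. av (?E R) * av z / real r) \<longlonglongrightarrow> 0" by (rule lim_const_over_n)
    have "av (?E (Suc r) - ?E r) \<le> av (?E R) * av z / real r" if "r \<ge> R" for r
    proof -
      have "av (?E r) = av (?E R)"
        using R R0 that by (intro finite_exp_lattice_ball_step(1)[OF L]) auto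
      moreover have "av (?E (Suc r) - ?E r) \<le> av (?E r) * (av z / real r)"
        using R R0 that by (intro finite_exp_lattice_ball_step(2)[OF L]) auto
      ultimately show ?thesis by simp
    qed
    thus "\<forall>\<^sub>F r in sequentially. norm (av (?E (Suc r) - ?E r)) \<le> av (?E R) * av z / real r"
      unfolding eventually_sequentially using av_nonneg by (intro exI[of _ R]) auto
  qed
  from av_ultrametric_Cauchy[OF this] obtain l where l: "(\<lambda>r. av (?E r - l)) \<longlonglongrightarrow> 0" by blast
  have "lattice_exp L z = l"
    unfolding lattice_exp_def E[symmetric] by (rule the_equality, rule l, rule av_limit_unique[OF _ l])
  thus ?thesis using l by simp
qed

text \<open>Nonvanishing survives the limit because the absolute values of the partial products are
  eventually constant.\<close>

lemma lattice_exp_nonzero: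
  assumes L: "discrete_subgroup L" and z: "z \<notin> iota ` L" "z \<noteq> 0"
  shows "lattice_exp L z \<noteq> 0"
proof -
  let ?E = "\<lambda>r::nat. finite_exp (lattice_ball L (real r)) z"
  obtain R :: nat where R: "av z < real R" using reals_Archimedean2 by blast
  have R0: "real R > 0" using R av_nonneg[of z] by linarith
  have "?E R \<noteq> 0"
  proof -
    have "1 - z / b \<noteq> 0" if "b \<in> lattice_ball L (real R) - {0}" for b
      using that z by (auto simp: lattice_ball_def field_simps)
    thus ?thesis using z lattice_ball_subgroup(2)[OF L] by (auto simp: finite_exp_def prod_zero_iff)
  qed
  have "(\<lambda>r. av (?E r)) \<longlonglongrightarrow> av (?E R)"
  proof (rule tendsto_eventually)
    have "av (?E r) = av (?E R)" if "r \<ge> R" for r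
      using R R0 that by (intro finite_exp_lattice_ball_step(1)[OF L]) auto
    thus "\<forall>\<^sub>F r in sequentially. av (?E r) = av (?E R)"
      unfolding eventually_sequentially by blast
  qed
  from LIMSEQ_unique[OF av_limit_norm[OF lattice_exp_limit[OF L]] this]
  have "av (lattice_exp L z) = av (?E R)" .
  thus ?thesis using av_pos[OF \<open>?E R \<noteq> 0\<close>] by auto
qed

text \<open>
  Translating \<open>z\<close> by the nearest lattice point does not change the exponential, and makes every
  factor of the product at least 1 in absolute value.
\<close>

lemma av_lattice_exp_ge:
  assumes L: "discrete_subgroup L" and R: "\<And>s. R \<le> av (z - iota s)"
  shows "R \<le> av (lattice_exp L z)"
proof (rule tendsto_lowerbound[OF av_limit_norm[OF lattice_exp_limit[OF L]]])
  have "R \<le> av (finite_exp (lattice_ball L (real r)) z)" for r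
  proof -
    let ?V = "lattice_ball L (real r)"
    have V: "add_subgroup ?V" "finite ?V" using lattice_ball_subgroup[OF L, of "real r"] by auto
    have "?V \<noteq> {}" using V(1) by (auto simp: add_subgroup_def)
    from arg_min_if_finite[OF V(2) this, of "\<lambda>b. av (z - b)"]
    obtain b0 where b0: "b0 \<in> ?V" "\<And>b. b \<in> ?V \<Longrightarrow> av (z - b0) \<le> av (z - b)" by (metis not_less)
    define w where "w = z - b0"
    \<comment> \<open>Minimality of \<open>b0\<close> is tested against \<open>b0 + b\<close>, a
      member of the ball because the ball is a group.\<close>
    have "av (1 - w / b) \<ge> 1" if b: "b \<in> ?V - {0}" for b
    proof -
      have "av w \<le> av (w - b)"
        using b0(2)[of "b0 + b"] b b0(1) V(1) by (simp add: w_def add_subgroup_add algebra_simps)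
      hence "av b \<le> av (w - b)" using av_diff_le[of w "w - b"] by simp
      moreover have "av (1 - w / b) = av (w - b) / av b"
      proof -
        have "1 - w / b = - (w - b) / b" using b by (simp add: diff_divide_distrib)
        thus ?thesis by (simp only: av_divide av_minus)
      qed
      moreover have "av b > 0" using b by (simp add: av_pos)
      ultimately show ?thesis by simp
    qed
    hence "1 \<le> (\<Prod>b\<in>?V - {0}. av (1 - w / b))" by (intro prod_ge_1) auto
    hence "av w * 1 \<le> av (finite_exp ?V w)"
      unfolding finite_exp_def av_mult av_prod using av_nonneg by (intro mult_left_mono) auto
    moreover have "finite_exp ?V w = finite_exp ?V z"
      unfolding w_def using finite_exp_translate[OF V b0(1)] .
    moreover have "R \<le> av w" using b0(1) R by (auto simp: w_def lattice_ball_def)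
    ultimately show ?thesis by simp
  qed
  thus "\<forall>\<^sub>F r in sequentially. R \<le> av (finite_exp (lattice_ball L (real r)) z)" by simp
qed simp

lemma lattice_exp_overlattice:
  assumes L: "discrete_subgroup L" and L': "discrete_subgroup L'" and S: "finite S" "0 \<in> S"
    and bij: "bij_betw (\<lambda>(c, b). c + b) (S \<times> L') L"
  shows "lattice_exp L z
    = lattice_exp L' z * (\<Prod>c\<in>S - {0}. 1 - lattice_exp L' z / lattice_exp L' (iota c))"
proof -
  let ?E = "\<lambda>r::nat. finite_exp (lattice_ball L (real r))"
  let ?E' = "\<lambda>r::nat. finite_exp (lattice_ball L' (real r))"
  have L'0: "0 \<in> L'" using L' by (simp add: discrete_subgroup_def add_subgroup_def)
  have inj: "inj_on (\<lambda>(c, b). c + b) (S \<times> L')" and img: "(\<lambda>(c, b). c + b) ` (S \<times> L') = L"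
    using bij by (auto simp: bij_betw_def)
  \<comment> \<open>For radii beyond every representative in \<open>S\<close>, adding a
    representative does not change membership in the ball, so the coset decomposition of
    \<open>L\<close> restricts to balls.\<close>
  obtain R :: nat where R: "Max (abs_infinity ` S) < real R" using reals_Archimedean2 by blast
  have step: "?E r z = ?E' r z * (\<Prod>c\<in>S - {0}. 1 - ?E' r z / ?E' r (iota c))" if r: "r \<ge> R" for r
  proof -
    have Sr: "abs_infinity c \<le> real r" if "c \<in> S" for c
    proof -
      have "abs_infinity c \<le> Max (abs_infinity ` S)" using that S by (intro Max_ge) auto
      thus ?thesis using R r by simp
    qed
    have ball: "abs_infinity (c + b) \<le> real r \<longleftrightarrow> abs_infinity b \<le> real r" if "c \<in> S" for c b
      using Sr[OF that] av_ultrametric[of "iota c" "iota b"] av_diff_le[of "iota (c + b)" "iota c"]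
      by (auto simp: av_iota simp flip: iota_add iota_diff)
    have "bij_betw (\<lambda>(c, b). c + b) (iota ` S \<times> lattice_ball L' (real r)) (lattice_ball L (real r))"
      unfolding bij_betw_def
    proof
      show "inj_on (\<lambda>(c, b). c + b) (iota ` S \<times> lattice_ball L' (real r))"
      proof (rule inj_onI)
        fix x y assume x: "x \<in> iota ` S \<times> lattice_ball L' (real r)"
          and y: "y \<in> iota ` S \<times> lattice_ball L' (real r)" and eq: "(case x of (c, b) \<Rightarrow> c + b) = (case y of (c, b) \<Rightarrow> c + b)"
        obtain c b where cb: "x = (iota c, iota b)" "c \<in> S" "b \<in> L'" using x by (auto simp: lattice_ball_def)
        obtain c' b' where cb': "y = (iota c', iota b')" "c' \<in> S" "b' \<in> L'" using y by (auto simp: lattice_ball_def)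
        have "iota (c + b) = iota (c' + b')" using eq cb cb' by (simp add: iota_add)
        hence "(c, b) = (c', b')" using cb cb' by (intro inj_onD[OF inj]) auto
        thus "x = y" using cb cb' by simp
      qed
      show "(\<lambda>(c, b). c + b) ` (iota ` S \<times> lattice_ball L' (real r)) = lattice_ball L (real r)"
      proof (intro equalityI subsetI)
        fix x assume "x \<in> (\<lambda>(c, b). c + b) ` (iota ` S \<times> lattice_ball L' (real r))"
        then obtain c b where cb: "x = iota (c + b)" "c \<in> S" "b \<in> L'" "abs_infinity b \<le> real r"
          by (auto simp: lattice_ball_def iota_add)
        moreover have "c + b \<in> L" using img cb by force
        ultimately show "x \<in> lattice_ball L (real r)" using ball[OF cb(2)] by (auto simp: lattice_ball_def)
      next
        fix x assume "x \<in> lattice_ball L (real r)"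
        then obtain l where l: "x = iota l" "l \<in> L" "abs_infinity l \<le> real r" by (auto simp: lattice_ball_def)
        then obtain c b where cb: "l = c + b" "c \<in> S" "b \<in> L'" using img by force
        hence "b \<in> {b \<in> L'. abs_infinity b \<le> real r}" using l ball[OF cb(2), of b] by simp
        hence "(iota c, iota b) \<in> iota ` S \<times> lattice_ball L' (real r)"
          using cb unfolding lattice_ball_def by blast
        moreover have "x = (\<lambda>(c, b). c + b) (iota c, iota b)" using l cb by (simp add: iota_add)
        ultimately show "x \<in> (\<lambda>(c, b). c + b) ` (iota ` S \<times> lattice_ball L' (real r))" by blast
      qed
    qed
    from finite_exp_overgroup[OF lattice_ball_subgroup[OF L' of_nat_0_le_iff] _ _ this, of z]
    have "?E r z = ?E' r z * (\<Prod>c\<in>iota ` S - {0}. 1 - ?E' r z / ?E' r c)"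
      using S by (auto intro!: image_eqI[of 0 iota 0])
    also have "iota ` S - {0} = iota ` (S - {0})" by auto
    also have "(\<Prod>c\<in>iota ` (S - {0}). 1 - ?E' r z / ?E' r c) = (\<Prod>c\<in>S - {0}. 1 - ?E' r z / ?E' r (iota c))"
      by (subst prod.reindex) (auto simp: inj_on_def)
    finally show ?thesis .
  qed
  have nz: "lattice_exp L' (iota c) \<noteq> 0" if "c \<in> S - {0}" for c
  proof (rule lattice_exp_nonzero[OF L'])
    show "iota c \<notin> iota ` L'"
    proof
      assume "iota c \<in> iota ` L'"
      hence "c \<in> L'" by auto
      hence "(c, 0) = (0, c)" using that S L'0 by (intro inj_onD[OF inj]) auto
      thus False using that by simp
    qed
  qed (use that in auto)
  note lim = lattice_exp_limit[OF L']
  have "(\<lambda>r. av (?E' r z * (\<Prod>c\<in>S - {0}. 1 - ?E' r z / ?E' r (iota c))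
      - lattice_exp L' z * (\<Prod>c\<in>S - {0}. 1 - lattice_exp L' z / lattice_exp L' (iota c)))) \<longlonglongrightarrow> 0"
  proof (intro av_limit_mult av_limit_prod lim)
    fix c assume c: "c \<in> S - {0}"
    have "(\<lambda>r. av (?E' r z * inverse (?E' r (iota c)) - lattice_exp L' z * inverse (lattice_exp L' (iota c)))) \<longlonglongrightarrow> 0"
      using nz[OF c] by (intro av_limit_mult av_limit_inverse lim)
    thus "(\<lambda>r. av (1 - ?E' r z / ?E' r (iota c) - (1 - lattice_exp L' z / lattice_exp L' (iota c)))) \<longlonglongrightarrow> 0"
      by (simp add: field_class.field_divide_inverse av_diff_commute)
  qed
  moreover have "(\<lambda>r. av (?E' r z * (\<Prod>c\<in>S - {0}. 1 - ?E' r z / ?E' r (iota c)) - lattice_exp L z)) \<longlonglongrightarrow> 0"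
  proof (rule Lim_transform_eventually[OF lattice_exp_limit[OF L, of z]])
    show "\<forall>\<^sub>F r in sequentially. av (?E r z - lattice_exp L z)
      = av (?E' r z * (\<Prod>c\<in>S - {0}. 1 - ?E' r z / ?E' r (iota c)) - lattice_exp L z)"
      unfolding eventually_sequentially using step by (intro exI[of _ R]) simp
  qed
  ultimately show ?thesis by (rule av_limit_unique[symmetric])
qed


subsection \<open>Change of parameter at a cusp\<close>

lemma av_null_comparison:
  assumes "\<And>j. av (y j) \<le> b j" "b \<longlonglongrightarrow> 0"
  shows "(\<lambda>j. av (y j)) \<longlonglongrightarrow> 0"
proof (rule Lim_null_comparison[OF _ assms(2)])
  show "\<forall>\<^sub>F j in sequentially. norm (av (y j)) \<le> b j"
    using assms(1) by (simp add: av_nonneg)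
qed

text \<open>Formal coefficients and convergence at a point are kept apart, so that products and
  compositions of expansions can be formed algebraically and summed afterwards.\<close>

definition fps_sums_to :: "'c fps \<Rightarrow> 'c \<Rightarrow> 'c \<Rightarrow> bool" where
  "fps_sums_to F x s \<longleftrightarrow> (\<lambda>j. av ((\<Sum>i<j. fps_nth F i * x ^ i) - s)) \<longlonglongrightarrow> 0"

text \<open>With no constant in front of M^k, the ultrametric inequality makes the bound stable
  under products and powers with the same \<open>M\<close>.\<close>

definition fps_bounded_by :: "'c fps \<Rightarrow> real \<Rightarrow> bool" where
  "fps_bounded_by F M \<longleftrightarrow> (\<forall>k. av (fps_nth F k) \<le> M ^ k)"

lemma fps_bounded_by_mult:
  assumes "fps_bounded_by F M" "fps_bounded_by G M" "M \<ge> 0"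
  shows "fps_bounded_by (F * G) M"
  unfolding fps_bounded_by_def
proof
  fix k
  show "av (fps_nth (F * G) k) \<le> M ^ k"
    unfolding fps_mult_nth
  proof (rule av_sum_le)
    fix i assume i: "i \<in> {0..k}"
    have "av (fps_nth F i * fps_nth G (k - i)) \<le> M ^ i * M ^ (k - i)"
      unfolding av_mult using assms av_nonneg by (intro mult_mono) (auto simp: fps_bounded_by_def)
    also have "\<dots> = M ^ k" using i by (simp flip: power_add)
    finally show "av (fps_nth F i * fps_nth G (k - i)) \<le> M ^ k" .
  qed (use assms in simp)
qed

lemma fps_bounded_by_1: "M \<ge> 0 \<Longrightarrow> fps_bounded_by 1 M"
  by (auto simp: fps_bounded_by_def)

lemma fps_bounded_by_power:
  "fps_bounded_by F M \<Longrightarrow> M \<ge> 0 \<Longrightarrow> fps_bounded_by (F ^ n) M"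
  by (induction n) (auto intro: fps_bounded_by_mult fps_bounded_by_1)

lemma fps_sums_to_1: "fps_sums_to 1 x 1"
  unfolding fps_sums_to_def
proof (rule tendsto_eventually)
  have "av ((\<Sum>i<j. fps_nth 1 i * x ^ i) - 1) = 0" if "j \<ge> 1" for j
  proof -
    have "(\<Sum>i<j. fps_nth 1 i * x ^ i) = (\<Sum>i<j. if i = 0 then 1 else 0)"
      by (intro sum.cong) auto
    also have "\<dots> = 1" using that by (simp add: sum.delta)
    finally show ?thesis by simp
  qed
  thus "\<forall>\<^sub>F j in sequentially. av ((\<Sum>i<j. fps_nth 1 i * x ^ i) - 1) = 0"
    unfolding eventually_sequentially by blast
qed

text \<open>The product of the partial sums differs from the partial sum of the product only by
  terms with i + k >= j, each of size at most (M |x|)^j.\<close>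

lemma fps_sums_to_mult:
  assumes F: "fps_bounded_by F M" "fps_sums_to F x s" and G: "fps_bounded_by G M" "fps_sums_to G x t"
    and M: "M \<ge> 0" "M * av x < 1"
  shows "fps_sums_to (F * G) x (s * t)"
proof -
  let ?F = "\<lambda>j. \<Sum>i<j. fps_nth F i * x ^ i" and ?G = "\<lambda>j. \<Sum>i<j. fps_nth G i * x ^ i"
  let ?FG = "\<lambda>j. \<Sum>i<j. fps_nth (F * G) i * x ^ i"
  let ?h = "\<lambda>i k. fps_nth F i * x ^ i * (fps_nth G k * x ^ k)"
  define \<theta> where "\<theta> = M * av x"
  have \<theta>: "\<theta> \<ge> 0" "\<theta> < 1" using M av_nonneg by (simp_all add: \<theta>_def)
  have "av (?F j * ?G j - ?FG j) \<le> \<theta> ^ j" for j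
  proof -
    have prod: "?F j * ?G j = (\<Sum>(i, k)\<in>{..<j} \<times> {..<j}. ?h i k)"
      by (simp add: sum_product sum.cartesian_product)
    have "?FG j = (\<Sum>n<j. \<Sum>i\<le>n. ?h i (n - i))"
    proof (intro sum.cong refl)
      fix n
      have "fps_nth (F * G) n * x ^ n = (\<Sum>i\<le>n. fps_nth F i * fps_nth G (n - i) * x ^ n)"
        by (simp add: fps_mult_nth sum_distrib_right atLeast0AtMost)
      also have "\<dots> = (\<Sum>i\<le>n. ?h i (n - i))"
      proof (intro sum.cong refl)
        fix i assume "i \<in> {..n}"
        hence "x ^ n = x ^ i * x ^ (n - i)" by (simp flip: power_add)
        thus "fps_nth F i * fps_nth G (n - i) * x ^ n = ?h i (n - i)" by (simp add: mult_ac)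
      qed
      finally show "fps_nth (F * G) n * x ^ n = (\<Sum>i\<le>n. ?h i (n - i))" .
    qed
    also have "\<dots> = (\<Sum>(i, k)\<in>{(i, k). i + k < j}. ?h i k)"
      by (rule sum.triangle_reindex[symmetric])
    finally have FG: "?FG j = (\<Sum>(i, k)\<in>{(i, k). i + k < j}. ?h i k)" .
    have sub: "{(i, k). i + k < j} \<subseteq> {..<j} \<times> {..<j}" by auto
    have "?F j * ?G j - ?FG j = (\<Sum>(i, k)\<in>{..<j} \<times> {..<j} - {(i, k). i + k < j}. ?h i k)"
      unfolding prod FG by (subst sum_diff[OF _ sub]) auto
    also have "av \<dots> \<le> \<theta> ^ j"
    proof (rule av_sum_le)
      fix p assume p: "p \<in> {..<j} \<times> {..<j} - {(i, k). i + k < j}"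
      obtain i k where ik: "p = (i, k)" by fastforce
      have "i + k \<ge> j" using p ik by auto
      have "av (?h i k) \<le> (M ^ i * av x ^ i) * (M ^ k * av x ^ k)"
        unfolding av_mult av_power using F(1) G(1) M(1) av_nonneg
        by (intro mult_mono) (auto simp: fps_bounded_by_def)
      also have "\<dots> = \<theta> ^ (i + k)" by (simp add: \<theta>_def power_add power_mult_distrib)
      also have "\<dots> \<le> \<theta> ^ j" using \<theta> \<open>i + k \<ge> j\<close> by (intro power_decreasing) auto
      finally show "av (case p of (i, k) \<Rightarrow> ?h i k) \<le> \<theta> ^ j" by (simp add: ik)
    qed (use \<theta> in simp)
    finally show ?thesis .
  qed
  hence "(\<lambda>j. av (?F j * ?G j - ?FG j)) \<longlonglongrightarrow> 0"
    by (rule av_null_comparison) (use \<theta> in \<open>simp add: LIMSEQ_realpow_zero\<close>)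
  hence "(\<lambda>j. av (?FG j - ?F j * ?G j - 0)) \<longlonglongrightarrow> 0" by (simp add: av_diff_commute)
  moreover have "(\<lambda>j. av (?F j * ?G j - s * t)) \<longlonglongrightarrow> 0"
    using F(2) G(2) unfolding fps_sums_to_def by (rule av_limit_mult)
  ultimately have "(\<lambda>j. av ((?FG j - ?F j * ?G j) + ?F j * ?G j - (0 + s * t))) \<longlonglongrightarrow> 0"
    by (rule av_limit_add)
  thus ?thesis by (simp add: fps_sums_to_def)
qed

lemma fps_sums_to_power:
  assumes "fps_bounded_by F M" "fps_sums_to F x s" "M \<ge> 0" "M * av x < 1"
  shows "fps_sums_to (F ^ n) x (s ^ n)"
proof (induction n)
  case (Suc n)
  thus ?case using assms by (simp add: fps_sums_to_mult fps_bounded_by_power)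
qed (simp add: fps_sums_to_1)

text \<open>In the ultrametric setting a tail is bounded by its largest term. The bound depends on
  \<open>M\<close> only, so it holds uniformly for all powers of a series in
  \<open>fps_sums_to_compose\<close>.\<close>

lemma fps_sums_to_remainder:
  assumes F: "fps_bounded_by F M" "fps_sums_to F x s" and M: "M \<ge> 0" "M * av x < 1"
  shows "av ((\<Sum>i<j. fps_nth F i * x ^ i) - s) \<le> (M * av x) ^ j"
proof -
  let ?F = "\<lambda>j. \<Sum>i<j. fps_nth F i * x ^ i"
  have \<theta>: "0 \<le> M * av x" using M av_nonneg by simp
  have "av (?F J - ?F j) \<le> (M * av x) ^ j" if "J \<ge> j" for J
  proof -
    have "?F J - ?F j = (\<Sum>i=j..<J. fps_nth F i * x ^ i)"
      using sum_diff_nat_ivl[of 0 j J "\<lambda>i. fps_nth F i * x ^ i"] that by (simp add: atLeast0LessThan)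
    also have "av \<dots> \<le> (M * av x) ^ j"
    proof (rule av_sum_le)
      fix i assume i: "i \<in> {j..<J}"
      have "av (fps_nth F i * x ^ i) \<le> M ^ i * av x ^ i"
        unfolding av_mult av_power using F(1) av_nonneg
        by (intro mult_right_mono) (auto simp: fps_bounded_by_def)
      also have "\<dots> = (M * av x) ^ i" by (simp add: power_mult_distrib)
      also have "\<dots> \<le> (M * av x) ^ j" using i \<theta> M by (intro power_decreasing) auto
      finally show "av (fps_nth F i * x ^ i) \<le> (M * av x) ^ j" .
    qed (use \<theta> in simp)
    finally show ?thesis .
  qed
  hence *: "av (?F j - s) \<le> max ((M * av x) ^ j) (av (?F J - s))" if "J \<ge> j" for J
    using that av_triangle[of "?F j" s "?F J"] by (force simp: av_diff_commute intro: order_trans)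
  have "(\<lambda>J. max ((M * av x) ^ j) (av (?F J - s))) \<longlonglongrightarrow> max ((M * av x) ^ j) 0"
    using F(2) unfolding fps_sums_to_def by (intro tendsto_max tendsto_const)
  hence "av (?F j - s) \<le> max ((M * av x) ^ j) 0"
  proof (rule tendsto_lowerbound)
    show "\<forall>\<^sub>F J in sequentially. av (?F j - s) \<le> max ((M * av x) ^ j) (av (?F J - s))"
      unfolding eventually_sequentially using * by blast
  qed simp
  thus ?thesis using \<theta> by simp
qed

lemma fps_power_nth_eq_0:
  fixes F :: "'c fps"
  assumes "fps_nth F 0 = 0"
  shows "k < i \<Longrightarrow> fps_nth (F ^ i) k = 0"
proof (induction i arbitrary: k)
  case (Suc i)
  show ?case unfolding power_Suc fps_mult_nth
  proof (intro sum.neutral ballI)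
    fix l assume l: "l \<in> {0..k}"
    show "fps_nth F l * fps_nth (F ^ i) (k - l) = 0"
      using Suc l assms by (cases "l = 0") auto
  qed
qed simp

text \<open>As \<open>G\<close> has no constant term, the first j coefficients of the composite use
  only powers G^i with i < j. Replacing s^i by a partial sum costs (M |x|)^j, weighted by at most B
  N^j; hence the condition on N (M |x|).\<close>

lemma fps_sums_to_compose:
  assumes G: "fps_nth G 0 = 0" "fps_bounded_by G M" "fps_sums_to G x s"
    and F: "\<And>i. av (fps_nth F i) \<le> B * N ^ i" "fps_sums_to F s t"
    and M: "M \<ge> 0" "N \<ge> 1" "B \<ge> 0" "N * (M * av x) < 1"
  shows "fps_sums_to (fps_compose F G) x t"
proof -
  let ?F = "\<lambda>j. \<Sum>i<j. fps_nth F i * s ^ i"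
  let ?C = "\<lambda>j. \<Sum>i<j. fps_nth (fps_compose F G) i * x ^ i"
  define \<theta> where "\<theta> = M * av x"
  have \<theta>0: "\<theta> \<ge> 0" using M av_nonneg by (simp add: \<theta>_def)
  have "\<theta> \<le> N * \<theta>" using M(2) \<theta>0 by (simp add: mult_le_cancel_right1)
  hence \<theta>1: "\<theta> < 1" using M(4) by (simp add: \<theta>_def)
  have "av (?C j - ?F j) \<le> B * (N * \<theta>) ^ j" for j
  proof -
    have "?C j = (\<Sum>k<j. \<Sum>i<j. fps_nth F i * fps_nth (G ^ i) k * x ^ k)"
    proof (intro sum.cong refl)
      fix k assume k: "k \<in> {..<j}"
      have "fps_nth (fps_compose F G) k = (\<Sum>i\<in>{0..k}. fps_nth F i * fps_nth (G ^ i) k)"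
        by (simp add: fps_compose_nth)
      also have "\<dots> = (\<Sum>i<j. fps_nth F i * fps_nth (G ^ i) k)"
        using k by (intro sum.mono_neutral_left) (auto intro!: fps_power_nth_eq_0[OF G(1)])
      finally show "fps_nth (fps_compose F G) k * x ^ k = (\<Sum>i<j. fps_nth F i * fps_nth (G ^ i) k * x ^ k)"
        by (simp add: sum_distrib_right)
    qed
    also have "\<dots> = (\<Sum>i<j. \<Sum>k<j. fps_nth F i * fps_nth (G ^ i) k * x ^ k)" by (rule sum.swap)
    also have "\<dots> = (\<Sum>i<j. fps_nth F i * (\<Sum>k<j. fps_nth (G ^ i) k * x ^ k))"
      by (simp add: sum_distrib_left mult.assoc)
    finally have "?C j - ?F j = (\<Sum>i<j. fps_nth F i * ((\<Sum>k<j. fps_nth (G ^ i) k * x ^ k) - s ^ i))"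
      by (simp add: sum_subtractf right_diff_distrib)
    also have "av \<dots> \<le> B * (N * \<theta>) ^ j"
    proof (rule av_sum_le)
      fix i assume i: "i \<in> {..<j}"
      have "av ((\<Sum>k<j. fps_nth (G ^ i) k * x ^ k) - s ^ i) \<le> \<theta> ^ j"
        unfolding \<theta>_def using G M \<theta>1
        by (intro fps_sums_to_remainder fps_bounded_by_power fps_sums_to_power[of G M]) (auto simp: \<theta>_def)
      hence "av (fps_nth F i * ((\<Sum>k<j. fps_nth (G ^ i) k * x ^ k) - s ^ i)) \<le> (B * N ^ j) * \<theta> ^ j"
        unfolding av_mult
      proof (intro mult_mono)
        have "B * N ^ i \<le> B * N ^ j" using i M by (intro mult_left_mono power_increasing) auto
        thus "av (fps_nth F i) \<le> B * N ^ j" using F(1)[of i] by linarith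
      qed (use M av_nonneg in auto)
      thus "av (fps_nth F i * ((\<Sum>k<j. fps_nth (G ^ i) k * x ^ k) - s ^ i)) \<le> B * (N * \<theta>) ^ j"
        by (simp add: power_mult_distrib mult.assoc)
    qed (use M \<theta>0 in simp)
    finally show ?thesis .
  qed
  moreover have "(\<lambda>j. B * (N * \<theta>) ^ j) \<longlonglongrightarrow> 0"
    using M \<theta>0 by (intro tendsto_mult_right_zero LIMSEQ_realpow_zero) (auto simp: \<theta>_def)
  ultimately have "(\<lambda>j. av (?C j - ?F j)) \<longlonglongrightarrow> 0" by (rule av_null_comparison)
  hence "(\<lambda>j. av (?C j - ?F j - 0)) \<longlonglongrightarrow> 0" by (simp only: diff_zero)
  from av_limit_add[OF this F(2)[unfolded fps_sums_to_def]]
  show ?thesis by (simp add: fps_sums_to_def)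
qed

text \<open>The expansion of 1 / (1 - 1/(x m)) = -m x / (1 - m x) in powers of x. With x = 1/e(z)
  and m = e(c) it is the reciprocal of a factor 1 - e(z)/e(c) of the product formula.\<close>

definition reciprocal_shift :: "'c \<Rightarrow> 'c fps" where
  "reciprocal_shift m = Abs_fps (\<lambda>k. if k = 0 then 0 else - (m ^ k))"

lemma reciprocal_shift_bounded:
  assumes "av m \<le> M"
  shows "fps_bounded_by (reciprocal_shift m) M"
  unfolding fps_bounded_by_def reciprocal_shift_def
  using assms av_nonneg by (auto simp: av_power intro: power_mono)

lemma reciprocal_shift_sums_to:
  assumes x: "x \<noteq> 0" and m: "m \<noteq> 0" and xm: "av (m * x) < 1"
  shows "fps_sums_to (reciprocal_shift m) x (1 / (1 - 1 / x / m))"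
proof -
  define y where "y = m * x"
  have "y \<noteq> 1" using xm by (auto simp: y_def)
  have "av y < 1" using xm by (simp add: y_def)
  have val: "1 / (1 - 1 / x / m) = 1 - 1 / (1 - y)"
  proof -
    have "1 - 1 / x / m = (y - 1) / y" using x m by (simp add: y_def field_simps)
    hence "1 / (1 - 1 / x / m) = y / (y - 1)" by simp
    also have "\<dots> = 1 - 1 / (1 - y)" using \<open>y \<noteq> 1\<close> by (simp add: field_simps)
    finally show ?thesis .
  qed
  \<comment> \<open>For j = 0 this fails: the constant 1 is cancelled by the term y^0, which an
    empty sum does not contain.\<close>
  have partial_sum: "av ((\<Sum>i<j. fps_nth (reciprocal_shift m) i * x ^ i) - (1 - 1 / (1 - y))) = av y ^ j / av (1 - y)"
    if "j \<ge> 1" for j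
  proof -
    have "(\<Sum>i<j. fps_nth (reciprocal_shift m) i * x ^ i) = (\<Sum>i<j. (if i = 0 then 1 else 0) - y ^ i)"
      by (intro sum.cong) (auto simp: reciprocal_shift_def y_def power_mult_distrib)
    also have "\<dots> = 1 - (\<Sum>i<j. y ^ i)"
      using that by (simp add: sum_subtractf sum.delta)
    also have "(\<Sum>i<j. y ^ i) = (1 - y ^ j) / (1 - y)"
      using \<open>y \<noteq> 1\<close> sum_gp_strict[of y j] by simp
    finally have "(\<Sum>i<j. fps_nth (reciprocal_shift m) i * x ^ i) - (1 - 1 / (1 - y)) = y ^ j / (1 - y)"
      by (simp add: diff_divide_distrib)
    thus ?thesis by (simp add: av_divide av_power)
  qed
  have lim: "(\<lambda>j. av y ^ j / av (1 - y)) \<longlonglongrightarrow> 0 / av (1 - y)"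
    using \<open>av y < 1\<close> \<open>y \<noteq> 1\<close> av_nonneg av_pos[of "1 - y"]
    by (intro tendsto_divide LIMSEQ_realpow_zero tendsto_const) auto
  show ?thesis unfolding fps_sums_to_def val
  proof (rule Lim_transform_eventually)
    show "(\<lambda>j. av y ^ j / av (1 - y)) \<longlonglongrightarrow> 0" using lim by simp
    show "\<forall>\<^sub>F j in sequentially. av y ^ j / av (1 - y)
        = av ((\<Sum>i<j. fps_nth (reciprocal_shift m) i * x ^ i) - (1 - 1 / (1 - y)))"
      by (rule eventually_sequentiallyI[of 1]) (rule partial_sum[symmetric])
  qed
qed

lemma fps_sums_to_X: "fps_sums_to fps_X x x"
  unfolding fps_sums_to_def
proof (rule tendsto_eventually)
  have "av ((\<Sum>i<j. fps_nth fps_X i * x ^ i) - x) = 0" if "j \<ge> 2" for j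
  proof -
    have "(\<Sum>i<j. fps_nth fps_X i * x ^ i) = (\<Sum>i<j. if i = 1 then x else 0)"
      by (intro sum.cong) (auto simp: fps_X_nth)
    also have "\<dots> = x" using that by (simp add: sum.delta)
    finally show ?thesis by simp
  qed
  thus "\<forall>\<^sub>F j in sequentially. av ((\<Sum>i<j. fps_nth fps_X i * x ^ i) - x) = 0"
    unfolding eventually_sequentially by blast
qed

lemma fps_bounded_by_X: "M \<ge> 1 \<Longrightarrow> fps_bounded_by fps_X M"
  by (auto simp: fps_bounded_by_def fps_X_nth)

lemma fps_prod_reciprocal_shift:
  assumes S: "finite S" and m: "\<And>c. c \<in> S \<Longrightarrow> m c \<noteq> 0" "\<And>c. c \<in> S \<Longrightarrow> av (m c) \<le> M" and M: "M \<ge> 1"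
  shows "fps_bounded_by (fps_X * (\<Prod>c\<in>S. reciprocal_shift (m c))) M"
    "x \<noteq> 0 \<Longrightarrow> M * av x < 1 \<Longrightarrow>
      fps_sums_to (fps_X * (\<Prod>c\<in>S. reciprocal_shift (m c))) x (x * (\<Prod>c\<in>S. 1 / (1 - 1 / x / m c)))"
proof -
  have bd: "fps_bounded_by (\<Prod>c\<in>S. reciprocal_shift (m c)) M"
    using S m(2) by (induction S) (auto intro!: fps_bounded_by_mult fps_bounded_by_1 reciprocal_shift_bounded simp: M order_trans[OF zero_le_one M])
  thus "fps_bounded_by (fps_X * (\<Prod>c\<in>S. reciprocal_shift (m c))) M"
    using M by (intro fps_bounded_by_mult fps_bounded_by_X) auto
  assume x: "x \<noteq> 0" "M * av x < 1"
  have "fps_bounded_by (\<Prod>c\<in>T. reciprocal_shift (m c)) M \<and>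
      fps_sums_to (\<Prod>c\<in>T. reciprocal_shift (m c)) x (\<Prod>c\<in>T. 1 / (1 - 1 / x / m c))" if "T \<subseteq> S" for T
    using finite_subset[OF that S] that
  proof (induction T)
    case empty
    thus ?case using M fps_sums_to_1 fps_bounded_by_1 by simp
  next
    case (insert c T)
    have c: "fps_bounded_by (reciprocal_shift (m c)) M" using insert m by (intro reciprocal_shift_bounded) auto
    have "av (m c) * av x \<le> M * av x" using insert m av_nonneg by (intro mult_right_mono) auto
    hence "av (m c * x) < 1" using x by (simp add: av_mult)
    hence "fps_sums_to (reciprocal_shift (m c)) x (1 / (1 - 1 / x / m c))"
      using x insert m by (intro reciprocal_shift_sums_to) auto
    moreover have IH: "fps_bounded_by (\<Prod>c\<in>T. reciprocal_shift (m c)) M"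
      "fps_sums_to (\<Prod>c\<in>T. reciprocal_shift (m c)) x (\<Prod>c\<in>T. 1 / (1 - 1 / x / m c))"
      using insert by auto
    ultimately have "fps_sums_to (reciprocal_shift (m c) * (\<Prod>c\<in>T. reciprocal_shift (m c))) x
        (1 / (1 - 1 / x / m c) * (\<Prod>c\<in>T. 1 / (1 - 1 / x / m c)))"
      using c x M by (intro fps_sums_to_mult) auto
    moreover have "fps_bounded_by (reciprocal_shift (m c) * (\<Prod>c\<in>T. reciprocal_shift (m c))) M"
      using c IH M by (intro fps_bounded_by_mult) auto
    ultimately show ?case using insert(1,2) by simp
  qed
  thus "fps_sums_to (fps_X * (\<Prod>c\<in>S. reciprocal_shift (m c))) x (x * (\<Prod>c\<in>S. 1 / (1 - 1 / x / m c)))"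
    using M x bd by (intro fps_sums_to_mult fps_bounded_by_X fps_sums_to_X) auto
qed

text \<open>
  With \<open>u' = 1 / e\<^bsub>L'\<^esub>\<close>, the product formula for \<open>e\<^sub>L\<close> exhibits \<open>u = 1 / e\<^sub>L\<close> as a power series without
  constant term in \<open>u'\<close>, into which the expansion in \<open>u\<close> is substituted.
\<close>

lemma doubly_vanishes_sublattice:
  assumes L: "discrete_subgroup L" and L': "discrete_subgroup L'" and S: "finite S" "0 \<in> S"
    and bij: "bij_betw (\<lambda>(c, b). c + b) (S \<times> L') L"
    and f: "doubly_vanishes_at_infinity L f"
  shows "doubly_vanishes_at_infinity L' f"
proof -
  obtain a R where a: "a 0 = 0" "a 1 = 0"
    and R: "\<And>z. z \<in> Omega \<Longrightarrow> (\<forall>s. av (z - iota s) \<ge> R) \<Longrightarrow>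
        (\<lambda>j. av ((\<Sum>i<j. a i * (1 / lattice_exp L z) ^ i) - f z)) \<longlonglongrightarrow> 0"
    using f unfolding doubly_vanishes_at_infinity_def by blast
  show ?thesis
  proof (cases "\<exists>z\<in>Omega. \<forall>s. av (z - iota s) \<ge> max R 1")
    \<comment> \<open>Without such a point the expansion condition beyond \<open>max R 1\<close> is
      vacuous, and zero coefficients serve.\<close>
    case False
    hence "\<forall>z\<in>Omega. (\<forall>s. av (z - iota s) \<ge> max R 1) \<longrightarrow>
        (\<lambda>j. av ((\<Sum>i<j. 0 * (1 / lattice_exp L' z) ^ i) - f z)) \<longlonglongrightarrow> 0" by blast
    thus ?thesis unfolding doubly_vanishes_at_infinity_def
      by (intro exI[of _ "\<lambda>_. 0"] exI[of _ "max R 1"]) simp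
  next
    case True
    then obtain z1 where z1: "z1 \<in> Omega" "\<And>s. av (z1 - iota s) \<ge> max R 1" by blast
    \<comment> \<open>Convergence at the single point \<open>z1\<close> bounds the terms there,
      which gives |a j| <= B N^j; the 1 in \<open>max R 1\<close> ensures N >= 1.\<close>
    define N where "N = av (lattice_exp L z1)"
    have N1: "N \<ge> 1" using av_lattice_exp_ge[OF L, of "max R 1" z1] z1(2) by (simp add: N_def)
    have "(\<lambda>j. av ((\<Sum>i<j. a i * (1 / lattice_exp L z1) ^ i) - f z1)) \<longlonglongrightarrow> 0"
      using z1 by (intro R) auto
    note lim = this LIMSEQ_Suc[OF this]
    have "(\<lambda>j. av (a j * (1 / lattice_exp L z1) ^ j)) \<longlonglongrightarrow> 0"
    proof (rule av_null_comparison)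
      let ?s = "\<lambda>j. \<Sum>i<j. a i * (1 / lattice_exp L z1) ^ i"
      show "(\<lambda>j. max (av (?s (Suc j) - f z1)) (av (?s j - f z1))) \<longlonglongrightarrow> 0"
        using tendsto_max[OF lim(2) lim(1)] by simp
      show "av (a j * (1 / lattice_exp L z1) ^ j) \<le> max (av (?s (Suc j) - f z1)) (av (?s j - f z1))" for j
        using av_diff_le[of "?s (Suc j) - f z1" "?s j - f z1"] by simp
    qed
    hence "Bseq (\<lambda>j. av (a j * (1 / lattice_exp L z1) ^ j))"
      by (intro convergent_imp_Bseq convergentI)
    then obtain B where B: "B > 0" "\<And>j. norm (av (a j * (1 / lattice_exp L z1) ^ j)) \<le> B"
      by (elim BseqE) blast
    have aB: "av (a j) \<le> B * N ^ j" for j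
    proof -
      have "av (a j) * (1 / N) ^ j \<le> B"
        using B(2)[of j] av_nonneg by (simp add: av_mult av_power av_divide N_def)
      thus ?thesis using N1 by (simp add: power_divide field_simps)
    qed
    let ?e = "lattice_exp L'"
    \<comment> \<open>The values at the representatives are the growth rates of the geometric
      series; the 1 accommodates the factor X and the case that 0 is the only
      representative.\<close>
    define M where "M = Max (insert 1 ((\<lambda>c. av (?e (iota c))) ` (S - {0})))"
    have M1: "M \<ge> 1" unfolding M_def using S by (intro Max_ge) auto
    have Mc: "av (?e (iota c)) \<le> M" if "c \<in> S - {0}" for c
      unfolding M_def using S that by (intro Max_ge) auto
    have inj: "inj_on (\<lambda>(c, b). c + b) (S \<times> L')" using bij by (auto simp: bij_betw_def)
    have L'0: "0 \<in> L'" using L' by (simp add: discrete_subgroup_def add_subgroup_def)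
    have nz: "?e (iota c) \<noteq> 0" if "c \<in> S - {0}" for c
    proof (rule lattice_exp_nonzero[OF L'])
      show "iota c \<notin> iota ` L'"
      proof
        assume "iota c \<in> iota ` L'"
        hence "c \<in> L'" by auto
        hence "(c, 0) = (0, c)" using that S L'0 by (intro inj_onD[OF inj]) auto
        thus False using that by simp
      qed
    qed (use that in auto)
    define \<phi> where "\<phi> = fps_X * (\<Prod>c\<in>S - {0}. reciprocal_shift (?e (iota c)))"
    have \<phi>0: "fps_nth \<phi> 0 = 0" by (simp add: \<phi>_def)
    have \<phi>: "fps_bounded_by \<phi> M" "\<And>x. x \<noteq> 0 \<Longrightarrow> M * av x < 1 \<Longrightarrow>
        fps_sums_to \<phi> x (x * (\<Prod>c\<in>S - {0}. 1 / (1 - 1 / x / ?e (iota c))))"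
      unfolding \<phi>_def using S nz Mc M1 by (intro fps_prod_reciprocal_shift; simp)+
    define F where "F = fps_compose (Abs_fps a) \<phi>"
    \<comment> \<open>Beyond this distance the exponential of \<open>L'\<close> has size at least 2
      N M, so that N M |x| <= 1/2 for its reciprocal x, as the composition requires.\<close>
    define R' where "R' = max R (2 * N * M)"
    have NM: "1 \<le> N * M" using mult_mono[OF N1 M1] N1 by simp
    show ?thesis
      unfolding doubly_vanishes_at_infinity_def
    proof (intro exI[of _ "fps_nth F"] exI[of _ R'] conjI ballI impI)
      \<comment> \<open>Coefficients 0 and 1 of a composite involve only \<open>a 0\<close> and
        \<open>a 1\<close>, so double vanishing survives.\<close>
      show "fps_nth F 0 = 0" by (simp add: F_def fps_compose_nth a)
      show "fps_nth F 1 = 0" using a by (simp add: F_def fps_compose_nth)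
      fix z assume z: "z \<in> Omega" "\<forall>s. av (z - iota s) \<ge> R'"
      define x where "x = 1 / ?e z"
      have "R' \<le> av (?e z)" using av_lattice_exp_ge[OF L', of R' z] z by simp
      hence e: "2 * N * M \<le> av (?e z)" by (simp add: R'_def)
      hence "av (?e z) > 0" using NM by simp
      hence e0: "?e z \<noteq> 0" by auto
      have Nx: "N * (M * av x) < 1"
        using e NM \<open>av (?e z) > 0\<close> by (simp add: x_def av_divide field_simps)
      have x: "x \<noteq> 0" "M * av x < 1"
      proof -
        show "x \<noteq> 0" using e0 by (simp add: x_def)
        have "1 * (M * av x) \<le> N * (M * av x)" using N1 M1 av_nonneg by (intro mult_right_mono) auto
        thus "M * av x < 1" using Nx by simp
      qed
      have "x * (\<Prod>c\<in>S - {0}. 1 / (1 - 1 / x / ?e (iota c))) = 1 / lattice_exp L z"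
        unfolding lattice_exp_overlattice[OF L L' S bij] x_def by (simp add: prod_dividef)
      hence "fps_sums_to \<phi> x (1 / lattice_exp L z)" using \<phi>(2)[OF x] by simp
      moreover have "fps_sums_to (Abs_fps a) (1 / lattice_exp L z) (f z)"
        using R[OF z(1)] z(2) by (simp add: fps_sums_to_def R'_def)
      ultimately have "fps_sums_to F x (f z)"
        unfolding F_def using \<phi>0 \<phi>(1) aB M1 N1 B(1) Nx by (intro fps_sums_to_compose) auto
      thus "(\<lambda>j. av ((\<Sum>i<j. fps_nth F i * (1 / ?e z) ^ i) - f z)) \<longlonglongrightarrow> 0"
        by (simp add: fps_sums_to_def x_def)
    qed
  qed
qed

lemma doubly_vanishes_add:
  assumes "doubly_vanishes_at_infinity L f" "doubly_vanishes_at_infinity L g"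
  shows "doubly_vanishes_at_infinity L (\<lambda>z. f z + g z)"
proof -
  obtain a R where a: "a 0 = 0" "a 1 = 0"
    and R: "\<And>z. z \<in> Omega \<Longrightarrow> (\<forall>s. av (z - iota s) \<ge> R) \<Longrightarrow>
        (\<lambda>j. av ((\<Sum>i<j. a i * (1 / lattice_exp L z) ^ i) - f z)) \<longlonglongrightarrow> 0"
    using assms(1) unfolding doubly_vanishes_at_infinity_def by blast
  obtain a' R' where a': "a' 0 = 0" "a' 1 = 0"
    and R': "\<And>z. z \<in> Omega \<Longrightarrow> (\<forall>s. av (z - iota s) \<ge> R') \<Longrightarrow>
        (\<lambda>j. av ((\<Sum>i<j. a' i * (1 / lattice_exp L z) ^ i) - g z)) \<longlonglongrightarrow> 0"
    using assms(2) unfolding doubly_vanishes_at_infinity_def by blast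
  show ?thesis unfolding doubly_vanishes_at_infinity_def
  proof (intro exI[of _ "\<lambda>i. a i + a' i"] exI[of _ "max R R'"] conjI ballI impI)
    fix z assume z: "z \<in> Omega" "\<forall>s. av (z - iota s) \<ge> max R R'"
    have "(\<lambda>j. av ((\<Sum>i<j. a i * (1 / lattice_exp L z) ^ i) + (\<Sum>i<j. a' i * (1 / lattice_exp L z) ^ i)
        - (f z + g z))) \<longlonglongrightarrow> 0"
      using z by (intro av_limit_add R R') auto
    thus "(\<lambda>j. av ((\<Sum>i<j. (a i + a' i) * (1 / lattice_exp L z) ^ i) - (f z + g z))) \<longlonglongrightarrow> 0"
      by (simp add: distrib_right sum.distrib)
  qed (use a a' in auto)
qed

end

subsection \<open>Cusp lattices and the degeneracy map\<close>

definition ideal_Kinf :: "'k::field poly \<Rightarrow> 'k fls set" where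
  "ideal_Kinf n = {A_to_Kinf (n * p) | p. True}"

lemma finite_poly_degree_le: "finite {p :: 'k::{zero,finite} poly. degree p \<le> d}"
proof (rule finite_subset)
  show "{p :: 'k poly. degree p \<le> d} \<subseteq> Poly ` {xs. set xs \<subseteq> UNIV \<and> length xs \<le> Suc d}"
  proof
    fix p :: "'k poly" assume "p \<in> {p. degree p \<le> d}"
    hence "length (coeffs p) \<le> Suc d" by (cases "p = 0") (simp_all add: length_coeffs_degree)
    thus "p \<in> Poly ` {xs. set xs \<subseteq> UNIV \<and> length xs \<le> Suc d}"
      by (intro image_eqI[of _ _ "coeffs p"]) auto
  qed
  show "finite (Poly ` {xs :: 'k list. set xs \<subseteq> UNIV \<and> length xs \<le> Suc d})"
    by (intro finite_imageI finite_lists_length_le) simp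
qed

lemma ideal_Kinf_0: "0 \<in> ideal_Kinf n"
  unfolding ideal_Kinf_def by (auto intro!: exI[of _ 0])

lemma ideal_Kinf_add: "x \<in> ideal_Kinf n \<Longrightarrow> y \<in> ideal_Kinf n \<Longrightarrow> x + y \<in> ideal_Kinf n"
  unfolding ideal_Kinf_def by (auto simp flip: A_to_Kinf_add distrib_left)

lemma ideal_Kinf_mult: "x \<in> ideal_Kinf n \<Longrightarrow> A_to_Kinf p * x \<in> ideal_Kinf n"
  unfolding ideal_Kinf_def by (auto simp flip: A_to_Kinf_mult) (metis mult.left_commute)

lemma ideal_Kinf_uminus_iff: "- x \<in> ideal_Kinf n \<longleftrightarrow> x \<in> ideal_Kinf n"
  using ideal_Kinf_mult[of x n "-1"] ideal_Kinf_mult[of "-x" n "-1"] by (auto simp: A_to_Kinf_minus)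

section \<open>Unipotent stabilisers of cusps\<close>

context completed_alg_closure
begin

lemma ideal_Kinf_mult_iff:
  assumes "v \<noteq> 0"
  shows "x \<in> ideal_Kinf (n * v) \<longleftrightarrow> x / A_to_Kinf v \<in> ideal_Kinf (n :: 'k poly)"
proof
  have V: "A_to_Kinf v \<noteq> 0" using assms by (simp add: A_to_Kinf_eq_0_iff)
  {
    assume "x \<in> ideal_Kinf (n * v)"
    then obtain p where "x = A_to_Kinf (n * v * p)" by (auto simp: ideal_Kinf_def)
    hence "x / A_to_Kinf v = A_to_Kinf (n * p)" using V by (simp add: A_to_Kinf_mult)
    thus "x / A_to_Kinf v \<in> ideal_Kinf n" by (auto simp: ideal_Kinf_def)
  next
    assume "x / A_to_Kinf v \<in> ideal_Kinf n"
    then obtain p where "x / A_to_Kinf v = A_to_Kinf (n * p)" by (auto simp: ideal_Kinf_def)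
    hence "x = A_to_Kinf (n * v * p)" using V by (simp add: A_to_Kinf_mult field_simps)
    thus "x \<in> ideal_Kinf (n * v)" by (auto simp: ideal_Kinf_def)
  }
qed

text \<open>Conjugating a translation by \<open>N\<close> gives the transvection along the first
  column of \<open>N\<close>, with parameter b / det N. So the lattice is determined by this column
  and the determinant.\<close>

lemma cusp_lattice_eq:
  assumes "det N \<noteq> 0"
  shows "cusp_lattice G N = {b. unipotent (N$1$1) (N$2$1) (b / det N) \<in> (G :: ('k fls ^ 2 ^ 2) set)}"
proof -
  let ?U = "\<lambda>b. unipotent (N$1$1) (N$2$1) (b / det N)"
  define N' where "N' = mat2 (N$2$2 / det N) (- N$1$2 / det N) (- N$2$1 / det N) (N$1$1 / det N)"
  have NN': "N ** N' = mat 1"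
  proof (rule mat2_eqI)
    have d: "N$1$1 * N$2$2 - N$1$2 * N$2$1 = det N" by (simp add: det_2)
    show "(N ** N') $ 1 $ 1 = (mat 1 :: 'k fls ^ 2 ^ 2) $ 1 $ 1"
      using d assms by (simp add: matrix_mult_nth2 N'_def flip: diff_divide_distrib)
    show "(N ** N') $ 2 $ 2 = (mat 1 :: 'k fls ^ 2 ^ 2) $ 2 $ 2"
      using d assms by (simp add: matrix_mult_nth2 N'_def mult.commute flip: diff_divide_distrib)
  qed (simp_all add: matrix_mult_nth2 N'_def mult.commute)
  have U: "?U b ** N = N ** mat2 1 b 0 1" for b
  proof -
    have "unipotent (N$1$1) (N$2$1) s ** N = N ** mat2 1 (s * det N) 0 1" for s
      unfolding det_2
      by (rule mat2_eqI) (simp_all add: matrix_mult_nth2 unipotent_def algebra_simps power2_eq_square)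
    from this[of "b / det N"] show ?thesis using assms by simp
  qed
  have "M ** N = N ** mat2 1 b 0 1 \<longleftrightarrow> M = ?U b" for M b
  proof
    assume "M ** N = N ** mat2 1 b 0 1"
    hence "M ** N ** N' = ?U b ** N ** N'" by (simp add: U)
    thus "M = ?U b" by (simp add: NN' flip: matrix_mul_assoc)
  qed (simp add: U)
  thus ?thesis by (auto simp: cusp_lattice_def)
qed

lemma unipotent_in_Gamma_principal_iff:
  "unipotent x y s \<in> Gamma_principal (n :: 'k poly) \<longleftrightarrow>
    s * x * y \<in> ideal_Kinf n \<and> s * x\<^sup>2 \<in> ideal_Kinf n \<and> s * y\<^sup>2 \<in> ideal_Kinf n" (is "?U \<in> _ \<longleftrightarrow> ?R")
proof
  assume "?U \<in> Gamma_principal n"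
  then obtain a b c d where *: "n dvd a - 1" "n dvd b" "n dvd c"
    "?U = mat2 (A_to_Kinf a) (A_to_Kinf b) (A_to_Kinf c) (A_to_Kinf d)" by (rule Gamma_principalE) blast
  have "1 - s * x * y = A_to_Kinf a" "s * x\<^sup>2 = A_to_Kinf b" "- s * y\<^sup>2 = A_to_Kinf c"
    using arg_cong[OF *(4), of "\<lambda>M. M$1$1"] arg_cong[OF *(4), of "\<lambda>M. M$1$2"]
      arg_cong[OF *(4), of "\<lambda>M. M$2$1"] by (simp_all add: unipotent_def)
  moreover obtain p1 p2 p3 where "a - 1 = n * p1" "b = n * p2" "c = n * p3" using * by (auto elim!: dvdE)
  ultimately have "s * x * y = A_to_Kinf (n * (- p1))" "s * x\<^sup>2 = A_to_Kinf (n * p2)"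
    "s * y\<^sup>2 = A_to_Kinf (n * (- p3))"
  proof -
    assume h: "1 - s * x * y = A_to_Kinf a" "s * x\<^sup>2 = A_to_Kinf b" "- s * y\<^sup>2 = A_to_Kinf c"
      "a - 1 = n * p1" "b = n * p2" "c = n * p3"
    have "s * x * y = 1 - A_to_Kinf a" using h(1) by (simp add: algebra_simps)
    also have "\<dots> = A_to_Kinf (- (a - 1))" by (simp add: A_to_Kinf_diff)
    finally show "s * x * y = A_to_Kinf (n * (- p1))" using h(4) by simp
    show "s * x\<^sup>2 = A_to_Kinf (n * p2)" using h by simp
    have "s * y\<^sup>2 = - A_to_Kinf c" using h(3) by (metis minus_mult_left minus_minus)
    thus "s * y\<^sup>2 = A_to_Kinf (n * (- p3))" using h(6) by (simp add: A_to_Kinf_minus)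
  qed
  thus ?R unfolding ideal_Kinf_def by blast
next
  assume ?R
  then obtain p1 p2 p3 where p: "s * x * y = A_to_Kinf (n * p1)" "s * x\<^sup>2 = A_to_Kinf (n * p2)"
    "s * y\<^sup>2 = A_to_Kinf (n * p3)" unfolding ideal_Kinf_def by blast
  show "?U \<in> Gamma_principal n"
  proof (rule Gamma_principalI)
    show "?U = mat2 (A_to_Kinf (1 - n * p1)) (A_to_Kinf (n * p2)) (A_to_Kinf (- (n * p3))) (A_to_Kinf (1 + n * p1))"
      unfolding unipotent_def A_to_Kinf_diff A_to_Kinf_add A_to_Kinf_minus p[symmetric] by simp
    \<comment> \<open>The determinant condition in A comes from (s x y)^2 = (s x^2)(s y^2) and the
      injectivity of \<open>A_to_Kinf\<close>.\<close>
    have "A_to_Kinf ((n * p1) * (n * p1)) = A_to_Kinf ((n * p2) * (n * p3))"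
      unfolding A_to_Kinf_mult[of "n * p1"] A_to_Kinf_mult[of "n * p2"] p[symmetric]
      by (simp add: power2_eq_square)
    hence "(n * p1) * (n * p1) = (n * p2) * (n * p3)" by (simp only: A_to_Kinf_eq_iff)
    moreover have "(1 - x) * (1 + x) - y * (- z) = 1 - x * x + y * z" for x y z :: "'k poly"
      by (simp add: algebra_simps)
    ultimately show "(1 - n * p1) * (1 + n * p1) - n * p2 * (- (n * p3)) = 1" by (simp only:) simp
  qed simp_all
qed

text \<open>The extra condition is divisibility of the lower left entry by \<open>v\<close>; as
  \<open>v\<close> does not divide \<open>n\<close>, it combines with divisibility by
  \<open>n\<close> to divisibility by \<open>n * v\<close>.\<close>

lemma unipotent_in_Gamma0_iff:
  assumes v: "irreducible v" and n: "\<not> v dvd n"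
  shows "unipotent x y s \<in> Gamma0 v \<inter> Gamma_principal (n :: 'k poly) \<longleftrightarrow>
    s * x * y \<in> ideal_Kinf n \<and> s * x\<^sup>2 \<in> ideal_Kinf n \<and> s * y\<^sup>2 \<in> ideal_Kinf (n * v)" (is "?U \<in> _ \<longleftrightarrow> ?R")
proof
  assume U: "?U \<in> Gamma0 v \<inter> Gamma_principal n"
  hence 1: "s * x * y \<in> ideal_Kinf n" "s * x\<^sup>2 \<in> ideal_Kinf n" "s * y\<^sup>2 \<in> ideal_Kinf n"
    using unipotent_in_Gamma_principal_iff by blast+
  obtain Y where Y: "?U = matrix_to_Kinf Y" "v dvd Y$2$1" using U by (auto simp: Gamma0_def)
  obtain p where p: "s * y\<^sup>2 = A_to_Kinf (n * p)" using 1(3) unfolding ideal_Kinf_def by blast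
  have "A_to_Kinf (Y$2$1) = - s * y\<^sup>2"
    using arg_cong[OF Y(1), of "\<lambda>M. M$2$1"] by (simp add: unipotent_def)
  also have "\<dots> = A_to_Kinf (- (n * p))" by (simp add: p A_to_Kinf_minus)
  finally have "Y$2$1 = - (n * p)" by (simp only: A_to_Kinf_eq_iff)
  hence "v dvd n * p" using Y(2) by simp
  hence "v dvd p" using irreducible_poly_dvd_multD[OF v _ n] by blast
  then obtain p' where "p = v * p'" by (elim dvdE)
  hence "s * y\<^sup>2 = A_to_Kinf (n * v * p')" using p by (simp add: mult.assoc)
  thus ?R using 1 unfolding ideal_Kinf_def by blast
next
  assume R: ?R
  then obtain p where p: "s * y\<^sup>2 = A_to_Kinf (n * v * p)" unfolding ideal_Kinf_def by blast
  hence "s * y\<^sup>2 \<in> ideal_Kinf n" unfolding ideal_Kinf_def by (auto simp: mult.assoc)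
  hence U: "?U \<in> Gamma_principal n" using R unipotent_in_Gamma_principal_iff by blast
  then obtain Y where Y: "?U = matrix_to_Kinf Y" "det Y = 1" by (auto simp: Gamma_principal_def)
  have "A_to_Kinf (Y$2$1) = - s * y\<^sup>2"
    using arg_cong[OF Y(1), of "\<lambda>M. M$2$1"] by (simp add: unipotent_def)
  also have "\<dots> = A_to_Kinf (- (n * v * p))" by (simp add: p A_to_Kinf_minus)
  finally have "Y$2$1 = - (n * v * p)" by (simp only: A_to_Kinf_eq_iff)
  hence "?U \<in> Gamma0 v" unfolding Gamma0_def using Y by auto
  thus "?U \<in> Gamma0 v \<inter> Gamma_principal n" using U by blast
qed

section \<open>Comparison of the translation lattices at the two levels\<close>

definition A_submodule :: "'k fls set \<Rightarrow> bool" where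
  "A_submodule L \<longleftrightarrow> 0 \<in> L \<and> (\<forall>b\<in>L. \<forall>b'\<in>L. b + b' \<in> L) \<and> (\<forall>b\<in>L. \<forall>p. A_to_Kinf p * b \<in> L)"

lemma A_submodule_principal:
  assumes L: "A_submodule L" and sub: "L \<subseteq> {\<beta> * A_to_Kinf p | p. True}"
  shows "\<exists>\<alpha>. L = {\<alpha> * A_to_Kinf p | p. True}"
proof (cases "\<beta> = 0")
  case True
  hence "L = {0}" using sub L by (auto simp: A_submodule_def)
  thus ?thesis by (intro exI[of _ 0]) auto
next
  case False
  define I where "I = {p. \<beta> * A_to_Kinf p \<in> L}"
  have "\<exists>g. I = range (\<lambda>x. g * x)"
  proof (rule poly_ideal_principal)
    show "0 \<in> I" using L by (simp add: I_def A_submodule_def)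
    show "p + r \<in> I" if "p \<in> I" "r \<in> I" for p r
      using L that by (auto simp: I_def A_submodule_def A_to_Kinf_add distrib_left)
    show "r * p \<in> I" if "p \<in> I" for p r
      using L that by (auto simp: I_def A_submodule_def A_to_Kinf_mult mult.left_commute)
  qed
  then obtain g where g: "I = range (\<lambda>x. g * x)" by blast
  have "b \<in> L \<longleftrightarrow> (\<exists>p. b = \<beta> * A_to_Kinf g * A_to_Kinf p)" for b
  proof
    assume b: "b \<in> L"
    then obtain p where p: "b = \<beta> * A_to_Kinf p" using sub by blast
    hence "p \<in> I" using b by (simp add: I_def)
    then obtain x where "p = g * x" unfolding g by blast
    thus "\<exists>p. b = \<beta> * A_to_Kinf g * A_to_Kinf p" using p by (auto simp: A_to_Kinf_mult mult.assoc)
  next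
    assume "\<exists>p. b = \<beta> * A_to_Kinf g * A_to_Kinf p"
    then obtain p where p: "b = \<beta> * A_to_Kinf (g * p)" by (auto simp: A_to_Kinf_mult mult.assoc)
    have "g * p \<in> I" unfolding g by blast
    thus "b \<in> L" using p by (simp add: I_def)
  qed
  thus ?thesis by (intro exI[of _ "\<beta> * A_to_Kinf g"]) blast
qed

text \<open>Bounded absolute value means bounded degree, and over a finite field there are finitely
  many such polynomials.\<close>

lemma discrete_subgroup_principal:
  assumes "\<alpha> \<noteq> 0"
  shows "discrete_subgroup {\<alpha> * A_to_Kinf p | p. True}"
  unfolding discrete_subgroup_def add_subgroup_def
proof (intro conjI ballI allI)
  show "0 \<in> {\<alpha> * A_to_Kinf p | p. True}" by (auto intro!: exI[of _ 0])
  show "x - y \<in> {\<alpha> * A_to_Kinf p | p. True}"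
    if "x \<in> {\<alpha> * A_to_Kinf p | p. True}" "y \<in> {\<alpha> * A_to_Kinf p | p. True}" for x y
    using that by (auto simp flip: A_to_Kinf_diff right_diff_distrib)
  fix r :: real
  have a: "av (iota \<alpha>) > 0" using assms by (simp add: av_pos)
  obtain d where d: "r / av (iota \<alpha>) < real CARD('k) ^ d" using real_arch_pow[OF q_gt_1] by blast
  have "{b \<in> {\<alpha> * A_to_Kinf p | p. True}. abs_infinity b \<le> r} \<subseteq> (\<lambda>p. \<alpha> * A_to_Kinf p) ` {p. degree p \<le> d}"
  proof
    fix b assume "b \<in> {b \<in> {\<alpha> * A_to_Kinf p | p. True}. abs_infinity b \<le> r}"
    then obtain p where p: "b = \<alpha> * A_to_Kinf p" "av (iota b) \<le> r" by (auto simp: av_iota)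
    have "degree p \<le> d"
    proof (cases "p = 0")
      case False
      have "av (iota \<alpha>) * real CARD('k) ^ degree p \<le> r"
        using p by (simp add: iota_mult av_mult av_A_to_Kinf[OF False])
      hence "real CARD('k) ^ degree p \<le> r / av (iota \<alpha>)" using a by (simp add: field_simps)
      hence "real CARD('k) ^ degree p < real CARD('k) ^ d" using d by linarith
      thus ?thesis using power_less_imp_less_exp[OF q_gt_1] by (simp add: less_imp_le)
    qed simp
    thus "b \<in> (\<lambda>p. \<alpha> * A_to_Kinf p) ` {p. degree p \<le> d}" using p by blast
  qed
  thus "finite {b \<in> {\<alpha> * A_to_Kinf p | p. True}. abs_infinity b \<le> r}"
    by (rule finite_subset) (intro finite_imageI finite_poly_degree_le)
qed

text \<open>For L = \<alpha> A nonzero, L / v L is isomorphic to A / v, which is simple as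
  \<open>v\<close> is irreducible. So \<open>L'\<close> is \<open>L\<close>, or it is v L and the
  remainders modulo \<open>v\<close> represent the cosets.\<close>

lemma doubly_vanishes_submodule:
  assumes v: "irreducible v"
    and L: "A_submodule L" "L \<subseteq> {\<beta> * A_to_Kinf p | p. True}"
    and L': "A_submodule L'" "L' \<subseteq> L" "\<And>b. b \<in> L \<Longrightarrow> A_to_Kinf v * b \<in> L'"
    and f: "doubly_vanishes_at_infinity L f"
  shows "doubly_vanishes_at_infinity L' f"
proof -
  obtain \<alpha> where \<alpha>: "L = {\<alpha> * A_to_Kinf p | p. True}" using A_submodule_principal[OF L] by blast
  have v0: "v \<noteq> 0" using v by auto
  have V0: "A_to_Kinf v \<noteq> 0" using v0 by (simp add: A_to_Kinf_eq_0_iff)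
  show ?thesis
  proof (cases "L' = L")
    case True
    thus ?thesis using f by simp
  next
    case False
    have \<alpha>0: "\<alpha> \<noteq> 0"
    proof
      assume "\<alpha> = 0"
      hence "L = {0}" using \<alpha> by auto
      thus False using False L' by (auto simp: A_submodule_def)
    qed
    \<comment> \<open>By a Bezout identity, a multiple of \<alpha> by an element prime to
      \<open>v\<close> would generate all of \<open>L\<close> together with v L.\<close>
    have vdvd: "v dvd p" if p: "\<alpha> * A_to_Kinf p \<in> L'" for p
    proof (rule ccontr)
      assume "\<not> v dvd p"
      then obtain x y where xy: "v * x + p * y = 1" using irreducible_poly_bezout[OF v] by blast
      have "\<alpha> * A_to_Kinf r \<in> L'" for r
      proof -
        have "A_to_Kinf v * (\<alpha> * A_to_Kinf (x * r)) \<in> L'" using \<alpha> by (intro L'(3)) blast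
        moreover have "A_to_Kinf (y * r) * (\<alpha> * A_to_Kinf p) \<in> L'" using L'(1) p by (simp add: A_submodule_def)
        ultimately have "A_to_Kinf v * (\<alpha> * A_to_Kinf (x * r)) + A_to_Kinf (y * r) * (\<alpha> * A_to_Kinf p) \<in> L'"
          using L'(1) by (simp add: A_submodule_def)
        also have "A_to_Kinf v * (\<alpha> * A_to_Kinf (x * r)) + A_to_Kinf (y * r) * (\<alpha> * A_to_Kinf p)
            = \<alpha> * A_to_Kinf ((v * x + p * y) * r)"
          by (simp add: A_to_Kinf_add A_to_Kinf_mult algebra_simps)
        finally show ?thesis by (simp add: xy)
      qed
      hence "L \<subseteq> L'" using \<alpha> by auto
      thus False using False L'(2) by blast
    qed
    have L'eq: "L' = {\<alpha> * A_to_Kinf v * A_to_Kinf p | p. True}"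
    proof (intro equalityI subsetI)
      fix b assume b: "b \<in> L'"
      then obtain p where p: "b = \<alpha> * A_to_Kinf p" using L'(2) \<alpha> by blast
      then obtain r where "p = v * r" using vdvd b by (auto elim: dvdE)
      thus "b \<in> {\<alpha> * A_to_Kinf v * A_to_Kinf p | p. True}" using p by (auto simp: A_to_Kinf_mult mult.assoc)
    next
      fix b assume "b \<in> {\<alpha> * A_to_Kinf v * A_to_Kinf p | p. True}"
      then obtain p where "b = A_to_Kinf v * (\<alpha> * A_to_Kinf p)" by (auto simp: mult_ac)
      moreover have "\<alpha> * A_to_Kinf p \<in> L" using \<alpha> by blast
      ultimately show "b \<in> L'" using L'(3) by simp
    qed
    \<comment> \<open>Remainders of division by \<open>v\<close>; 0 is among them because
      \<open>v\<close> has positive degree.\<close>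
    define S where "S = (\<lambda>p. \<alpha> * A_to_Kinf p) ` {p. degree p < degree v}"
    have deg: "degree v > 0" using irreducible_poly_degree_pos[OF v] .
    show ?thesis
    proof (rule doubly_vanishes_sublattice[OF _ _ _ _ _ f])
      show "discrete_subgroup L" unfolding \<alpha> by (rule discrete_subgroup_principal[OF \<alpha>0])
      show "discrete_subgroup L'" unfolding L'eq using \<alpha>0 V0 by (intro discrete_subgroup_principal) simp
      show "finite S" unfolding S_def
        by (intro finite_imageI finite_subset[OF _ finite_poly_degree_le[of "degree v"]]) auto
      show "0 \<in> S" unfolding S_def using deg by (intro image_eqI[of _ _ 0]) auto
      show "bij_betw (\<lambda>(c, b). c + b) (S \<times> L') L"
        unfolding bij_betw_def
      proof
        show "inj_on (\<lambda>(c, b). c + b) (S \<times> L')"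
        proof (rule inj_onI)
          fix x y assume x: "x \<in> S \<times> L'" and y: "y \<in> S \<times> L'"
            and eq: "(case x of (c, b) \<Rightarrow> c + b) = (case y of (c, b) \<Rightarrow> c + b)"
          obtain p r where pr: "x = (\<alpha> * A_to_Kinf p, \<alpha> * A_to_Kinf v * A_to_Kinf r)" "degree p < degree v"
            using x by (auto simp: S_def L'eq)
          obtain p' r' where pr': "y = (\<alpha> * A_to_Kinf p', \<alpha> * A_to_Kinf v * A_to_Kinf r')" "degree p' < degree v"
            using y by (auto simp: S_def L'eq)
          have "\<alpha> * A_to_Kinf (p + v * r) = \<alpha> * A_to_Kinf (p' + v * r')"
            using eq pr(1) pr'(1) by (simp add: A_to_Kinf_add A_to_Kinf_mult distrib_left mult.assoc)
          hence "p + v * r = p' + v * r'" using \<alpha>0 by (simp add: A_to_Kinf_eq_iff)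
          hence *: "p - p' = v * (r' - r)" by (simp add: algebra_simps)
          have "r' - r = 0"
          proof (rule ccontr)
            assume "r' - r \<noteq> 0"
            hence "degree v \<le> degree (p - p')" unfolding * using v0 by (subst degree_mult_eq) auto
            moreover have "degree (p - p') < degree v" using pr(2) pr'(2) by (rule degree_diff_less)
            ultimately show False by simp
          qed
          thus "x = y" using * pr pr' by simp
        qed
        show "(\<lambda>(c, b). c + b) ` (S \<times> L') = L"
        proof (intro equalityI subsetI)
          fix b assume "b \<in> (\<lambda>(c, b). c + b) ` (S \<times> L')"
          then obtain p r where "b = \<alpha> * A_to_Kinf p + \<alpha> * A_to_Kinf v * A_to_Kinf r" by (auto simp: S_def L'eq)
          hence "b = \<alpha> * A_to_Kinf (p + v * r)" by (simp add: A_to_Kinf_add A_to_Kinf_mult distrib_left mult.assoc)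
          thus "b \<in> L" using \<alpha> by blast
        next
          fix b assume "b \<in> L"
          then obtain p where p: "b = \<alpha> * A_to_Kinf p" using \<alpha> by blast
          have "degree (p mod v) < degree v"
            using degree_mod_less[OF v0, of p] deg by (cases "p mod v = 0") auto
          hence 1: "\<alpha> * A_to_Kinf (p mod v) \<in> S" unfolding S_def by blast
          have 2: "\<alpha> * A_to_Kinf v * A_to_Kinf (p div v) \<in> L'" unfolding L'eq by blast
          have "b = \<alpha> * A_to_Kinf (p mod v + v * (p div v))" using p by simp
          hence "b = \<alpha> * A_to_Kinf (p mod v) + \<alpha> * A_to_Kinf v * A_to_Kinf (p div v)"
            by (simp only: A_to_Kinf_add A_to_Kinf_mult distrib_left mult.assoc)
          thus "b \<in> (\<lambda>(c, b). c + b) ` (S \<times> L')" using 1 2 by (intro image_eqI[of _ _ "(\<alpha> * A_to_Kinf (p mod v), \<alpha> * A_to_Kinf v * A_to_Kinf (p div v))"]) auto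
        qed
      qed
    qed
  qed
qed

text \<open>Common shape of the translation lattices: for N with first column (a, c), membership of
  the transvection in \<Gamma>(n) asks that \<open>b\<close> times a c/det N, a^2/det N and c^2/det
  N lie in n A.\<close>

definition conductor_lattice :: "'k poly \<Rightarrow> 'k fls \<Rightarrow> 'k fls \<Rightarrow> 'k fls \<Rightarrow> 'k fls set" where
  "conductor_lattice n x y z = {b. b * x \<in> ideal_Kinf n \<and> b * y \<in> ideal_Kinf n \<and> b * z \<in> ideal_Kinf n}"

lemma A_submodule_conductor_lattice: "A_submodule (conductor_lattice n x y z)"
  by (auto simp: A_submodule_def conductor_lattice_def distrib_right mult.assoc
      intro: ideal_Kinf_0 ideal_Kinf_add ideal_Kinf_mult)

lemma conductor_lattice_bounded:
  assumes "y \<noteq> 0 \<or> z \<noteq> 0"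
  shows "\<exists>\<beta>. conductor_lattice n x y z \<subseteq> {\<beta> * A_to_Kinf p | p. True}"
proof -
  have *: "\<exists>p. b = A_to_Kinf n / w * A_to_Kinf p" if bw: "b * w \<in> ideal_Kinf n" "w \<noteq> 0" for b w
  proof -
    obtain p where "b * w = A_to_Kinf n * A_to_Kinf p"
      using bw(1) unfolding ideal_Kinf_def by (auto simp: A_to_Kinf_mult)
    hence "b = A_to_Kinf n / w * A_to_Kinf p" using bw(2) by (simp add: field_simps)
    thus ?thesis by blast
  qed
  from assms show ?thesis
  proof
    assume "y \<noteq> 0"
    thus ?thesis using * unfolding conductor_lattice_def by (intro exI[of _ "A_to_Kinf n / y"]) blast
  next
    assume "z \<noteq> 0"
    thus ?thesis using * unfolding conductor_lattice_def by (intro exI[of _ "A_to_Kinf n / z"]) blast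
  qed
qed

lemma atkin_lehner_mult_nth:
  "(atkin_lehner_matrix v ** N) $ 1 $ j = N $ 2 $ j"
  "(atkin_lehner_matrix v ** N) $ 2 $ j = - A_to_Kinf v * N $ 1 $ j"
  by (simp_all add: matrix_mult_nth2 atkin_lehner_matrix_eq)

lemma det_atkin_lehner: "det (atkin_lehner_matrix v) = A_to_Kinf v"
  by (simp add: atkin_lehner_matrix_eq det_2)

text \<open>In terms of triples, \<Gamma>(n) has (x, y, z) at N and (x, v y, z/v) at W N, and the
  smaller group has (x, y, z/v) at N. The last lattice lies in both others and contains v times each
  of them, as \<open>doubly_vanishes_submodule\<close> requires.\<close>

lemma
  fixes v n :: "'k poly"
  assumes v: "irreducible v" and n: "\<not> v dvd n" and N: "det N \<noteq> 0"
  shows doubly_vanishes_at_level_Gamma0: "doubly_vanishes_at_infinity (cusp_lattice (Gamma_principal n) N) f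
      \<Longrightarrow> doubly_vanishes_at_infinity (cusp_lattice (Gamma0 v \<inter> Gamma_principal n) N) f" (is "?A1 \<Longrightarrow> ?B")
    and doubly_vanishes_at_level_Gamma0_conj:
      "doubly_vanishes_at_infinity (cusp_lattice (Gamma_principal n) (atkin_lehner_matrix v ** N)) f
      \<Longrightarrow> doubly_vanishes_at_infinity (cusp_lattice (Gamma0 v \<inter> Gamma_principal n) N) f" (is "?A2 \<Longrightarrow> ?B")
proof -
  let ?V = "A_to_Kinf v"
  have v0: "v \<noteq> 0" using v by auto
  have V0: "?V \<noteq> 0" using v0 by (simp add: A_to_Kinf_eq_0_iff)
  define x where "x = N$1$1 * N$2$1 / det N"
  define y where "y = (N$1$1)\<^sup>2 / det N"
  define z where "z = (N$2$1)\<^sup>2 / det N"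
  \<comment> \<open>A column of an invertible matrix is nonzero, which bounds the denominators in
    the lattices.\<close>
  have "N$1$1 \<noteq> 0 \<or> N$2$1 \<noteq> 0" using N by (auto simp: det_2)
  hence yz: "y \<noteq> 0 \<or> z \<noteq> 0" using N by (simp add: y_def z_def)
  have L': "cusp_lattice (Gamma0 v \<inter> Gamma_principal n) N = conductor_lattice n x y (z / ?V)"
    unfolding cusp_lattice_eq[OF N] unipotent_in_Gamma0_iff[OF v n] conductor_lattice_def
      ideal_Kinf_mult_iff[OF v0]
    by (simp add: x_def y_def z_def mult.assoc)
  have L1: "cusp_lattice (Gamma_principal n) N = conductor_lattice n x y z"
    unfolding cusp_lattice_eq[OF N] unipotent_in_Gamma_principal_iff conductor_lattice_def
    by (simp add: x_def y_def z_def mult.assoc)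
  have L2: "cusp_lattice (Gamma_principal n) (atkin_lehner_matrix v ** N)
      = conductor_lattice n x (?V * y) (z / ?V)"
  proof -
    have dWN: "det (atkin_lehner_matrix v ** N) = ?V * det N" by (simp add: det_mul det_atkin_lehner)
    hence dn0: "det (atkin_lehner_matrix v ** N) \<noteq> 0" using V0 N by simp
    have "b / (?V * det N) * N$2$1 * (- ?V * N$1$1) = - (b * x)"
      "b / (?V * det N) * (N$2$1)\<^sup>2 = b * (z / ?V)"
      "b / (?V * det N) * (- ?V * N$1$1)\<^sup>2 = b * (?V * y)" for b
      using V0 by (simp_all add: x_def y_def z_def power2_eq_square)
    thus ?thesis
      unfolding cusp_lattice_eq[OF dn0] unipotent_in_Gamma_principal_iff conductor_lattice_def
        atkin_lehner_mult_nth dWN by (auto simp: ideal_Kinf_uminus_iff)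
  qed
  have mult: "b * w \<in> ideal_Kinf n \<Longrightarrow> ?V * b * w \<in> ideal_Kinf n" for b w
    using ideal_Kinf_mult[of "b * w" n v] by (simp add: mult.assoc)
  show "?A1 \<Longrightarrow> ?B"
  proof -
    assume A: ?A1
    obtain \<beta> where \<beta>: "conductor_lattice n x y z \<subseteq> {\<beta> * A_to_Kinf p | p. True}"
      using conductor_lattice_bounded[OF yz] by blast
    show ?B unfolding L'
    proof (rule doubly_vanishes_submodule[OF v A_submodule_conductor_lattice \<beta> A_submodule_conductor_lattice])
      show "conductor_lattice n x y (z / ?V) \<subseteq> conductor_lattice n x y z"
      proof
        fix b assume b: "b \<in> conductor_lattice n x y (z / ?V)"
        hence "?V * (b * (z / ?V)) \<in> ideal_Kinf n" unfolding conductor_lattice_def by (blast intro: ideal_Kinf_mult)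
        hence "b * z \<in> ideal_Kinf n" using V0 by simp
        thus "b \<in> conductor_lattice n x y z" using b by (simp add: conductor_lattice_def)
      qed
      show "?V * b \<in> conductor_lattice n x y (z / ?V)" if b: "b \<in> conductor_lattice n x y z" for b
      proof -
        have "?V * b * (z / ?V) = b * z" using V0 by simp
        thus ?thesis using b mult unfolding conductor_lattice_def by simp
      qed
      show "doubly_vanishes_at_infinity (conductor_lattice n x y z) f" using A unfolding L1 .
    qed
  qed
  show "?A2 \<Longrightarrow> ?B"
  proof -
    assume A: ?A2
    have "?V * y \<noteq> 0 \<or> z / ?V \<noteq> 0" using yz V0 by simp
    then obtain \<beta> where \<beta>: "conductor_lattice n x (?V * y) (z / ?V) \<subseteq> {\<beta> * A_to_Kinf p | p. True}"
      using conductor_lattice_bounded by blast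
    show ?B unfolding L'
    proof (rule doubly_vanishes_submodule[OF v A_submodule_conductor_lattice \<beta> A_submodule_conductor_lattice])
      show "conductor_lattice n x y (z / ?V) \<subseteq> conductor_lattice n x (?V * y) (z / ?V)"
      proof
        fix b assume b: "b \<in> conductor_lattice n x y (z / ?V)"
        hence "?V * (b * y) \<in> ideal_Kinf n" unfolding conductor_lattice_def by (blast intro: ideal_Kinf_mult)
        hence "b * (?V * y) \<in> ideal_Kinf n" by (simp add: mult.left_commute)
        thus "b \<in> conductor_lattice n x (?V * y) (z / ?V)" using b by (simp add: conductor_lattice_def)
      qed
      show "?V * b \<in> conductor_lattice n x y (z / ?V)" if b: "b \<in> conductor_lattice n x (?V * y) (z / ?V)" for b
      proof -
        have b': "b * x \<in> ideal_Kinf n" "b * (?V * y) \<in> ideal_Kinf n" "b * (z / ?V) \<in> ideal_Kinf n"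
          using b by (auto simp: conductor_lattice_def)
        have "?V * b * y \<in> ideal_Kinf n" using b'(2) by (simp only: mult_ac)
        thus ?thesis using mult[OF b'(1)] mult[OF b'(3)] unfolding conductor_lattice_def by blast
      qed
      show "doubly_vanishes_at_infinity (conductor_lattice n x (?V * y) (z / ?V)) f" using A unfolding L2 .
    qed
  qed
qed

section \<open>Well-definedness of the degeneracy map\<close>

lemma atkin_lehner_GL2_K:
  fixes v :: "'k poly"
  assumes "v \<noteq> 0" "N \<in> GL2_K"
  shows "atkin_lehner_matrix v ** N \<in> GL2_K"
proof -
  have K: "- A_to_Kinf v * x \<in> K_in_Kinf" if x: "x \<in> K_in_Kinf" for x
  proof -
    obtain a b where ab: "x = A_to_Kinf a / A_to_Kinf b" "b \<noteq> 0" using x by (auto simp: K_in_Kinf_def)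
    hence "- A_to_Kinf v * x = A_to_Kinf (- v * a) / A_to_Kinf b" by (simp add: A_to_Kinf_mult A_to_Kinf_minus)
    thus ?thesis unfolding K_in_Kinf_def using ab(2) by blast
  qed
  have "det (atkin_lehner_matrix v ** N) \<noteq> 0"
    using assms by (simp add: det_mul det_atkin_lehner GL2_K_def A_to_Kinf_eq_0_iff)
  moreover have "\<forall>i j. (atkin_lehner_matrix v ** N) $ i $ j \<in> K_in_Kinf"
    using assms(2) K by (simp add: GL2_K_def forall_2 atkin_lehner_mult_nth)
  ultimately show ?thesis by (simp add: GL2_K_def)
qed

text \<open>Conjugation turns (a, b; c, d) into (d, -c/v; -v b, a), and c/v is still divisible by
  \<open>n\<close> because \<open>v\<close> does not divide \<open>n\<close>.\<close>

lemma Gamma0_atkin_lehner_conj: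
  fixes v n :: "'k poly"
  assumes v: "irreducible v" and n: "\<not> v dvd n" and M: "M \<in> Gamma0 v \<inter> Gamma_principal n"
  shows "\<exists>M'\<in>Gamma_principal n. atkin_lehner_matrix v ** M = M' ** atkin_lehner_matrix v \<and> det M \<noteq> 0"
proof -
  obtain a b c d where *: "a * d - b * c = 1" "n dvd a - 1" "n dvd b" "n dvd c" "n dvd d - 1"
    "M = mat2 (A_to_Kinf a) (A_to_Kinf b) (A_to_Kinf c) (A_to_Kinf d)"
    using M by (elim IntE Gamma_principalE)
  obtain Y where Y: "M = matrix_to_Kinf Y" "v dvd Y$2$1" using M by (auto simp: Gamma0_def)
  have "A_to_Kinf (Y$2$1) = A_to_Kinf c"
    using arg_cong[OF Y(1), of "\<lambda>M. M$2$1"] by (simp add: *(6))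
  hence "v dvd c" using Y(2) by (simp add: A_to_Kinf_eq_iff)
  moreover obtain k where k: "c = n * k" using *(4) by (elim dvdE)
  ultimately have "v dvd k" using irreducible_poly_dvd_multD[OF v _ n] by blast
  then obtain l where l: "k = v * l" by (elim dvdE)
  have c: "c = v * (n * l)" by (simp add: k l mult.left_commute)
  define M' where "M' = mat2 (A_to_Kinf d) (A_to_Kinf (- (n * l))) (A_to_Kinf (- (b * v))) (A_to_Kinf a)"
  have "M' \<in> Gamma_principal n"
  proof (rule Gamma_principalI[OF _ _ _ _ _ M'_def])
    show "d * a - - (n * l) * - (b * v) = 1" using *(1) by (simp add: c algebra_simps)
  qed (use * in auto)
  moreover have "atkin_lehner_matrix v ** M = M' ** atkin_lehner_matrix v"
    by (rule mat2_eqI) (simp_all add: atkin_lehner_matrix_eq matrix_mult_nth2 *(6) M'_def c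
        A_to_Kinf_mult A_to_Kinf_minus mult_ac)
  moreover have "det M \<noteq> 0"
  proof -
    have "det M = A_to_Kinf (a * d - b * c)" by (simp add: det_2 *(6) A_to_Kinf_diff A_to_Kinf_mult)
    thus ?thesis by (simp add: *(1))
  qed
  ultimately show ?thesis by blast
qed

lemma double_cusp_formsD:
  assumes "f \<in> double_cusp_forms k m G"
  shows "z \<notin> Omega \<Longrightarrow> f z = 0" "rigid_analytic f" "M \<in> G \<Longrightarrow> slash k m f M = f"
    "N \<in> GL2_K \<Longrightarrow> doubly_vanishes_at_infinity (cusp_lattice G N) (slash k m f N)"
  using assms by (auto simp: double_cusp_forms_def)

lemma degeneracy_map_eq:
  assumes "\<And>z. z \<notin> Omega \<Longrightarrow> f z = 0" "\<And>z. z \<notin> Omega \<Longrightarrow> g z = 0"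
  shows "degeneracy_map v (f, g) = (\<lambda>z. f z + slash 2 1 g (atkin_lehner_matrix v) z)"
  unfolding degeneracy_map_def proj'_pullback_def proj_pullback_def pullback_eq_slash o_def
  using slash_mat_1[of f 2 1, OF assms(1)] slash_mat_1[of g 2 1, OF assms(2)] by simp

lemma degeneracy_map_well_defined:
  fixes v n :: "'k poly"
  assumes v: "irreducible v" and n: "\<not> v dvd n"
    and f: "f \<in> double_cusp_forms 2 1 (Gamma_principal n)"
    and g: "g \<in> double_cusp_forms 2 1 (Gamma_principal n)"
  shows "degeneracy_map v (f, g) \<in> double_cusp_forms 2 1 (Gamma0 v \<inter> Gamma_principal n)"
proof -
  let ?W = "atkin_lehner_matrix v"
  have v0: "v \<noteq> 0" using v by auto
  have detW: "det ?W \<noteq> 0" using v0 by (simp add: det_atkin_lehner A_to_Kinf_eq_0_iff)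
  note f = double_cusp_formsD[OF f] and g = double_cusp_formsD[OF g]
  have "(\<lambda>z. f z + slash 2 1 g ?W z) \<in> double_cusp_forms 2 1 (Gamma0 v \<inter> Gamma_principal n)"
    unfolding double_cusp_forms_def mem_Collect_eq
  proof (intro conjI allI impI ballI)
    show "f z + slash 2 1 g ?W z = 0" if "z \<notin> Omega" for z
      using f(1)[OF that] that by (simp add: slash_def)
    show "rigid_analytic (\<lambda>z. f z + slash 2 1 g ?W z)"
      using f(2) rigid_analytic_atkin_lehner[OF g(2) v0] by (rule rigid_analytic_add)
    show "slash 2 1 (\<lambda>z. f z + slash 2 1 g ?W z) M = (\<lambda>z. f z + slash 2 1 g ?W z)"
      if M: "M \<in> Gamma0 v \<inter> Gamma_principal n" for M
    proof -
      obtain M' where M': "M' \<in> Gamma_principal n" "?W ** M = M' ** ?W" "det M \<noteq> 0"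
        using Gamma0_atkin_lehner_conj[OF v n M] by blast
      have "slash 2 1 (slash 2 1 g ?W) M = slash 2 1 (slash 2 1 g M') ?W"
        using slash_mult[OF M'(3), of 2 1 g ?W] slash_mult[OF detW, of 2 1 g M'] M'(2) by simp
      also have "\<dots> = slash 2 1 g ?W" using g(3)[OF M'(1)] by simp
      finally have "slash 2 1 (slash 2 1 g ?W) M = slash 2 1 g ?W" .
      moreover have "slash 2 1 f M = f" using M by (intro f(3)) blast
      ultimately show ?thesis unfolding slash_add by simp
    qed
    show "doubly_vanishes_at_infinity (cusp_lattice (Gamma0 v \<inter> Gamma_principal n) N)
        (slash 2 1 (\<lambda>z. f z + slash 2 1 g ?W z) N)" if N: "N \<in> GL2_K" for N
    proof -
      have dN: "det N \<noteq> 0" using N by (simp add: GL2_K_def)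
      have "doubly_vanishes_at_infinity (cusp_lattice (Gamma0 v \<inter> Gamma_principal n) N) (slash 2 1 f N)"
        by (rule doubly_vanishes_at_level_Gamma0[OF v n dN f(4)[OF N]])
      \<comment> \<open>Slashing by \<open>?W\<close> and then by \<open>N\<close> is slashing by
        the product, so the second summand behaves at the cusp of \<open>N\<close> as
        \<open>g\<close> does at the cusp of \<open>?W ** N\<close>.\<close>
      moreover have "doubly_vanishes_at_infinity (cusp_lattice (Gamma0 v \<inter> Gamma_principal n) N)
          (slash 2 1 g (?W ** N))"
        by (rule doubly_vanishes_at_level_Gamma0_conj[OF v n dN g(4)[OF atkin_lehner_GL2_K[OF v0 N]]])
      ultimately show ?thesis unfolding slash_add slash_mult[OF dN] by (rule doubly_vanishes_add)
    qed
  qed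
  thus ?thesis using degeneracy_map_eq[of f g v, OF f(1) g(1)] by simp
qed

section \<open>Injectivity\<close>

lemma degeneracy_kernel_trivial:
  fixes v n :: "'k poly"
  assumes v: "irreducible v" and n: "n \<noteq> 0" "\<not> v dvd n"
    and f: "\<And>z. z \<notin> Omega \<Longrightarrow> f z = 0" "rigid_analytic f"
      "\<And>M. M \<in> Gamma_principal n \<Longrightarrow> slash 2 1 f M = f"
    and g: "\<And>z. z \<notin> Omega \<Longrightarrow> g z = 0" "rigid_analytic g"
      "\<And>M. M \<in> Gamma_principal n \<Longrightarrow> slash 2 1 g M = g"
    and gf: "slash 2 1 g (atkin_lehner_matrix v) = (\<lambda>z. - f z)"
  shows "f z = 0 \<and> g z = 0"
proof -
  let ?A = A_to_Kinf
  have v0: "v \<noteq> 0" using v by auto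
  have V0: "?A v \<noteq> 0" "?A n \<noteq> 0" using v0 n by (simp_all add: A_to_Kinf_eq_0_iff)
  \<comment> \<open>Applying the involution once more recovers \<open>g\<close> and makes the
    relation between \<open>f\<close> and \<open>g\<close> symmetric.\<close>
  have "(\<lambda>z. - slash 2 1 f (atkin_lehner_matrix v) z) = g"
    using slash_atkin_lehner_twice[of g v, OF g(1) v0] unfolding gf slash_uminus .
  hence fg: "slash 2 1 f (atkin_lehner_matrix v) = (\<lambda>z. - g z)" by auto
  define b where "b = (\<lambda>j. ?A n / ?A v ^ j)"
  \<comment> \<open>The cusp (1 : 0) is infinity, where transvections are translations.\<close>
  have "unipotent 1 0 s = mat2 1 s 0 1" for s :: "'k fls" by (simp add: unipotent_def)
  hence inv: "slash 2 1 f (mat2 1 (b j) 0 1) = f \<and> slash 2 1 g (mat2 1 (b j) 0 1) = g" for j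
    using unipotent_invariance[OF v n(2) f(3) g(3) fg gf, of 1 1 0 0 j] by (simp add: b_def)
  define Q where "Q = av (iota (?A v))"
  \<comment> \<open>The positive degree of \<open>v\<close> makes the translations
    \<open>b j\<close> pairwise distinct and lets them tend to 0.\<close>
  have Q: "Q > 1"
    using q_gt_1 irreducible_poly_degree_pos[OF v] unfolding Q_def av_A_to_Kinf[OF v0]
    by (intro one_less_power) auto
  have inj: "inj b"
  proof (rule injI)
    fix i j assume "b i = b j"
    hence "?A v ^ i = ?A v ^ j" using V0 by (simp add: b_def field_simps)
    hence "Q ^ i = Q ^ j" by (metis Q_def av_power iota_power)
    thus "i = j" using Q by simp
  qed
  have "av (iota (b j)) = av (iota (?A n)) * (1 / Q) ^ j" for j
    by (simp add: b_def iota_divide av_divide iota_power av_power Q_def power_one_over)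
  moreover have "(\<lambda>j. av (iota (?A n)) * (1 / Q) ^ j) \<longlonglongrightarrow> 0"
    using Q by (intro tendsto_mult_right_zero LIMSEQ_realpow_zero) auto
  ultimately have lim: "(\<lambda>j. av (iota (b j))) \<longlonglongrightarrow> 0" by simp
  \<comment> \<open>Its automorphy factor n z + 1 is nonconstant since \<open>n\<close> is
    nonzero.\<close>
  have L: "mat2 1 0 (?A n) 1 \<in> Gamma_principal n"
    by (rule Gamma_principalI[of 1 1 0 n]) simp_all
  show ?thesis
    using vanishes_if_translations_accumulate[of f b "?A n" z, OF f(2,1) inj lim _ V0(2) f(3)[OF L]]
      vanishes_if_translations_accumulate[of g b "?A n" z, OF g(2,1) inj lim _ V0(2) g(3)[OF L]] inv by blast
qed

lemma degeneracy_map_injective: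
  fixes v n :: "'k poly"
  assumes v: "irreducible v" and n: "n \<noteq> 0" "\<not> v dvd n"
  shows "inj_on (degeneracy_map v)
    (double_cusp_forms 2 1 (Gamma_principal n) \<times> double_cusp_forms 2 1 (Gamma_principal n))"
proof (rule inj_onI, clarify)
  fix f1 g1 f2 g2
  assume forms: "f1 \<in> double_cusp_forms 2 1 (Gamma_principal n)" "g1 \<in> double_cusp_forms 2 1 (Gamma_principal n)"
      "f2 \<in> double_cusp_forms 2 1 (Gamma_principal n)" "g2 \<in> double_cusp_forms 2 1 (Gamma_principal n)"
    and eq: "degeneracy_map v (f1, g1) = degeneracy_map v (f2, g2)"
  note F1 = double_cusp_formsD[OF forms(1)] and G1 = double_cusp_formsD[OF forms(2)]
    and F2 = double_cusp_formsD[OF forms(3)] and G2 = double_cusp_formsD[OF forms(4)]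
  let ?W = "atkin_lehner_matrix v"
  have "f1 z + slash 2 1 g1 ?W z = f2 z + slash 2 1 g2 ?W z" for z
    using fun_cong[OF eq, of z] degeneracy_map_eq[of f1 g1 v, OF F1(1) G1(1)]
      degeneracy_map_eq[of f2 g2 v, OF F2(1) G2(1)] by simp
  hence "slash 2 1 g1 ?W z - slash 2 1 g2 ?W z = - (f1 z - f2 z)" for z
    by (simp add: algebra_simps)
  \<comment> \<open>Linearity of the slash operator moves the equality of images onto the
    differences, which reduces injectivity to the kernel.\<close>
  hence gf: "slash 2 1 (\<lambda>z. g1 z - g2 z) ?W = (\<lambda>z. - (f1 z - f2 z))" unfolding slash_diff by blast
  have "f1 z - f2 z = 0 \<and> g1 z - g2 z = 0" for z
  proof (rule degeneracy_kernel_trivial[OF v n _ _ _ _ _ _ gf])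
    show "rigid_analytic (\<lambda>z. f1 z - f2 z)" using F1(2) F2(2) by (rule rigid_analytic_diff)
    show "rigid_analytic (\<lambda>z. g1 z - g2 z)" using G1(2) G2(2) by (rule rigid_analytic_diff)
    show "slash 2 1 (\<lambda>z. f1 z - f2 z) M = (\<lambda>z. f1 z - f2 z)" if "M \<in> Gamma_principal n" for M
      unfolding slash_diff F1(3)[OF that] F2(3)[OF that] ..
    show "slash 2 1 (\<lambda>z. g1 z - g2 z) M = (\<lambda>z. g1 z - g2 z)" if "M \<in> Gamma_principal n" for M
      unfolding slash_diff G1(3)[OF that] G2(3)[OF that] ..
    show "f1 z - f2 z = 0" if "z \<notin> Omega" for z using F1(1)[OF that] F2(1)[OF that] by simp
    show "g1 z - g2 z = 0" if "z \<notin> Omega" for z using G1(1)[OF that] G2(1)[OF that] by simp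
  qed
  thus "f1 = f2 \<and> g1 = g2" by (auto simp: fun_eq_iff)
qed

end

theorem theorem2p2p8:
  fixes av :: "'c::field \<Rightarrow> real"
    and emb :: "'k::{field,finite} fls alg_closure \<Rightarrow> 'c"
    and v n :: "'k poly"
  assumes "completed_alg_closure av emb"
    and "CARD('k) > 4"
    and "irreducible v" and "lead_coeff v = 1"
    and "n \<noteq> 0" and "\<not> v dvd n"
  shows "completed_alg_closure.degeneracy_map emb v \<in>
           completed_alg_closure.double_cusp_forms av emb 2 1 (Gamma_principal n) \<times>
           completed_alg_closure.double_cusp_forms av emb 2 1 (Gamma_principal n) \<rightarrow>
           completed_alg_closure.double_cusp_forms av emb 2 1 (Gamma0 v \<inter> Gamma_principal n) \<and>
         inj_on (completed_alg_closure.degeneracy_map emb v)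
           (completed_alg_closure.double_cusp_forms av emb 2 1 (Gamma_principal n) \<times>
            completed_alg_closure.double_cusp_forms av emb 2 1 (Gamma_principal n))"
proof -
  interpret completed_alg_closure av emb by (rule assms(1))
  show ?thesis
    using degeneracy_map_well_defined[OF assms(3,6)] degeneracy_map_injective[OF assms(3,5,6)] by auto
qed

end
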